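(* Let $F$ be a finite field with $q$ elements, $G=\mathrm{GL}_4(F)$, and let $X_2$ be the conjugacy class in $G$ of the involution $t=I(4,2)$. Then $\operatorname{Diam}\Gamma(G,X_2)=3$. In particular, $$|\Delta_1(t)|=\begin{cases} 2q^4-q^3-2q^2+q-1 & \text{if } \operatorname{char}(F)=2,\\ q^2(q+1)^2+1 & \text{if } \operatorname{char}(F)\neq 2,\end{cases}$$ $$|\Delta_2(t)|=\begin{cases} q^2(q^5+q^4-q^3-4q^2+q+2) & \text{if } \operatorname{char}(F)=2,\\ \tfrac12(q-1)(q+1)(q^6+3q^5+q^4+3q^3+8q^2+4q+4) & \text{if } \operatorname{char}(F)\neq 2,\end{cases}$$ $$|\Delta_3(t)|=\begin{cases} q^4(q^4-q^3-q^2+1) & \text{if } \operatorname{char}(F)=2,\\ \tfrac12 q(q-1)^2(q+1)(q^4+5q^2+6q+4) & \text{if } \operatorname{char}(F)\neq 2.\end{cases}$$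
   Context: For a subset $X$ of a group $G$, the commuting graph $\Gamma(G,X)$ has vertex set $X$, and distinct $x,y\in X$ are joined by an edge iff $xy=yx$. The distance $d(x,y)$ is the number of edges in a shortest path from $x$ to $y$, and the diameter $\operatorname{Diam}\Gamma(G,X)$ of a connected graph is the maximum distance over all pairs of vertices. $\Delta_i(t)=\{x\in X_2\mid d(t,x)=i\}$, with $d$ the distance in $\Gamma(G,X_2)$. The involution $t=I(4,2)$ is $\begin{pmatrix} I_2 & 0\\ 0 & -I_2\end{pmatrix}$ if $\operatorname{char}(F)\neq 2$ and $\begin{pmatrix} I_2 & 0\\ I_2 & I_2\end{pmatrix}$ if $\operatorname{char}(F)=2$. *)

theory Defs
  imports
    "Jordan_Normal_Form.Matrix"
    "Graph_Theory.Graph_Theory"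
    "HOL-Library.Cardinality"
begin

section \<open>The general linear group and conjugacy classes\<close>

definition GL :: "nat \<Rightarrow> 'a::field mat monoid" where
  "GL n = units_of (ring_mat TYPE('a) n ())"

lemma group_GL: "group (GL n :: 'a::field mat monoid)"
proof -
  interpret ring "ring_mat TYPE('a) n ()" by (rule ring_mat)
  show ?thesis unfolding GL_def by (rule units_group)
qed

lemma GL_simps:
  shows "carrier (GL n) = Units (ring_mat TYPE('a::field) n ())"
    and "x \<otimes>\<^bsub>GL n\<^esub> y = x * (y :: 'a mat)"
    and "\<one>\<^bsub>GL n\<^esub> = (1\<^sub>m n :: 'a mat)"
  by (simp_all add: GL_def units_of_def ring_mat_def)

definition conjugacy_class :: "('a, 'b) monoid_scheme \<Rightarrow> 'a \<Rightarrow> 'a set" where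
  "conjugacy_class G x = {g \<otimes>\<^bsub>G\<^esub> x \<otimes>\<^bsub>G\<^esub> inv\<^bsub>G\<^esub> g | g. g \<in> carrier G}"

section \<open>Commuting graphs, distance and diameter\<close>

text \<open>A simple graph is encoded as a symmetric loop-free digraph whose arcs are pairs.\<close>

definition commuting_graph :: "('a, 'b) monoid_scheme \<Rightarrow> 'a set \<Rightarrow> 'a pair_pre_digraph" where
  "commuting_graph G X =
     \<lparr> pverts = X,
       parcs = {(x, y). x \<in> X \<and> y \<in> X \<and> x \<noteq> y \<and> x \<otimes>\<^bsub>G\<^esub> y = y \<otimes>\<^bsub>G\<^esub> x} \<rparr>"

lemma wf_digraph_commuting_graph: "wf_digraph (with_proj (commuting_graph G X))"
  by unfold_locales (auto simp: commuting_graph_def)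

lemma symmetric_commuting_graph: "symmetric (with_proj (commuting_graph G X))"
  by (auto simp: symmetric_def commuting_graph_def intro!: symI)

text \<open>
  With unit weights the cost of a walk is its number of edges, so the following is the length of
  a shortest path; it is infinite iff there is no path.
\<close>

definition graph_dist :: "'a pair_pre_digraph \<Rightarrow> 'a \<Rightarrow> 'a \<Rightarrow> ereal" where
  "graph_dist \<Gamma> x y = wf_digraph.\<mu> (with_proj \<Gamma>) (\<lambda>_. 1) x y"

text \<open>For a finite nonempty graph the supremum is a maximum.\<close>

definition graph_diameter :: "'a pair_pre_digraph \<Rightarrow> ereal" where
  "graph_diameter \<Gamma> = (SUP x\<in>pverts \<Gamma>. SUP y\<in>pverts \<Gamma>. graph_dist \<Gamma> x y)"

definition dist_sphere :: "'a pair_pre_digraph \<Rightarrow> nat \<Rightarrow> 'a \<Rightarrow> 'a set" where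
  "dist_sphere \<Gamma> i x = {y \<in> pverts \<Gamma>. graph_dist \<Gamma> x y = ereal (real i)}"

section \<open>The involution\<close>

definition invol_4_2 :: "'a::field mat" where
  "invol_4_2 =
     (if CHAR('a) = 2
      then four_block_mat (1\<^sub>m 2) (0\<^sub>m 2 2) (1\<^sub>m 2) (1\<^sub>m 2)
      else four_block_mat (1\<^sub>m 2) (0\<^sub>m 2 2) (0\<^sub>m 2 2) (- 1\<^sub>m 2))"

lemma invol_4_2_involution:
  "invol_4_2 \<in> carrier (GL 4 :: 'a::field mat monoid)"
  "invol_4_2 \<otimes>\<^bsub>GL 4\<^esub> invol_4_2 = (\<one>\<^bsub>GL 4\<^esub> :: 'a mat)"
  "invol_4_2 \<noteq> (\<one>\<^bsub>GL 4\<^esub> :: 'a mat)"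
proof -
  have two: "(1 :: 'a) + 1 = 0" if "CHAR('a) = 2"
    using of_nat_CHAR[where 'a = 'a] that by simp
  have neg: "(- 1 :: 'a) \<noteq> 1" if "CHAR('a) \<noteq> 2"
  proof
    assume "(- 1 :: 'a) = 1"
    hence "of_nat 2 = (0 :: 'a)" by (metis add.right_inverse of_nat_numeral one_add_one)
    hence "CHAR('a) dvd 2" by (simp only: of_nat_eq_0_iff_char_dvd)
    hence "CHAR('a) \<le> 2" and "CHAR('a) \<noteq> 0"
      by (simp add: dvd_imp_le, metis dvd_0_left zero_neq_numeral)
    moreover have "CHAR('a) \<noteq> 1" by simp
    ultimately show False using that by linarith
  qed
  have [simp]: "(1\<^sub>m 2 + 1\<^sub>m 2 :: 'a mat) = 0\<^sub>m 2 2" if "CHAR('a) = 2"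
    by (rule eq_matI) (use two that in auto)
  have [simp]: "- 0\<^sub>m 2 2 = (0\<^sub>m 2 2 :: 'a mat)"
    by (rule eq_matI) auto
  have car: "(invol_4_2 :: 'a mat) \<in> carrier_mat 4 4"
    by (auto simp: invol_4_2_def)
  have one: "four_block_mat (1\<^sub>m 2) (0\<^sub>m 2 2) (0\<^sub>m 2 2) (1\<^sub>m 2) = (1\<^sub>m 4 :: 'a mat)"
    by (rule eq_matI) auto
  have sq: "invol_4_2 * invol_4_2 = (1\<^sub>m 4 :: 'a mat)"
    by (auto simp: invol_4_2_def mult_four_block_mat[of _ 2 2 _ 2 _ 2 _ _ 2 _ 2] one)
  show "invol_4_2 \<in> carrier (GL 4 :: 'a mat monoid)"
    using car sq by (auto simp: GL_simps Units_def ring_mat_simps)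
  show "invol_4_2 \<otimes>\<^bsub>GL 4\<^esub> invol_4_2 = (\<one>\<^bsub>GL 4\<^esub> :: 'a mat)"
    using sq by (simp add: GL_simps)
  have "invol_4_2 $$ (2, 0) \<noteq> (1\<^sub>m 4 :: 'a mat) $$ (2, 0) \<or>
        invol_4_2 $$ (2, 2) \<noteq> (1\<^sub>m 4 :: 'a mat) $$ (2, 2)"
    using neg by (auto simp: invol_4_2_def)
  thus "invol_4_2 \<noteq> (\<one>\<^bsub>GL 4\<^esub> :: 'a mat)"
    by (metis GL_simps(3))
qed

end

theory Submission
  imports Defs
begin

text \<open>
  Write 4x4 matrices in 2x2 blocks, \<open>y = (a, b; c, d)\<close>. If \<open>z\<close> is in the class and commutes with \<open>t\<close>
  and \<open>y\<close>, then it commutes with \<open>ty + yt\<close>, and conversely \<open>z\<close> can usually be taken as a linear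
  polynomial in \<open>ty + yt\<close>.

  In odd characteristic \<open>y\<close> is in the class iff \<open>y\<^sup>2 = 1\<close> and \<open>y\<close> has trace 0. Then \<open>a\<close> and \<open>-d\<close> have the
  same characteristic polynomial, \<open>ty + yt\<close> is \<open>2 diag(a, -d)\<close>, and \<open>d(t, y) \<le> 2\<close> iff \<open>a\<close> has two
  distinct eigenvalues in the field or \<open>a\<close> and \<open>d\<close> are both scalar.

  In characteristic 2 put \<open>y = 1 + m\<close>; then \<open>m\<^sup>2 = 0\<close>, \<open>m\<close> has rank 2, and, in the blocks of \<open>m\<close>,
  \<open>ty + yt\<close> is \<open>(b, 0; a + d, b)\<close>. Now \<open>d(t, y) \<le> 2\<close> iff \<open>tr b = 0\<close>, because this says that \<open>b\<close> has a
  double eigenvalue.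

  In all cases \<open>d(t, y) \<le> 3\<close>: after conjugation by a block diagonal matrix and a block lower
  unitriangular one all blocks become diagonal, and a path can be written down. The cardinalities are
  obtained by fixing the corner \<open>b\<close>; the number of \<open>y\<close> with given \<open>b\<close> depends only on the rank of \<open>b\<close>.
\<close>

section \<open>2x2 matrices over a ring\<close>

text \<open>A 4x4 matrix is an element of \<open>'a m2 m2\<close>, a 2x2 matrix over the
  noncommutative ring \<open>'a m2\<close>, so block computations are ring identities and conjugacy
  needs only one definition for blocks and whole matrices. Each class is described by equations (the
  sets \<open>S\<close>) and not only as an orbit; this is what allows counting its elements with a
  prescribed corner b. The matrix ty + yt commutes with t and y because both are involutions. To
  turn it into a member of the class one needs its eigenvalues in the field: here a nonzero square
  discriminant enters in odd characteristic, and the existence of square roots in a finite field of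
  characteristic 2. The recipe breaks down when a and d, respectively b, are scalar; these cases get
  neighbours of their own. Only three numbers are counted: the size of the class, the elements
  commuting with t, and the elements at distance 3. The sphere of radius 2 follows by subtraction.
  The factor 1/2 in odd characteristic arises because a matrix with two distinct eigenvalues is
  counted once for each ordering of them.\<close>

datatype 'a m2 = M2 (m11: 'a) (m12: 'a) (m21: 'a) (m22: 'a)

instantiation m2 :: (ring_1) ring_1
begin

definition "0 = M2 0 0 0 0"
definition "1 = M2 1 0 0 1"
definition "x + y = M2 (m11 x + m11 y) (m12 x + m12 y) (m21 x + m21 y) (m22 x + m22 y)"
definition "x - y = M2 (m11 x - m11 y) (m12 x - m12 y) (m21 x - m21 y) (m22 x - m22 y)"
definition "- x = M2 (- m11 x) (- m12 x) (- m21 x) (- m22 x)"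
definition "x * y =
  M2 (m11 x * m11 y + m12 x * m21 y) (m11 x * m12 y + m12 x * m22 y)
     (m21 x * m11 y + m22 x * m21 y) (m21 x * m12 y + m22 x * m22 y)"

instance
  by standard (auto simp: zero_m2_def one_m2_def plus_m2_def minus_m2_def uminus_m2_def
      times_m2_def algebra_simps)

end

lemma M2_simps [simp]:
  "M2 a b c d + M2 a' b' c' d' = M2 (a + a') (b + b') (c + c') (d + d')"
  "M2 a b c d - M2 a' b' c' d' = M2 (a - a') (b - b') (c - c') (d - d')"
  "- M2 a b c d = M2 (- a) (- b) (- c) (- d)"
  "M2 a b c d * M2 a' b' c' d' =
    M2 (a * a' + b * c') (a * b' + b * d') (c * a' + d * c') (c * b' + d * d')"
  "M2 a b c d = 0 \<longleftrightarrow> a = 0 \<and> b = 0 \<and> c = 0 \<and> d = 0"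
  "M2 a b c d = 1 \<longleftrightarrow> a = 1 \<and> b = 0 \<and> c = 0 \<and> d = 1"
  "1 = M2 a b c d \<longleftrightarrow> a = 1 \<and> b = 0 \<and> c = 0 \<and> d = 1"
  "0 = M2 a b c d \<longleftrightarrow> a = 0 \<and> b = 0 \<and> c = 0 \<and> d = 0"
  by (auto simp: plus_m2_def minus_m2_def uminus_m2_def times_m2_def zero_m2_def one_m2_def)

lemma m2_sel_simps [simp]:
  "m11 (x + y) = m11 x + m11 y" "m12 (x + y) = m12 x + m12 y"
  "m21 (x + y) = m21 x + m21 y" "m22 (x + y) = m22 x + m22 y"
  "m11 (x - y) = m11 x - m11 y" "m12 (x - y) = m12 x - m12 y"
  "m21 (x - y) = m21 x - m21 y" "m22 (x - y) = m22 x - m22 y"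
  "m11 (- x) = - m11 x" "m12 (- x) = - m12 x" "m21 (- x) = - m21 x" "m22 (- x) = - m22 x"
  "m11 (x * y) = m11 x * m11 y + m12 x * m21 y" "m12 (x * y) = m11 x * m12 y + m12 x * m22 y"
  "m21 (x * y) = m21 x * m11 y + m22 x * m21 y" "m22 (x * y) = m21 x * m12 y + m22 x * m22 y"
  "m11 0 = 0" "m12 0 = 0" "m21 0 = 0" "m22 0 = 0"
  "m11 1 = 1" "m12 1 = 0" "m21 1 = 0" "m22 1 = 1"
  for x y :: "'a::ring_1 m2"
  by (auto simp: plus_m2_def minus_m2_def uminus_m2_def times_m2_def zero_m2_def one_m2_def)

lemma m2_eq_iff: "x = y \<longleftrightarrow> m11 x = m11 y \<and> m12 x = m12 y \<and> m21 x = m21 y \<and> m22 x = m22 y"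
  by (cases x; cases y) auto

lemma m2_ex: "(\<exists>x. P x) \<longleftrightarrow> (\<exists>a b c d. P (M2 a b c d))"
  by (metis m2.exhaust)

lemma bij_M2: "bij (\<lambda>(a, b, c, d). M2 a b c d)"
  by (rule bijI', auto) (metis m2.exhaust)

lemma card_m2_Collect: "card {x. P x} = card {(a, b, c, d). P (M2 a b c d)}"
proof -
  have "bij_betw (\<lambda>(a, b, c, d). M2 a b c d) {(a, b, c, d). P (M2 a b c d)} {x. P x}"
    by (rule bij_betw_byWitness[where f' = "\<lambda>x. (m11 x, m12 x, m21 x, m22 x)"]) auto
  thus ?thesis by (simp add: bij_betw_same_card)
qed

instance m2 :: (finite) finite
proof
  have "(UNIV :: 'a m2 set) = range (\<lambda>(a, b, c, d). M2 a b c d)"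
    using bij_M2 by (metis bij_is_surj)
  thus "finite (UNIV :: 'a m2 set)" by (metis finite finite_imageI)
qed

section \<open>Scalars, trace, determinant and conjugacy of 2x2 matrices\<close>

definition scal :: "'a::ring_1 \<Rightarrow> 'a m2" where "scal a = M2 a 0 0 a"

definition tr :: "'a::ring_1 m2 \<Rightarrow> 'a" where "tr x = m11 x + m22 x"

definition det2 :: "'a::comm_ring_1 m2 \<Rightarrow> 'a" where
  "det2 x = m11 x * m22 x - m12 x * m21 x"

definition adj2 :: "'a::comm_ring_1 m2 \<Rightarrow> 'a m2" where
  "adj2 x = M2 (m22 x) (- m12 x) (- m21 x) (m11 x)"

definition is_invertible :: "'a::ring_1 \<Rightarrow> bool" where
  "is_invertible x \<longleftrightarrow> (\<exists>y. x * y = 1 \<and> y * x = 1)"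

text \<open>Stated for an arbitrary ring, so that it serves for the blocks as well as for the 4x4
  matrices; the inverse is an explicit witness.\<close>

definition conj_to :: "'a::ring_1 \<Rightarrow> 'a \<Rightarrow> bool" where
  "conj_to x y \<longleftrightarrow> (\<exists>g g'. g * g' = 1 \<and> g' * g = 1 \<and> y = g * x * g')"

lemma conj_to_refl [simp]: "conj_to x x"
  unfolding conj_to_def by (rule exI[of _ 1])+ simp

lemma conj_cancel: "(g::'a::ring_1) * g' = 1 \<Longrightarrow> g * (g' * x) = x"
  by (metis mult.assoc mult.left_neutral)

lemma conj_to_sym: "conj_to x y \<Longrightarrow> conj_to y x"
  unfolding conj_to_def by (metis mult.assoc mult.left_neutral mult.right_neutral)

lemma conj_to_trans:
  assumes "conj_to x y" "conj_to y z" shows "conj_to x z"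
proof -
  from assms obtain g g' h h' where
    "g * g' = 1" "g' * g = 1" "y = g * x * g'" "h * h' = 1" "h' * h = 1" "z = h * y * h'"
    unfolding conj_to_def by blast
  thus ?thesis unfolding conj_to_def
    by (intro exI[of _ "h * g"] exI[of _ "g' * h'"]) (simp add: mult.assoc conj_cancel)
qed

lemma conj_toI: "g * x = y * g \<Longrightarrow> is_invertible g \<Longrightarrow> conj_to x y"
  unfolding conj_to_def is_invertible_def by (metis mult.assoc mult.right_neutral)

lemma tr_mult_commute: "tr (x * y) = tr (y * (x :: 'a::comm_ring_1 m2))"
  by (simp add: tr_def algebra_simps)

lemma tr_simps [simp]:
  "tr (x + y) = tr x + tr y" "tr (x - y) = tr x - tr y" "tr (- x) = - tr x" "tr 0 = 0"
  "tr (1 :: 'a::ring_1 m2) = 2" "tr (scal a) = 2 * a"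
  by (auto simp: tr_def scal_def mult_2)

lemma tr_conj: "g' * g = 1 \<Longrightarrow> tr (g * x * g') = tr (x :: 'a::comm_ring_1 m2)"
  by (metis mult.assoc mult.right_neutral tr_mult_commute)

lemma det2_mult: "det2 (x * y) = det2 x * det2 y"
  by (simp add: det2_def algebra_simps)

lemma det2_1 [simp]: "det2 1 = 1" by (simp add: det2_def)

lemma adj2_mult [simp]: "x * adj2 x = scal (det2 x)" "adj2 x * x = scal (det2 x)"
  by (auto simp: det2_def adj2_def scal_def m2_eq_iff algebra_simps)

lemma adj2_mult_distrib: "adj2 (x * y) = adj2 y * adj2 x"
  by (auto simp: adj2_def m2_eq_iff algebra_simps)

lemma adj2_eq: "adj2 x = scal (tr x) - x"
  by (auto simp: adj2_def scal_def tr_def m2_eq_iff)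

lemma scal_commute: "scal a * x = x * scal (a :: 'a::comm_ring_1)"
  by (auto simp: scal_def m2_eq_iff algebra_simps)

lemma scal_simps [simp]:
  "scal a + scal b = scal (a + b)" "scal a - scal b = scal (a - b)" "- scal a = scal (- a)"
  "scal a * scal b = scal (a * b)" "scal 0 = 0" "scal 1 = 1"
  "scal a = scal b \<longleftrightarrow> a = b"
  by (auto simp: scal_def m2_eq_iff)

lemma is_invertible_det2: "is_invertible x \<longleftrightarrow> det2 x \<noteq> (0 :: 'a::field)"
proof
  assume "is_invertible x"
  thus "det2 x \<noteq> 0" unfolding is_invertible_def by (metis det2_1 det2_mult mult_zero_left zero_neq_one)
next
  assume *: "det2 x \<noteq> 0"
  have "x * (scal (inverse (det2 x)) * adj2 x) = 1"
    by (metis * adj2_mult(1) mult.assoc right_inverse scal_commute scal_simps(4,6))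
  moreover have "(scal (inverse (det2 x)) * adj2 x) * x = 1"
    by (metis * adj2_mult(2) left_inverse mult.assoc scal_simps(4,6))
  ultimately show "is_invertible x" unfolding is_invertible_def by blast
qed

lemma cayley_hamilton: "x * x = scal (tr x) * x - scal (det2 x)"
  by (auto simp: tr_def det2_def scal_def m2_eq_iff algebra_simps)

definition is_scal :: "'a::ring_1 m2 \<Rightarrow> bool" where "is_scal x \<longleftrightarrow> (\<exists>a. x = scal a)"

lemma is_scal_iff: "is_scal x \<longleftrightarrow> m12 x = 0 \<and> m21 x = 0 \<and> m11 x = m22 x"
  by (auto simp: is_scal_def scal_def m2_eq_iff)

definition companion :: "'a::comm_ring_1 \<Rightarrow> 'a \<Rightarrow> 'a m2" where
  "companion t d = M2 0 (- d) 1 t"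

text \<open>A nonscalar matrix has a cyclic vector: one of e1, e2, e1 + e2 is not an eigenvector.
  The base change has columns w and x w, where w = (u, v).\<close>

lemma conj_to_companion:
  fixes x :: "'a::field m2"
  assumes "\<not> is_scal x"
  shows "conj_to (companion (tr x) (det2 x)) x"
proof -
  obtain a b c d where x: "x = M2 a b c d" by (cases x)
  have *: "conj_to (companion (tr x) (det2 x)) x"
    if "u * (c * u + d * v) - v * (a * u + b * v) \<noteq> 0" for u v
    by (rule conj_toI[where g = "M2 u (a * u + b * v) v (c * u + d * v)"])
      (use that in \<open>simp_all add: is_invertible_det2 x companion_def tr_def det2_def algebra_simps\<close>)
  consider "c \<noteq> 0" | "b \<noteq> 0" | "b = 0" "c = 0" "a \<noteq> d"
    using assms by (auto simp: is_scal_iff x)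
  thus ?thesis
  proof cases
    case 1 thus ?thesis by (intro *[of 1 0]) simp
  next
    case 2 thus ?thesis by (intro *[of 0 1]) simp
  next
    case 3 thus ?thesis by (intro *[of 1 1]) simp
  qed
qed

lemma conj_to_if_same_charpoly:
  fixes x y :: "'a::field m2"
  assumes "\<not> is_scal x" "\<not> is_scal y" "tr x = tr y" "det2 x = det2 y"
  shows "conj_to x y"
  using assms by (metis conj_to_companion conj_to_sym conj_to_trans)

text \<open>Rank normal form: swaps of rows and columns bring a nonzero entry to the upper left
  position, where \<open>*\<close> applies.\<close>

lemma diagonalize_equiv:
  fixes x :: "'a::field m2"
  assumes "x \<noteq> 0"
  obtains p q e where "is_invertible p" "is_invertible q" "x = p * M2 1 0 0 e * q" "e = 0 \<or> e = 1"
proof -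
  obtain a b c d where x: "x = M2 a b c d" by (cases x)
  have swap: "is_invertible (M2 0 1 1 0 :: 'a m2)" by (simp add: is_invertible_det2 det2_def)
  have *: "\<exists>p q e. is_invertible p \<and> is_invertible q \<and> M2 a b c d = p * M2 1 0 0 e * q \<and> (e = 0 \<or> e = 1)"
    if "a \<noteq> 0" for a b c d :: 'a
  proof (cases "a * d = b * c")
    case True
    \<comment> \<open>Rank 1: the matrix is the column (a, c) times the row (1, b/a).\<close>
    show ?thesis
      by (rule exI[of _ "M2 a 0 c 1"], rule exI[of _ "M2 1 (b / a) 0 1"], rule exI[of _ 0])
        (use that True in \<open>simp add: is_invertible_det2 det2_def field_simps\<close>)
  next
    case False
    show ?thesis
      by (rule exI[of _ "M2 a b c d"], rule exI[of _ 1], rule exI[of _ 1])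
        (use False in \<open>simp add: is_invertible_det2 det2_def field_simps\<close>)
  qed
  have unit_mult: "is_invertible (u * v)" if "is_invertible u" "is_invertible v" for u v :: "'a m2"
    using that by (simp add: is_invertible_det2 det2_mult)
  consider "a \<noteq> 0" | "b \<noteq> 0" | "c \<noteq> 0" | "d \<noteq> 0" using assms by (auto simp: x)
  thus thesis
  proof cases
    case 1 with * show thesis using that x by blast
  next
    case 2
    with *[of b a d c] obtain p q e where pq: "is_invertible p" "is_invertible q"
      "M2 b a d c = p * M2 1 0 0 e * q" "e = 0 \<or> e = 1" by blast
    have "x = p * M2 1 0 0 e * (q * M2 0 1 1 0)"
      unfolding mult.assoc[symmetric] pq(3)[symmetric] by (simp add: x)
    with pq that swap unit_mult show thesis by blast
  next
    case 3
    with *[of c d a b] obtain p q e where pq: "is_invertible p" "is_invertible q"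
      "M2 c d a b = p * M2 1 0 0 e * q" "e = 0 \<or> e = 1" by blast
    have "x = M2 0 1 1 0 * (M2 c d a b)" by (simp add: x)
    hence "x = (M2 0 1 1 0 * p) * M2 1 0 0 e * q" by (simp only: pq(3) mult.assoc)
    with pq that swap unit_mult show thesis by blast
  next
    case 4
    with *[of d c b a] obtain p q e where pq: "is_invertible p" "is_invertible q"
      "M2 d c b a = p * M2 1 0 0 e * q" "e = 0 \<or> e = 1" by blast
    have "x = M2 0 1 1 0 * (M2 d c b a) * M2 0 1 1 0" by (simp add: x)
    hence "x = (M2 0 1 1 0 * p) * M2 1 0 0 e * (q * M2 0 1 1 0)" by (simp only: pq(3) mult.assoc)
    with pq that swap unit_mult show thesis by blast
  qed
qed

section \<open>Counting 2x2 matrices over a finite field\<close>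

lemmas power_expand = power2_eq_square power3_eq_cube power4_eq_xxxx

lemma card_pairs: "card {(x, y). P x y} = (\<Sum>x\<in>UNIV. card {y. P x y})"
  for P :: "'a::finite \<Rightarrow> 'b::finite \<Rightarrow> bool"
proof -
  have "{(x, y). P x y} = Sigma UNIV (\<lambda>x. {y. P x y})" by auto
  thus ?thesis by (simp add: card_SigmaI)
qed

lemma card_fibres:
  assumes "finite S" "\<And>r. r \<in> R \<Longrightarrow> card {s \<in> S. f s = r} = n" "finite R"
  shows "card {s \<in> S. f s \<in> R} = card R * n"
proof -
  have "{s \<in> S. f s \<in> R} = (\<Union>r\<in>R. {s \<in> S. f s = r})" by auto
  also have "card \<dots> = (\<Sum>r\<in>R. card {s \<in> S. f s = r})"
    by (rule card_UN_disjoint) (use assms in auto)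
  also have "\<dots> = card R * n" using assms by simp
  finally show ?thesis .
qed

lemma card_eq_by_inverse:
  assumes "\<And>x. x \<in> A \<Longrightarrow> g (f x) = x \<and> f x \<in> B" "\<And>y. y \<in> B \<Longrightarrow> f (g y) = y \<and> g y \<in> A"
  shows "card A = card B"
  by (rule bij_betw_same_card[of f], rule bij_betw_byWitness[where f' = g]) (use assms in auto)

lemma card_UNIV_ge_1: "real CARD('a::finite) \<ge> 1"
  by (simp add: Suc_leI)

lemma card_UNIV_ge_2: "CARD('a::{field, finite}) \<ge> 2"
proof -
  have "card {0, 1 :: 'a} \<le> CARD('a)" by (rule card_mono) auto
  thus ?thesis by simp
qed

lemma card_nonzero: "real (card {x :: 'a::{field, finite}. x \<noteq> 0}) = real CARD('a) - 1"
proof -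
  have "{x :: 'a. x \<noteq> 0} = UNIV - {0}" by auto
  thus ?thesis using card_UNIV_ge_1[where 'a = 'a] by (simp add: card_Diff_subset of_nat_diff)
qed

lemma card_compl: "real (card {x :: 'a::finite. \<not> P x}) = real CARD('a) - real (card {x. P x})"
proof -
  have "CARD('a) = card {x :: 'a. P x} + card {x. \<not> P x}"
    by (subst card_Un_disjoint[symmetric]) (auto intro: arg_cong[of _ _ card])
  thus ?thesis by simp
qed

lemma card_split_Collect:
  "real (card {x :: 'a::finite. P x}) =
     real (card {x. P x \<and> Q x}) + real (card {x. P x \<and> \<not> Q x})"
proof -
  have "card {x. P x} = card {x. P x \<and> Q x} + card {x. P x \<and> \<not> Q x}"
    by (subst card_Un_disjoint[symmetric]) (auto intro: arg_cong[of _ _ card])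
  thus ?thesis by simp
qed

lemma card_mult_eq:
  fixes k :: "'a::{field, finite}"
  shows "real (card {(b, c). b * c = k}) =
    (if k = 0 then 2 * real CARD('a) - 1 else real CARD('a) - 1)"
proof (cases "k = 0")
  case False
  have "card {(b, c). b * c = k} = card {b :: 'a. b \<noteq> 0}"
    by (rule card_eq_by_inverse[where f = fst and g = "\<lambda>b. (b, k / b)"])
      (use False in \<open>auto simp: field_simps\<close>)
  thus ?thesis using False card_nonzero by simp
next
  case True
  have "{(b, c). b * c = k} = ({0} \<times> UNIV) \<union> ({b. b \<noteq> 0} \<times> {0})" using True by auto
  also have "card \<dots> = CARD('a) + card {b :: 'a. b \<noteq> 0}"
    by (subst card_Un_disjoint) (auto simp: card_cartesian_product)
  finally show ?thesis using True card_nonzero[where 'a = 'a] by simp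
qed

lemma card_m2: "card (UNIV :: 'a::finite m2 set) = CARD('a) ^ 4"
proof -
  have "card {x :: 'a m2. True} = card {(a :: 'a, b :: 'a, c :: 'a, d :: 'a). True}"
    by (rule card_m2_Collect)
  also have "{(a :: 'a, b :: 'a, c :: 'a, d :: 'a). True} = UNIV" by auto
  finally show ?thesis by (simp add: power4_eq_xxxx card_prod)
qed

text \<open>Counted by the first row: a nonzero one confines the second row to a line (q choices),
  the zero row leaves it free (q^2 choices).\<close>

lemma card_det2_0:
  "real (card {x :: 'a::{field, finite} m2. det2 x = 0}) =
    real CARD('a) ^ 3 + real CARD('a) ^ 2 - real CARD('a)"
proof -
  define q where "q = CARD('a)"
  have 1: "card {(c, d). a * d - b * c = 0} = (if a = 0 \<and> b = 0 then q ^ 2 else q)" for a b :: 'a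
  proof -
    consider "a = 0" "b = 0" | "a \<noteq> 0" | "a = 0" "b \<noteq> 0" by blast
    thus ?thesis
    proof cases
      case 1
      thus ?thesis by (simp add: q_def power2_eq_square card_prod)
    next
      case 2
      have "card {(c, d). a * d - b * c = 0} = card (UNIV :: 'a set)"
        by (rule card_eq_by_inverse[where f = fst and g = "\<lambda>c. (c, b * c / a)"])
          (use 2 in \<open>auto simp: field_simps\<close>)
      thus ?thesis using 2 by (simp add: q_def)
    next
      case 3
      have "card {(c, d). a * d - b * c = 0} = card (UNIV :: 'a set)"
        by (rule card_eq_by_inverse[where f = snd and g = "\<lambda>d. (0, d)"])
          (use 3 in \<open>auto simp: field_simps\<close>)
      thus ?thesis using 3 by (simp add: q_def)
    qed
  qed
  have "card {x :: 'a m2. det2 x = 0} = card {(a :: 'a, b, c, d). a * d - b * c = 0}"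
    by (subst card_m2_Collect) (simp add: det2_def)
  also have "\<dots> = card {(ab :: 'a \<times> 'a, cd). fst ab * snd cd - snd ab * fst cd = 0}"
    by (rule card_eq_by_inverse[where f = "\<lambda>(a, b, c, d). ((a, b), (c, d))"
          and g = "\<lambda>((a, b), (c, d)). (a, b, c, d)"]) auto
  also have "\<dots> = (\<Sum>ab\<in>UNIV. if ab = (0 :: 'a, 0 :: 'a) then q ^ 2 else q)"
    unfolding card_pairs
  proof (rule sum.cong)
    fix ab :: "'a \<times> 'a"
    obtain a b where ab: "ab = (a, b)" by fastforce
    show "card {y. fst ab * snd y - snd ab * fst y = 0} = (if ab = (0, 0) then q ^ 2 else q)"
      using 1[of a b, unfolded case_prod_unfold] by (simp add: ab)
  qed simp
  also have "\<dots> = q ^ 2 + (q ^ 2 - 1) * q"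
    by (subst sum.remove[of _ "(0, 0)"]) (auto simp: card_prod q_def power2_eq_square)
  also have "real \<dots> = real q ^ 2 + (real q ^ 2 - 1) * real q"
    using zero_less_card_finite[where 'a = 'a] by (simp add: q_def of_nat_diff Suc_leI)
  finally show ?thesis by (simp add: q_def algebra_simps power2_eq_square power3_eq_cube)
qed

lemma card_invertible:
  "real (card {x :: 'a::{field, finite} m2. is_invertible x}) =
    (real CARD('a) ^ 2 - 1) * (real CARD('a) ^ 2 - real CARD('a))"
proof -
  have "real (card {x :: 'a m2. is_invertible x}) =
    real CARD('a) ^ 4 - (real CARD('a) ^ 3 + real CARD('a) ^ 2 - real CARD('a))"
    unfolding is_invertible_det2 card_compl card_det2_0 by (simp add: card_m2)
  also have "\<dots> = (real CARD('a) ^ 2 - 1) * (real CARD('a) ^ 2 - real CARD('a))"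
    by (simp add: algebra_simps power_expand)
  finally show ?thesis .
qed

lemma card_singular_nonzero:
  "real (card {x :: 'a::{field, finite} m2. x \<noteq> 0 \<and> \<not> is_invertible x}) =
    (real CARD('a) ^ 2 - 1) * (real CARD('a) + 1)"
proof -
  have eq: "{x :: 'a m2. x \<noteq> 0 \<and> \<not> is_invertible x} = {x. det2 x = 0} - {0}"
    by (auto simp: is_invertible_det2)
  have "card {x :: 'a m2. det2 x = 0} = Suc (card {x :: 'a m2. x \<noteq> 0 \<and> \<not> is_invertible x})"
    unfolding eq by (rule card.remove) (auto simp: det2_def)
  hence "real (card {x :: 'a m2. x \<noteq> 0 \<and> \<not> is_invertible x}) = 
    real CARD('a) ^ 3 + real CARD('a) ^ 2 - real CARD('a) - 1"
    using card_det2_0[where 'a = 'a] by linarith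
  also have "\<dots> = (real CARD('a) ^ 2 - 1) * (real CARD('a) + 1)"
    by (simp add: algebra_simps power_expand)
  finally show ?thesis .
qed

text \<open>With diagonal (a, t - a), the off-diagonal entries satisfy b c = a (t - a) - e, which
  has q - 1 solutions, and q more exactly when a is a root of the characteristic polynomial.\<close>

lemma card_tr_det2:
  "real (card {x :: 'a::{field, finite} m2. tr x = t \<and> det2 x = e}) =
    real CARD('a) * (real CARD('a) - 1) + real CARD('a) * real (card {a. a * (t - a) = e})"
proof -
  define q where "q = real CARD('a)"
  have "card {x :: 'a m2. tr x = t \<and> det2 x = e} =
      card {(a, b, c, d). a + d = t \<and> a * d - b * c = e}"
    by (subst card_m2_Collect) (simp add: det2_def tr_def)
  also have "\<dots> = card {(a, bc). fst bc * snd bc = a * (t - a) - e}"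
    by (rule card_eq_by_inverse[where f = "\<lambda>(a, b, c, d). (a, b, c)" and g = "\<lambda>(a, b, c). (a, b, c, t - a)"])
      (auto simp: algebra_simps)
  also have "\<dots> = (\<Sum>a\<in>UNIV. card {(b, c). b * c = a * (t - a) - e})"
    by (subst card_pairs) (unfold case_prod_unfold, rule refl)
  also have "real \<dots> = (\<Sum>a\<in>UNIV. (q - 1) + (if a * (t - a) = e then q else 0))"
    unfolding of_nat_sum card_mult_eq q_def by (rule sum.cong) auto
  also have "\<dots> = q * (q - 1) + q * real (card {a. a * (t - a) = e})"
    by (simp add: sum.distrib q_def sum.If_cases)
  finally show ?thesis by (simp add: q_def)
qed

lemma card_nilpotent:
  "real (card {x :: 'a::{field, finite} m2. tr x = 0 \<and> det2 x = 0}) = real CARD('a) ^ 2"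
  unfolding card_tr_det2 by (simp add: algebra_simps power2_eq_square)

lemma card_nilpotent_nonzero:
  "real (card {x :: 'a::{field, finite} m2. tr x = 0 \<and> det2 x = 0 \<and> x \<noteq> 0}) = real CARD('a) ^ 2 - 1"
proof -
  have eq: "{x :: 'a m2. tr x = 0 \<and> det2 x = 0 \<and> x \<noteq> 0} = {x. tr x = 0 \<and> det2 x = 0} - {0}" by auto
  have "card {x :: 'a m2. tr x = 0 \<and> det2 x = 0} = Suc (card {x :: 'a m2. tr x = 0 \<and> det2 x = 0 \<and> x \<noteq> 0})"
    unfolding eq by (rule card.remove) (auto simp: det2_def)
  thus ?thesis using card_nilpotent[where 'a = 'a] by linarith
qed

lemma card_singular_tr:
  "real (card {x :: 'a::{field, finite} m2. det2 x = 0 \<and> tr x \<noteq> 0}) =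
    real CARD('a) ^ 3 - real CARD('a)"
  using card_split_Collect[of "\<lambda>x :: 'a m2. det2 x = 0" "\<lambda>x. tr x = 0"] 
    card_det2_0[where 'a = 'a] card_nilpotent[where 'a = 'a]
  by (simp add: conj_commute)

lemma card_tr_nonzero:
  "real (card {x :: 'a::{field, finite} m2. tr x \<noteq> 0}) = real CARD('a) ^ 4 - real CARD('a) ^ 3"
proof -
  have "card {x :: 'a m2. tr x = 0} = card {(a :: 'a, b :: 'a, c :: 'a, d). a + d = 0}"
    by (subst card_m2_Collect) (simp add: tr_def)
  also have "\<dots> = card (UNIV :: ('a \<times> 'a \<times> 'a) set)"
    by (rule card_eq_by_inverse[where f = "\<lambda>(a, b, c, d). (a, b, c)" and g = "\<lambda>(a, b, c). (a, b, c, - a)"])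
      (auto simp: add_eq_0_iff)
  also have "\<dots> = CARD('a) ^ 3" by (simp add: card_prod power3_eq_cube)
  finally show ?thesis by (simp add: card_compl card_m2)
qed

lemma card_invertible_tr_nonzero:
  "real (card {x :: 'a::{field, finite} m2. is_invertible x \<and> tr x \<noteq> 0}) =
    real CARD('a) ^ 4 - 2 * real CARD('a) ^ 3 + real CARD('a)"
  using card_split_Collect[of "\<lambda>x :: 'a m2. tr x \<noteq> 0" "\<lambda>x. det2 x = 0"] 
    card_tr_nonzero[where 'a = 'a] card_singular_tr[where 'a = 'a]
  unfolding is_invertible_det2 by (simp add: conj_commute)

section \<open>Matrices with two distinct eigenvalues, and intertwiners\<close>

definition disc :: "'a::comm_ring_1 m2 \<Rightarrow> 'a" where "disc x = (tr x)\<^sup>2 - 4 * det2 x"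

text \<open>When 2 is invertible this says that x has two distinct eigenvalues in the field;
  \<open>r\<close> is their difference.\<close>

definition is_split :: "'a::comm_ring_1 m2 \<Rightarrow> bool" where
  "is_split x \<longleftrightarrow> (\<exists>r. r \<noteq> 0 \<and> r\<^sup>2 = disc x)"

lemma disc_scal [simp]: "disc (scal a) = 0"
  by (simp add: disc_def det2_def power2_eq_square scal_def tr_def algebra_simps)

lemma disc_add_scal: "disc (x + scal a) = disc x"
  by (simp add: disc_def det2_def power2_eq_square scal_def tr_def algebra_simps)

text \<open>Pairs (x, r) are counted twice. Over each split x there are the two roots r and -r; on
  the other hand m = (tr x - r) / 2 is an eigenvalue, and x = m + k with k singular of trace r, so
  the pairs correspond to a free m and a singular k of nonzero trace.\<close>

lemma card_is_split:
  assumes two: "(2 :: 'a::{field, finite}) \<noteq> 0"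
  shows "2 * real (card {x :: 'a m2. is_split x}) = real CARD('a) ^ 2 * (real CARD('a) ^ 2 - 1)"
proof -
  define S where "S = {(x :: 'a m2, r). r \<noteq> 0 \<and> r\<^sup>2 = disc x}"
  have neg: "- r \<noteq> r" if "r \<noteq> 0" for r :: 'a
  proof
    assume "- r = r"
    hence "2 * r = 0" by (metis add.right_inverse mult_2)
    thus False using that two by simp
  qed
  have "card {s \<in> S. fst s \<in> {x. is_split x}} = card {x :: 'a m2. is_split x} * 2"
  proof (rule card_fibres)
    fix x :: "'a m2" assume "x \<in> {x. is_split x}"
    then obtain r where r: "r \<noteq> 0" "r\<^sup>2 = disc x" by (auto simp: is_split_def)
    have "{s \<in> S. fst s = x} = {(x, r), (x, - r)}"
      using r by (auto simp: S_def power2_eq_iff) (metis power2_eq_iff)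
    thus "card {s \<in> S. fst s = x} = 2" using neg[OF r(1)] by auto
  qed auto
  also have "{s \<in> S. fst s \<in> {x. is_split x}} = S" by (auto simp: S_def is_split_def)
  also have "card S = card ((UNIV :: 'a set) \<times> {k :: 'a m2. det2 k = 0 \<and> tr k \<noteq> 0})"
  proof (rule card_eq_by_inverse[where f = "\<lambda>(x, r). ((tr x - r) / 2, x - scal ((tr x - r) / 2))"
        and g = "\<lambda>(m, k). (k + scal m, tr k)"])
    fix s assume "s \<in> S"
    then obtain x r where s: "s = (x, r)" "r \<noteq> 0" "r\<^sup>2 = disc x" by (auto simp: S_def)
    define m where "m = (tr x - r) / 2"
    have m: "2 * m = tr x - r" using two by (simp add: m_def)
    have "4 * det2 (x - scal m) = (2 * m) * (2 * m) - 2 * (2 * m) * tr x + 4 * det2 x"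
      by (simp add: det2_def tr_def scal_def algebra_simps)
    also have "\<dots> = r\<^sup>2 - disc x" unfolding m by (simp add: disc_def power2_eq_square algebra_simps)
    finally have "2 * 2 * det2 (x - scal m) = 0" using s by simp
    hence "det2 (x - scal m) = 0" using two unfolding mult_eq_0_iff by blast
    moreover have "tr (x - scal m) = r" using m by simp
    ultimately show "(case case s of (x, r) \<Rightarrow> ((tr x - r) / 2, x - scal ((tr x - r) / 2)) of
        (m, k) \<Rightarrow> (k + scal m, tr k)) = s \<and>
      (case s of (x, r) \<Rightarrow> ((tr x - r) / 2, x - scal ((tr x - r) / 2)))
        \<in> UNIV \<times> {k. det2 k = 0 \<and> tr k \<noteq> 0}"
      using s by (simp add: m_def[symmetric])
  next
    fix p :: "'a \<times> 'a m2" assume "p \<in> UNIV \<times> {k. det2 k = 0 \<and> tr k \<noteq> 0}"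
    then obtain m k where p: "p = (m, k)" "det2 k = 0" "tr k \<noteq> 0" by auto
    have "(tr k + 2 * m - tr k) / 2 = m" using two by simp
    thus "(case case p of (m, k) \<Rightarrow> (k + scal m, tr k) of
        (x, r) \<Rightarrow> ((tr x - r) / 2, x - scal ((tr x - r) / 2))) = p \<and>
      (case p of (m, k) \<Rightarrow> (k + scal m, tr k)) \<in> S"
      using p by (simp add: S_def disc_add_scal) (simp add: disc_def)
  qed
  finally have "CARD('a) * card {k :: 'a m2. det2 k = 0 \<and> tr k \<noteq> 0} =
      card {x :: 'a m2. is_split x} * 2"
    by (simp add: card_cartesian_product)
  from arg_cong[OF this, of real]
  have "real CARD('a) * real (card {k :: 'a m2. det2 k = 0 \<and> tr k \<noteq> 0}) =
      real (card {x :: 'a m2. is_split x}) * 2"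
    by simp
  thus ?thesis unfolding card_singular_tr by (simp add: algebra_simps power2_eq_square power3_eq_cube)
qed

lemma card_is_scal: "card {x :: 'a::{field, finite} m2. is_scal x} = CARD('a)"
  by (rule card_eq_by_inverse[where f = m11 and g = scal]) (auto simp: is_scal_def scal_def)

lemma card_not_diagonalizable:
  assumes two: "(2 :: 'a::{field, finite}) \<noteq> 0"
  shows "2 * real (card {x :: 'a m2. \<not> is_split x \<and> \<not> is_scal x}) =
    real CARD('a) ^ 4 + real CARD('a) ^ 2 - 2 * real CARD('a)"
proof -
  have "{x :: 'a m2. \<not> is_split x \<and> is_scal x} = {x. is_scal x}"
    by (auto simp: is_split_def is_scal_def)
  hence "real (card {x :: 'a m2. \<not> is_split x \<and> is_scal x}) = real CARD('a)"
    using card_is_scal by metis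
  moreover have "real (card {x :: 'a m2. \<not> is_split x}) = real CARD('a) ^ 4 - real (card {x :: 'a m2. is_split x})"
    by (simp add: card_compl card_m2)
  ultimately show ?thesis
    using card_split_Collect[of "\<lambda>x :: 'a m2. \<not> is_split x" is_scal] card_is_split[OF two]
    by (simp add: algebra_simps power2_eq_square power4_eq_xxxx)
qed

text \<open>Both matrices are conjugate to the same companion matrix, so the intertwiners correspond
  to its centralizer. As e1 is cyclic, an element of this centralizer is determined by its first
  column (u, v), which is arbitrary.\<close>

lemma card_intertwiners:
  fixes x y :: "'a::{field, finite} m2"
  assumes "\<not> is_scal x" "\<not> is_scal y" "tr x = tr y" "det2 x = det2 y"
  shows "card {c. c * x = y * c} = CARD('a) ^ 2"
proof -
  define k where "k = companion (tr x) (det2 x)"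
  obtain g g' where g: "g * g' = 1" "g' * g = 1" "x = g * k * g'"
    using conj_to_companion[OF assms(1)] unfolding conj_to_def k_def by blast
  obtain h h' where h: "h * h' = 1" "h' * h = 1" "y = h * k * h'"
    using conj_to_companion[OF assms(2)] unfolding conj_to_def k_def assms(3,4) by blast
  note canc = conj_cancel[OF g(1)] conj_cancel[OF g(2)] conj_cancel[OF h(1)] conj_cancel[OF h(2)]
  have "card {c. c * x = y * c} = card {c. c * k = k * c}"
  proof (rule card_eq_by_inverse[where f = "\<lambda>c. h' * c * g" and g = "\<lambda>c. h * c * g'"])
    fix c assume "c \<in> {c. c * x = y * c}"
    hence "c * (g * (k * g')) = h * (k * (h' * c))" by (simp add: g(3) h(3) mult.assoc)
    hence "h' * (c * (g * (k * g'))) * g = h' * (h * (k * (h' * c))) * g" by simp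
    thus "h * (h' * c * g) * g' = c \<and> h' * c * g \<in> {c. c * k = k * c}"
      by (simp add: g(1,2) h(1,2) mult.assoc canc)
  next
    fix c assume "c \<in> {c. c * k = k * c}"
    hence "c * k = k * c" by simp
    hence "h * (c * k) * g' = h * (k * c) * g'" by simp
    thus "h' * (h * c * g') * g = c \<and> h * c * g' \<in> {c. c * x = y * c}"
      by (simp add: g h mult.assoc canc)
  qed
  also have "\<dots> = card (UNIV :: ('a \<times> 'a) set)"
    by (rule card_eq_by_inverse[where f = "\<lambda>c. (m11 c, m21 c)"
          and g = "\<lambda>(u, v). M2 u (- det2 x * v) v (u + tr x * v)"])
      (auto simp: m2_eq_iff k_def companion_def algebra_simps)
  finally show ?thesis by (simp add: card_prod power2_eq_square)
qed

section \<open>Block matrices\<close>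

abbreviation comm :: "'a::ring_1 \<Rightarrow> 'a \<Rightarrow> bool" where "comm x y \<equiv> x * y = y * x"

definition bdiag :: "'a::ring_1 \<Rightarrow> 'a \<Rightarrow> 'a m2" where "bdiag p q = M2 p 0 0 q"

lemma bdiag_mult [simp]: "bdiag p q * bdiag p' q' = bdiag (p * p') (q * q')"
  by (simp add: bdiag_def)

lemma bdiag_1 [simp]: "bdiag 1 1 = 1" by (simp add: bdiag_def)

lemma bdiag_conj:
  "bdiag p q * M2 a b c d * bdiag p' q' = M2 (p * a * p') (p * b * q') (q * c * p') (q * d * q')"
  by (simp add: bdiag_def)

lemma conj_toI': "g * g' = 1 \<Longrightarrow> g' * g = 1 \<Longrightarrow> conj_to x (g * x * g')"
  unfolding conj_to_def by blast

lemma conj_comm: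
  assumes "g' * g = (1 :: 'a::ring_1)" "comm x y"
  shows "comm (g * x * g') (g * y * g')"
  by (simp add: mult.assoc conj_cancel[OF assms(1)])
    (simp add: mult.assoc[symmetric] assms(2))

lemma conj_to_bdiag:
  assumes "conj_to a a'" "conj_to b b'"
  shows "conj_to (bdiag a b) (bdiag a' b')"
proof -
  from assms obtain g g' h h' where g: "g * g' = 1" "g' * g = 1" "a' = g * a * g'"
    and h: "h * h' = 1" "h' * h = 1" "b' = h * b * h'" unfolding conj_to_def by blast
  have "conj_to (bdiag a b) (bdiag g h * bdiag a b * bdiag g' h')"
    by (rule conj_toI') (simp_all add: g h)
  thus ?thesis by (simp add: g h)
qed

text \<open>Exchanges the inner and the outer indices of a block matrix.\<close>
definition flip :: "'a m2 m2 \<Rightarrow> 'a m2 m2" where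
  "flip y =
    M2 (M2 (m11 (m11 y)) (m11 (m12 y)) (m11 (m21 y)) (m11 (m22 y)))
       (M2 (m12 (m11 y)) (m12 (m12 y)) (m12 (m21 y)) (m12 (m22 y)))
       (M2 (m21 (m11 y)) (m21 (m12 y)) (m21 (m21 y)) (m21 (m22 y)))
       (M2 (m22 (m11 y)) (m22 (m12 y)) (m22 (m21 y)) (m22 (m22 y)))"

lemma conj_to_flip: "conj_to y (flip y)"
proof -
  define g :: "'a m2 m2" where
    \<comment> \<open>The permutation matrix that exchanges the second and the third basis
      vector.\<close>
    "g = M2 (M2 1 0 0 0) (M2 0 0 1 0) (M2 0 1 0 0) (M2 0 0 0 1)"
  have "g * g = 1" by (simp add: g_def)
  hence "is_invertible g" unfolding is_invertible_def by blast
  moreover have "g * y = flip y * g" by (simp add: g_def flip_def m2_eq_iff)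
  ultimately show ?thesis by (rule conj_toI[rotated])
qed

lemma conj_to_flipI: "conj_to x (flip y) \<Longrightarrow> conj_to x y"
  using conj_to_flip conj_to_sym conj_to_trans by blast

text \<open>\<open>tr (tr x)\<close> is the trace of the 4x4 matrix. The block trace
  \<open>tr x\<close> has no such symmetry, because blocks do not commute.\<close>

lemma ring_tr_mult_commute:
  "tr (tr (x * y)) = tr (tr (y * (x :: 'a::comm_ring_1 m2 m2)))"
  by (simp add: tr_def algebra_simps)

lemma ring_tr_conj: "g' * g = 1 \<Longrightarrow> tr (tr (g * x * g')) = tr (tr (x :: 'a::comm_ring_1 m2 m2))"
  by (metis mult.assoc mult.right_neutral ring_tr_mult_commute)

text \<open>The centralizer of a nonscalar x consists of the polynomials in x. The coefficient v is
  read off at an entry in which x differs from a scalar matrix.\<close>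

lemma commuting_nonscalar:
  fixes x y :: "'a::field m2"
  assumes "comm x y" "\<not> is_scal x"
  shows "\<exists>u v. y = scal u + scal v * x"
proof -
  obtain a b c d where x: "x = M2 a b c d" by (cases x)
  obtain a' b' c' d' where y: "y = M2 a' b' c' d'" by (cases y)
  have eqs: "b * c' = b' * c" "a * b' + b * d' = a' * b + b' * d" "c * a' + d * c' = c' * a + d' * c"
    using assms(1) by (auto simp: x y)
  consider "b \<noteq> 0" | "c \<noteq> 0" | "b = 0" "c = 0" "a \<noteq> d"
    using assms(2) by (auto simp: is_scal_iff x)
  thus ?thesis
  proof cases
    case 1
    show ?thesis
      by (rule exI[of _ "a' - b' / b * a"], rule exI[of _ "b' / b"])
        (use 1 eqs in \<open>simp add: x y scal_def field_simps\<close>)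
  next
    case 2
    show ?thesis
      by (rule exI[of _ "a' - c' / c * a"], rule exI[of _ "c' / c"])
        (use 2 eqs in \<open>simp add: x y scal_def field_simps\<close>)
  next
    case 3
    have "b' * (a - d) = 0" "c' * (a - d) = 0" using eqs 3 by (simp_all add: algebra_simps)
    hence "b' = 0" "c' = 0" using 3 by auto
    moreover define v where "v = (a' - d') / (a - d)"
    hence "v * (a - d) = a' - d'" using 3 by simp
    ultimately show ?thesis
      by (intro exI[of _ "a' - v * a"] exI[of _ v])
        (use 3 in \<open>simp add: x y scal_def algebra_simps\<close>)
  qed
qed

lemma disc_lin: "disc (scal u + scal v * x) = v\<^sup>2 * disc x"
  by (simp add: disc_def det2_def power2_eq_square scal_def tr_def algebra_simps)

section \<open>Conjugation by block lower unitriangular matrices\<close>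

definition uconj :: "'a::ring_1 \<Rightarrow> 'a m2 \<Rightarrow> 'a m2" where
  "uconj x y = M2 1 0 x 1 * y * M2 1 0 (- x) 1"

text \<open>The corner b is kept, while a and d move by -b x and x b; once b is normalised, x can be
  chosen to clear entries of a and d.\<close>

lemma uconj_M2: "uconj x (M2 a b c d) = M2 (a - b * x) b (x * a + c - (x * b + d) * x) (x * b + d)"
  by (simp add: uconj_def)

lemma uconj_inverse [simp]: "uconj (- x) (uconj x y) = y" "uconj x (uconj (- x) y) = y"
  by (cases y, simp add: uconj_M2 algebra_simps)+

lemma conj_to_uconj: "conj_to y (uconj x y)"
  unfolding uconj_def by (rule conj_toI') simp_all

lemma comm_uconj: "comm y z \<Longrightarrow> comm (uconj x y) (uconj x z)"
  unfolding uconj_def by (rule conj_comm) simp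

definition diag_blocks :: "'a::ring_1 m2 m2 \<Rightarrow> bool" where
  "diag_blocks y \<longleftrightarrow> (\<exists>k l. flip y = bdiag k l)"

lemma diag_blocks_iff:
  "diag_blocks y \<longleftrightarrow> m12 (m11 y) = 0 \<and> m12 (m12 y) = 0 \<and> m12 (m21 y) = 0 \<and> m12 (m22 y) = 0
    \<and> m21 (m11 y) = 0 \<and> m21 (m12 y) = 0 \<and> m21 (m21 y) = 0 \<and> m21 (m22 y) = 0"
  by (auto simp: diag_blocks_def m2_eq_iff bdiag_def flip_def m2_ex)

lemma diagonalize_blocks:
  fixes a c d :: "'a::field m2"
  assumes "y * y = bdiag (scal k) (scal k)" "y = M2 a (M2 1 0 0 e) c d" "e = 0 \<or> e = 1"
  shows "\<exists>x. diag_blocks (uconj x y)"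
proof -
  obtain a1 a2 a3 a4 where a: "a = M2 a1 a2 a3 a4" by (cases a)
  obtain c1 c2 c3 c4 where c: "c = M2 c1 c2 c3 c4" by (cases c)
  obtain d1 d2 d3 d4 where d: "d = M2 d1 d2 d3 d4" by (cases d)
  note eqs = assms(1)[unfolded assms(2) a c d, simplified scal_def bdiag_def M2_simps, simplified]
  show ?thesis using assms(3)
  proof
    assume e: "e = 1"
    \<comment> \<open>The corner is 1, so x = a clears the block a; the square condition then forces
      the lower right block to vanish and the lower left one to be k.\<close>
    show ?thesis
      by (rule exI[of _ a])
        (use eqs in \<open>auto simp: assms(2) e a c d uconj_M2 diag_blocks_iff algebra_simps add_eq_0_iff\<close>)
  next
    assume e: "e = 0"
    \<comment> \<open>The first row of x clears the first row of a, its entry -d3 clears the lower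
      left entry of d, and the square condition does the rest.\<close>
    show ?thesis
      by (rule exI[of _ "M2 a1 a2 (- d3) 0"])
        (use eqs in \<open>auto simp: assms(2) e a c d uconj_M2 diag_blocks_iff algebra_simps add_eq_0_iff\<close>)
  qed
qed

section \<open>Odd characteristic\<close>

locale odd_char =
  fixes field_type :: "'a::field itself"
  assumes two: "(2 :: 'a) \<noteq> 0"
begin

abbreviation t1 :: "'a m2 m2" where "t1 \<equiv> bdiag 1 (- 1)"

abbreviation sg :: "'a m2" where "sg \<equiv> M2 1 0 0 (- 1)"

lemma four: "(4 :: 'a) \<noteq> 0"
proof -
  have "(2 :: 'a) * 2 \<noteq> 0" using two by (simp only: mult_eq_0_iff) simp
  thus ?thesis by simp
qed

lemma eq_neg_iff: "x = - x \<longleftrightarrow> x = (0 :: 'a)"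
proof
  assume "x = - x"
  hence "2 * x = 0" by (metis add.right_inverse mult_2)
  thus "x = 0" using two by simp
qed simp

lemma eq_neg_iff_m2: "x = - x \<longleftrightarrow> x = (0 :: 'a m2)"
  by (auto simp: m2_eq_iff eq_neg_iff)

text \<open>By Cayley-Hamilton, x^2 = 1 reads tr x * x = 1 + det x, so a nonzero trace makes x
  scalar.\<close>

lemma involution_cases:
  assumes "x * x = (1 :: 'a m2)"
  obtains "x = 1" | "x = - 1" | "\<not> is_scal x" "tr x = 0" "det2 x = - 1"
proof (cases "is_scal x")
  case True
  then obtain a where a: "x = scal a" by (auto simp: is_scal_def)
  hence "a * a = 1" using assms by (metis scal_simps(4,6,7))
  hence "a = 1 \<or> a = - 1" by (simp add: square_eq_1_iff)
  thus thesis using that a by (metis scal_simps(3,6))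
next
  case False
  have *: "1 + scal (det2 x) = scal (tr x) * x"
    using cayley_hamilton[of x] assms by (simp add: algebra_simps)
  have "tr x = 0"
  proof (rule ccontr)
    assume n: "tr x \<noteq> 0"
    have "x = scal (inverse (tr x) * tr x) * x" using n by simp
    also have "\<dots> = scal (inverse (tr x)) * (1 + scal (det2 x))"
      unfolding * by (simp add: mult.assoc[symmetric])
    also have "\<dots> = scal (inverse (tr x) * (1 + det2 x))"
      by (metis scal_simps(1,4,6))
    finally show False using False by (auto simp: is_scal_def)
  qed
  moreover from this * have "det2 x = - 1"
    by (metis add.commute add_eq_0_iff mult_zero_left scal_simps(1,5,6,7))
  ultimately show thesis using that False by blast
qed

lemma nonscal_sg: "\<not> is_scal sg" "tr sg = 0" "det2 sg = (- 1 :: 'a)" "sg * sg = 1"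
  using eq_neg_iff[of 1] by (auto simp: is_scal_iff tr_def det2_def)

text \<open>Opposite traces leave two possibilities: k = -l is scalar, or both have eigenvalues 1
  and -1. In the latter case both are conjugate to \<open>sg\<close>, and \<open>flip\<close> turns
  \<open>bdiag sg sg\<close> into \<open>t1\<close>.\<close>

lemma conj_to_bdiag_involutions:
  assumes "k * k = (1 :: 'a m2)" "l * l = 1" "tr k + tr l = 0"
  shows "conj_to t1 (bdiag k l)"
proof -
  have 2: "(2 :: 'a) + 2 \<noteq> 0" using four by simp
  have 3: "(- 2 :: 'a) - 2 \<noteq> 0" 
  proof -
    have "(- 2 :: 'a) - 2 = - 4" by simp
    thus ?thesis using four by simp
  qed
  show ?thesis
    using assms(1)
  proof (cases rule: involution_cases)
    case 1
    from assms(2) have "l = - 1"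
      by (cases rule: involution_cases) (use assms(3) 1 2 two in auto)
    thus ?thesis using 1 by simp
  next
    case 2
    from assms(2) have "l = 1"
      by (cases rule: involution_cases) (use assms(3) 2 3 two in auto)
    moreover have "is_invertible (M2 0 1 1 0 :: 'a m2 m2)"
      unfolding is_invertible_def by (rule exI[of _ "M2 0 1 1 0"]) simp
    hence "conj_to t1 (bdiag (- 1) 1)"
      by (intro conj_toI[where g = "M2 0 1 1 0"]) (simp_all add: bdiag_def)
    ultimately show ?thesis using 2 by simp
  next
    case 3
    from assms(2) have l: "\<not> is_scal l" "tr l = 0" "det2 l = - 1"
      by (cases rule: involution_cases; use assms(3) 3 two in auto)+
    have "conj_to sg k" "conj_to sg l"
      by (rule conj_to_if_same_charpoly; use 3 l nonscal_sg in simp)+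
    hence "conj_to (bdiag sg sg) (bdiag k l)" by (rule conj_to_bdiag)
    moreover have "flip (bdiag sg sg) = t1" by (simp add: flip_def bdiag_def m2_eq_iff)
    hence "conj_to t1 (bdiag sg sg)" by (metis conj_to_flipI conj_to_refl)
    ultimately show ?thesis using conj_to_trans by blast
  qed
qed

text \<open>An involution with m eigenvalues 1 has trace 2 (m - 2), where m is at most 4; in odd
  characteristic this vanishes only for m = 2, so the trace singles out the class.\<close>

definition S :: "'a m2 m2 set" where "S = {y. y * y = 1 \<and> tr (tr y) = 0}"

lemma S_conj:
  assumes "g' * g = 1" "g * g' = 1" "y \<in> S"
  shows "g * y * g' \<in> S"
  using assms(3) ring_tr_conj[OF assms(1), of y]
  by (simp add: S_def mult.assoc conj_cancel[OF assms(1)])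
    (simp add: mult.assoc[symmetric] assms(2))

lemma S_conj_to:
  assumes "conj_to x y" "x \<in> S" shows "y \<in> S"
proof -
  from assms(1) obtain g g' where "g * g' = 1" "g' * g = 1" "y = g * x * g'"
    unfolding conj_to_def by blast
  thus ?thesis using S_conj assms(2) by simp
qed

lemma uconj_S: "y \<in> S \<Longrightarrow> uconj x y \<in> S"
  using S_conj_to conj_to_uconj by blast

lemma S_iff: "M2 a b c d \<in> S \<longleftrightarrow> a * a + b * c = 1 \<and> a * b + b * d = 0 \<and> c * a + d * c = 0
    \<and> c * b + d * d = 1 \<and> tr a + tr d = 0"
  by (simp add: S_def tr_def algebra_simps)

lemma bdiag_S_iff: "bdiag a d \<in> S \<longleftrightarrow> a * a = 1 \<and> d * d = 1 \<and> tr a + tr d = 0"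
  by (simp add: bdiag_def S_iff)

lemma conj_to_diag_blocks:
  assumes "y \<in> S" "diag_blocks y"
  shows "conj_to t1 y"
proof -
  from assms(2) obtain k l where *: "flip y = bdiag k l" unfolding diag_blocks_def by blast
  have "conj_to y (bdiag k l)" using conj_to_flip * by metis
  hence "bdiag k l \<in> S" using assms(1) by (rule S_conj_to)
  hence "conj_to t1 (bdiag k l)" by (intro conj_to_bdiag_involutions) (auto simp: bdiag_S_iff)
  thus ?thesis using * conj_to_flipI by metis
qed

lemma diagonalize_blocks_S:
  assumes "M2 a (M2 1 0 0 e) c d \<in> S" "e = 0 \<or> e = 1"
  shows "\<exists>x. diag_blocks (uconj x (M2 a (M2 1 0 0 e) c d))"
  using assms by (intro diagonalize_blocks[where k = 1]) (auto simp: S_def)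

lemma conj_to_t1_if_S:
  assumes "y \<in> S"
  shows "conj_to t1 y"
proof -
  obtain a b c d where y: "y = M2 a b c d" by (cases y)
  show ?thesis
  proof (cases "b = 0")
    case True
    \<comment> \<open>The solution of x a - d x = -c, which removes the lower left block; it works
      because a^2 = 1 and d c = -c a.\<close>
    define x where "x = scal (- 1 / 2) * (c * a)"
    note eqs = assms[unfolded y S_iff True, simplified]
    have half: "scal (- 1 / 2) + scal (- 1 / 2) = (- 1 :: 'a m2)"
    proof -
      have "(- 1 / 2) + (- 1 / 2) = (- 1 :: 'a)" using two by (simp add: field_simps)
      thus ?thesis by (metis scal_simps(1,3,6))
    qed
    have "x * a = scal (- 1 / 2) * c"
      using eqs by (simp add: x_def mult.assoc)
    moreover have "d * x = - (scal (- 1 / 2) * c)"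
    proof -
      have "d * x = scal (- 1 / 2) * (d * c * a)" 
        unfolding x_def by (metis mult.assoc scal_commute)
      also have "d * c = - (c * a)" using eqs by (simp add: add_eq_0_iff)
      finally show ?thesis using eqs by (simp add: mult.assoc)
    qed
    moreover have "scal (- 1 / 2) * c + c + scal (- 1 / 2) * c = (scal (- 1 / 2) + scal (- 1 / 2)) * c + c"
      by (simp only: distrib_right) (simp only: add_ac)
    ultimately have "x * a + c - d * x = 0" unfolding half by simp
    hence "uconj x y = bdiag a d" by (simp add: y True uconj_M2 bdiag_def)
    moreover have "conj_to t1 (bdiag a d)"
      by (rule conj_to_bdiag_involutions) (use eqs in auto)
    ultimately show ?thesis using conj_to_uconj by (metis conj_to_sym conj_to_trans)
  next
    case False
    then obtain p q e where pq: "is_invertible p" "is_invertible q" "b = p * M2 1 0 0 e * q" "e = 0 \<or> e = 1"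
      by (rule diagonalize_equiv)
    from pq(1,2) obtain p' q' where p: "p * p' = 1" "p' * p = 1" and q: "q * q' = 1" "q' * q = 1"
      unfolding is_invertible_def by blast
    \<comment> \<open>The two diagonal blocks act independently on the two sides of the corner,
      which becomes p' b q'.\<close>
    define z where "z = bdiag p' q * y * bdiag p q'"
    have b: "p' * b * q' = M2 1 0 0 e"
      by (simp add: pq(3) mult.assoc q conj_cancel[OF p(2)])
    have "conj_to y z" unfolding z_def by (rule conj_toI') (simp_all add: p q)
    moreover have "z = M2 (p' * a * p) (M2 1 0 0 e) (q * c * p) (q * d * q')"
      unfolding z_def y bdiag_conj b ..
    moreover from \<open>conj_to y z\<close> have "z \<in> S" using assms by (rule S_conj_to)
    ultimately obtain x where "diag_blocks (uconj x z)"
      using diagonalize_blocks_S pq(4) by metis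
    hence "conj_to t1 (uconj x z)" using \<open>z \<in> S\<close> uconj_S by (intro conj_to_diag_blocks)
    thus ?thesis using \<open>conj_to y z\<close> conj_to_uconj by (metis conj_to_sym conj_to_trans)
  qed
qed

lemma S_eq: "S = {y. conj_to t1 y}"
proof -
  have "t1 \<in> S" by (simp add: bdiag_S_iff)
  thus ?thesis using conj_to_t1_if_S S_conj_to by blast
qed

section \<open>Distance at most 2 and at most 3 from \<open>t1\<close>, where steps may be
  trivial\<close>

definition near :: "'a m2 m2 \<Rightarrow> bool" where
  "near y \<longleftrightarrow> (\<exists>z\<in>S. comm t1 z \<and> comm z y)"

definition near3 :: "'a m2 m2 \<Rightarrow> bool" where
  "near3 y \<longleftrightarrow> (\<exists>z\<in>S. \<exists>w\<in>S. comm t1 z \<and> comm z w \<and> comm w y)"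

lemma bdiag_conj_t1:
  assumes "p * p' = 1" "q * q' = 1"
  shows "bdiag p q * t1 * bdiag p' q' = t1"
  using assms by simp

text \<open>Block diagonal matrices centralize \<open>t1\<close>, so conjugation by one keeps the
  starting point of a path.\<close>

lemma near_bdiag_conj:
  assumes "p * p' = 1" "p' * p = 1" "q * q' = 1" "q' * q = 1" "near y"
  shows "near (bdiag p q * y * bdiag p' q')"
proof -
  from assms obtain z where z: "z \<in> S" "comm t1 z" "comm z y" unfolding near_def by blast
  have g: "bdiag p' q' * bdiag p q = 1" "bdiag p q * bdiag p' q' = 1" using assms by simp_all
  show ?thesis unfolding near_def
    using S_conj[OF g z(1)] conj_comm[OF g(1) z(2)] conj_comm[OF g(1) z(3)]
      bdiag_conj_t1[OF assms(1,3)] by metis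
qed

lemma near3_bdiag_conj:
  assumes "p * p' = 1" "p' * p = 1" "q * q' = 1" "q' * q = 1" "near3 y"
  shows "near3 (bdiag p q * y * bdiag p' q')"
proof -
  from assms obtain z w where z: "z \<in> S" "w \<in> S" "comm t1 z" "comm z w" "comm w y"
    unfolding near3_def by blast
  have g: "bdiag p' q' * bdiag p q = 1" "bdiag p q * bdiag p' q' = 1" using assms by simp_all
  show ?thesis unfolding near3_def
    using S_conj[OF g z(1)] S_conj[OF g z(2)] conj_comm[OF g(1) z(3)] conj_comm[OF g(1) z(4)]
      conj_comm[OF g(1) z(5)] bdiag_conj_t1[OF assms(1,3)] by metis
qed

lemma sg_in_S: "bdiag sg sg \<in> S" "bdiag sg (- sg) \<in> S"
  by (simp_all add: bdiag_S_iff tr_def)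

text \<open>A matrix with diagonal blocks commutes with \<open>bdiag sg sg\<close>; conjugated back,
  this gives \<open>w\<close>. The lower left block of \<open>w\<close> is sg x - x sg, which
  anticommutes with \<open>sg\<close>: hence the sign in the vertex \<open>bdiag sg (- sg)\<close>
  next to \<open>t1\<close>.\<close>

lemma near3_if_diag_blocks:
  assumes "diag_blocks (uconj x y)"
  shows "near3 y"
proof -
  define w where "w = uconj (- x) (bdiag sg sg)"
  have "comm (bdiag sg sg) (uconj x y)" using assms by (simp add: diag_blocks_iff bdiag_def m2_eq_iff)
  hence "comm w (uconj (- x) (uconj x y))" unfolding w_def by (rule comm_uconj)
  hence "comm w y" by simp
  moreover have "w \<in> S" unfolding w_def by (intro uconj_S sg_in_S)
  moreover have "comm (bdiag sg (- sg)) w"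
    by (simp add: w_def uconj_M2 bdiag_def m2_eq_iff algebra_simps)
  moreover have "comm t1 (bdiag sg (- sg))" by simp
  ultimately show ?thesis unfolding near3_def using sg_in_S by blast
qed

text \<open>From tr (b c) = tr (c b) one gets tr (a^2) = tr (d^2). Together with the traces this
  determines the determinants, because 2 is invertible.\<close>

lemma same_charpoly:
  assumes "M2 a b c d \<in> S"
  shows "tr (- d) = tr a" "det2 (- d) = det2 a"
proof -
  note eqs = assms[unfolded S_iff]
  show t: "tr (- d) = tr a" using eqs by (simp add: add_eq_0_iff)
  have "tr (a * a + b * c) = tr (c * b + d * d)" using eqs by simp
  hence "tr (a * a) = tr (d * d)" using tr_mult_commute[of b c] by simp
  moreover have "tr (x * x) = (tr x)\<^sup>2 - 2 * det2 x" for x :: "'a m2"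
    by (simp add: tr_def det2_def power2_eq_square algebra_simps)
  moreover have "(tr d)\<^sup>2 = (tr a)\<^sup>2" using t by (metis power2_minus tr_simps(3))
  ultimately have "2 * det2 a = 2 * det2 d" by simp
  hence "det2 a = det2 d" using two by simp
  thus "det2 (- d) = det2 a" by (simp add: det2_def)
qed

text \<open>With \<open>s = diag(a, -d)\<close>, the common neighbour is \<open>(2s - tr a) / r\<close>.\<close>
lemma near_if_is_split:
  assumes S: "M2 a b c d \<in> S" and "is_split a"
  shows "near (M2 a b c d)"
proof -
  from assms(2) obtain r where r: "r \<noteq> 0" "r\<^sup>2 = disc a" by (auto simp: is_split_def)
  note eqs = S[unfolded S_iff]
  define f where "f x = scal (1 / r) * (x + x - scal (tr a))" for x
  have sq: "f x * f x = 1" if "tr x = tr a" "det2 x = det2 a" for x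
  proof -
    \<comment> \<open>Completing the square in the characteristic polynomial: (2x - tr x)^2 is the
      discriminant.\<close>
    have "(x + x - scal (tr a)) * (x + x - scal (tr a)) = scal (disc a)"
      unfolding disc_def that[symmetric] by (simp add: m2_eq_iff scal_def tr_def det2_def power2_eq_square algebra_simps)
    hence "f x * f x = scal (1 / r) * (scal (1 / r) * scal (disc a))"
      unfolding f_def by (metis mult.assoc scal_commute)
    thus ?thesis using r by (simp add: power2_eq_square flip: r(2))
  qed
  have tr0: "tr (f x) = 0" if "tr x = tr a" for x
  proof -
    have "tr (f x) = (1 / r) * (tr x + tr x - 2 * tr a)"
      by (simp add: f_def tr_def scal_def algebra_simps)
    thus ?thesis using that by simp
  qed
  have "bdiag (f a) (f (- d)) \<in> S"
    using sq[of a] sq[of "- d"] tr0[of a] tr0[of "- d"] same_charpoly[OF S]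
    by (simp add: bdiag_S_iff)
  moreover have "comm (bdiag (f a) (f (- d))) (M2 a b c d)"
  proof -
    have ab: "a * b = b * (- d)" using eqs by (simp add: add_eq_0_iff2)
    have ca: "(- d) * c = c * a" using eqs by (simp add: add_eq_0_iff2)
    \<comment> \<open>\<open>f\<close> is a polynomial with scalar coefficients, so it inherits
      every intertwining relation; those for b and c relate a to -d.\<close>
    have f1: "f x * y = y * f z" if "x * y = y * z" for x y z
    proof -
      have "(x + x - scal (tr a)) * y = y * (z + z - scal (tr a))"
        by (simp only: left_diff_distrib right_diff_distrib distrib_left distrib_right that
            scal_commute[of _ y])
      thus ?thesis unfolding f_def by (metis mult.assoc scal_commute)
    qed
    have "f a * a = a * f a" "f a * b = b * f (- d)" "f (- d) * c = c * f a" "f (- d) * d = d * f (- d)"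
      by (rule f1, use ab ca in simp)+
    thus ?thesis by (simp add: bdiag_def)
  qed
  moreover have "comm t1 (bdiag (f a) (f (- d)))" by simp
  ultimately show ?thesis unfolding near_def by blast
qed


text \<open>Here ty + yt is scalar and yields no candidate. But b c and c b are both the scalar 1 -
  l^2, so one block diagonal conjugation makes b and c diagonal together, and then
  \<open>bdiag sg sg\<close> is a common neighbour.\<close>

lemma near_if_is_scal:
  assumes S: "M2 (scal l) b c (scal m) \<in> S"
  shows "near (M2 (scal l) b c (scal m))"
proof -
  note eqs = S[unfolded S_iff]
  have ml: "m = - l"
  proof -
    have "2 * (l + m) = 0" using eqs by (simp add: algebra_simps)
    hence "l + m = 0" using two unfolding mult_eq_0_iff by blast
    thus ?thesis by (simp add: add_eq_0_iff)
  qed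
  have bc: "b * c = scal (1 - l * l)" "c * b = scal (1 - l * l)"
  proof -
    have "scal (1 - l * l) = 1 - scal (l * l)" by (metis scal_simps(2,6))
    moreover have "scal (l * l) + b * c = 1" "c * b + scal (l * l) = 1"
      using eqs by (simp_all add: ml)
    ultimately show "b * c = scal (1 - l * l)" "c * b = scal (1 - l * l)"
      by (metis eq_diff_eq add.commute)+
  qed
  have diag: "near (M2 (scal l) b' c' (scal m))"
    if "m12 b' = 0" "m21 b' = 0" "m12 c' = 0" "m21 c' = 0" for b' c'
    unfolding near_def
    by (rule bexI[of _ "bdiag sg sg"])
      (use that sg_in_S in \<open>auto simp: bdiag_def m2_eq_iff scal_def\<close>)
  consider "b = 0" "c = 0" | "b \<noteq> 0" | "b = 0" "c \<noteq> 0" by blast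
  thus ?thesis
  proof cases
    case 1
    thus ?thesis by (intro diag) auto
  next
    case 2
    then obtain p q e where pq: "is_invertible p" "is_invertible q" "b = p * M2 1 0 0 e * q" "e = 0 \<or> e = 1"
      by (rule diagonalize_equiv)
    from pq(1,2) obtain p' q' where p: "p * p' = 1" "p' * p = 1" and q: "q * q' = 1" "q' * q = 1"
      unfolding is_invertible_def by blast
    define k where "k = q * c * p"
    have c: "c = q' * k * p'"
      by (simp add: k_def mult.assoc p conj_cancel[OF q(2)])
    have "M2 1 0 0 e * k = p' * (b * c) * p"
      by (simp add: k_def pq(3) mult.assoc q conj_cancel[OF p(2)] conj_cancel[OF q(2)] conj_cancel[OF q(1)])
    hence 1: "M2 1 0 0 e * k = scal (1 - l * l)"
      unfolding bc by (simp add: scal_commute[symmetric, of p'] mult.assoc p)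
    have "k * M2 1 0 0 e = q * (c * b) * q'"
      by (simp add: k_def pq(3) mult.assoc q conj_cancel[OF p(2)] conj_cancel[OF q(2)] conj_cancel[OF q(1)])
    hence 2: "k * M2 1 0 0 e = scal (1 - l * l)"
      unfolding bc by (simp add: scal_commute[symmetric, of q] mult.assoc q)
    \<comment> \<open>Fact 1 makes the upper right entry of \<open>k\<close> vanish, fact 2 the
      lower left one; both are needed because e may be 0.\<close>
    have "near (M2 (scal l) (M2 1 0 0 e) k (scal m))"
      by (rule diag) (use 1 2 in \<open>auto simp: m2_eq_iff scal_def\<close>)
    hence "near (bdiag p q' * M2 (scal l) (M2 1 0 0 e) k (scal m) * bdiag p' q)"
      by (rule near_bdiag_conj[OF p q(2,1)])
    thus ?thesis unfolding bdiag_conj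
      by (simp add: c pq(3) scal_commute[symmetric, of p] scal_commute[symmetric, of q']
          mult.assoc p q)
  next
    case 3
    then obtain p q e where pq: "is_invertible p" "is_invertible q" "c = p * M2 1 0 0 e * q" "e = 0 \<or> e = 1"
      by (metis diagonalize_equiv)
    from pq(1,2) obtain p' q' where p: "p * p' = 1" "p' * p = 1" and q: "q * q' = 1" "q' * q = 1"
      unfolding is_invertible_def by blast
    have "near (M2 (scal l) 0 (M2 1 0 0 e) (scal m))" by (rule diag) auto
    hence "near (bdiag q' p * M2 (scal l) 0 (M2 1 0 0 e) (scal m) * bdiag q p')"
      by (rule near_bdiag_conj[OF q(2,1) p])
    thus ?thesis unfolding bdiag_conj
      by (simp add: 3 pq(3) scal_commute[symmetric, of p] scal_commute[symmetric, of q']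
          mult.assoc p q)
  qed
qed

lemma comm_t1_iff: "comm t1 z \<longleftrightarrow> m12 z = 0 \<and> m21 z = 0"
  using eq_neg_iff_m2[of "m12 z"] eq_neg_iff_m2[of "m21 z"]
  by (cases z) (auto simp: bdiag_def)

text \<open>The centralizer of a matrix with eigenvalues 1 and -1 consists of the matrices u + v a,
  of discriminant (2v)^2.\<close>

lemma is_split_or_scal_if_comm:
  fixes a x :: "'a m2"
  assumes "comm a x" "\<not> is_scal a" "tr a = 0" "det2 a = - 1"
  shows "is_split x \<or> is_scal x"
proof -
  obtain u v where x: "x = scal u + scal v * a" using commuting_nonscalar[OF assms(1,2)] by blast
  have "disc x = (2 * v)\<^sup>2"
    unfolding x disc_lin by (simp add: disc_def assms power2_eq_square)
  moreover have "is_scal x" if "v = 0" using that by (auto simp: x is_scal_def)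
  ultimately show ?thesis using two unfolding is_split_def by (metis mult_eq_0_iff)
qed

text \<open>A common neighbour is block diagonal, with blocks x and y. If these are nonscalar, then
  a and d lie in their centralizers and are split or scalar. Otherwise x = -y is 1 or -1, and x b =
  b y forces b = 0, so that a and d are themselves involutions. As a and d have the same
  discriminant, they are split together.\<close>

lemma near_imp:
  assumes S: "M2 a b c d \<in> S" and "near (M2 a b c d)"
  shows "is_split a \<or> is_scal a \<and> is_scal d"
proof -
  note eqs = S[unfolded S_iff]
  note cp = same_charpoly[OF S]
  have disc: "disc d = disc a" 
    using cp by (simp add: disc_def det2_def) (metis power2_minus)
  have not_split: "\<not> is_split x" if "is_scal x" for x :: "'a m2"
    using that by (auto simp: is_split_def is_scal_def)
  have split_eq: "is_split d = is_split a" by (simp add: is_split_def disc)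
  have key: "is_split a \<or> is_scal a \<and> is_scal d"
    if "is_split a \<or> is_scal a" "is_split d \<or> is_scal d"
    using that split_eq by blast
  from assms(2) obtain z where z: "z \<in> S" "comm t1 z" "comm z (M2 a b c d)"
    unfolding near_def by blast
  from z(2) have "z = bdiag (m11 z) (m22 z)" unfolding comm_t1_iff by (simp add: bdiag_def m2_eq_iff)
  then obtain x y where z_eq: "z = bdiag x y" by blast
  have x: "x * x = 1" and y: "y * y = 1" and tr: "tr x + tr y = 0"
    using z(1) by (auto simp: z_eq bdiag_S_iff)
  have com: "comm x a" "comm y d" "x * b = b * y" "y * c = c * x"
    using z(3) by (auto simp: z_eq bdiag_def)
  have invol: "is_split w \<or> is_scal w" if "w * w = 1" for w :: "'a m2"
    using that
  proof (cases rule: involution_cases)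
    case 1
    hence "is_scal w" by (metis is_scal_def scal_simps(6))
    thus ?thesis ..
  next
    case 2
    hence "is_scal w" by (metis is_scal_def scal_simps(3,6))
    thus ?thesis ..
  next
    case 3
    thus ?thesis by (intro is_split_or_scal_if_comm[of w]) auto
  qed
  have bc: "is_split a \<or> is_scal a \<and> is_scal d" if "b = 0"
    by (rule key) (use that eqs invol in auto)
  have not2: "tr v \<noteq> 0" if "v = 1 \<or> v = - 1" for v :: "'a m2" using that two by auto
  from x show ?thesis
  proof (cases rule: involution_cases)
    case 1
    with y have "y = - 1"
      by (cases rule: involution_cases) (use tr four two in auto)
    hence "b = 0" using com(3) 1 by (simp add: eq_neg_iff_m2)
    thus ?thesis by (rule bc)
  next
    case 2
    have neg4: "(- 2 :: 'a) - 2 = - 4" by simp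
    from y have "y = 1"
      by (cases rule: involution_cases) (use tr 2 neg4 four two in auto)
    hence "b = 0" using com(3) 2 eq_neg_iff_m2[of b] by simp
    thus ?thesis by (rule bc)
  next
    case 3
    from y have "\<not> is_scal y \<and> tr y = 0 \<and> det2 y = - 1"
      by (cases rule: involution_cases) (use tr not2[of y] 3 in auto)
    thus ?thesis
      using 3 com by (intro key is_split_or_scal_if_comm[of x a] is_split_or_scal_if_comm[of y d]) auto
  qed
qed

lemma near_iff:
  assumes "M2 a b c d \<in> S"
  shows "near (M2 a b c d) \<longleftrightarrow> is_split a \<or> is_scal a \<and> is_scal d"
  using near_imp[OF assms] near_if_is_split[OF assms] near_if_is_scal assms
  by (auto simp: is_scal_def)

lemma near_if_zero:
  assumes S: "M2 a 0 c d \<in> S"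
  shows "near (M2 a 0 c d)"
proof -
  from S have a: "a * a = 1" "d * d = 1" "tr a + tr d = 0" by (auto simp: S_iff)
  from S have "disc d = disc a" using same_charpoly[OF S]
    by (simp add: disc_def det2_def) (metis power2_minus)
  hence *: "is_split d = is_split a" by (simp add: is_split_def)
  have "is_split x \<or> is_scal x" if "x * x = 1" for x :: "'a m2"
    using that
  proof (cases rule: involution_cases)
    case 1
    hence "is_scal x" by (metis is_scal_def scal_simps(6))
    thus ?thesis ..
  next
    case 2
    hence "is_scal x" by (metis is_scal_def scal_simps(3,6))
    thus ?thesis ..
  next
    case 3
    thus ?thesis by (intro is_split_or_scal_if_comm[of x]) auto
  qed
  with a * show ?thesis unfolding near_iff[OF S] by blast
qed

text \<open>A zero corner already gives distance at most 2. Otherwise the corner is normalised by a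
  block diagonal matrix, which fixes \<open>t1\<close>.\<close>

lemma near3_all:
  assumes "y \<in> S"
  shows "near3 y"
proof -
  obtain a b c d where y: "y = M2 a b c d" by (cases y)
  show ?thesis
  proof (cases "b = 0")
    case True
    hence "near y" using near_if_zero assms y by simp
    thus ?thesis using assms unfolding near_def near3_def by blast
  next
    case False
    then obtain p q e where pq: "is_invertible p" "is_invertible q" "b = p * M2 1 0 0 e * q" "e = 0 \<or> e = 1"
      by (rule diagonalize_equiv)
    from pq(1,2) obtain p' q' where p: "p * p' = 1" "p' * p = 1" and q: "q * q' = 1" "q' * q = 1"
      unfolding is_invertible_def by blast
    define z where "z = bdiag p' q * y * bdiag p q'"
    have b: "p' * b * q' = M2 1 0 0 e"
      by (simp add: pq(3) mult.assoc q conj_cancel[OF p(2)])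
    have "z = M2 (p' * a * p) (M2 1 0 0 e) (q * c * p) (q * d * q')"
      unfolding z_def y bdiag_conj b ..
    moreover have "z \<in> S" unfolding z_def by (rule S_conj[OF _ _ assms]) (simp_all add: p q)
    ultimately have "near3 z"
      using diagonalize_blocks_S pq(4) near3_if_diag_blocks by metis
    hence "near3 (bdiag p q' * z * bdiag p' q)"
      by (rule near3_bdiag_conj[OF p q(2,1)])
    moreover have "bdiag p q' * z * bdiag p' q = y"
      unfolding z_def by (simp add: mult.assoc p q conj_cancel[of "bdiag p q'" "bdiag p' q"])
    ultimately show ?thesis by simp
  qed
qed

end

section \<open>Counting in odd characteristic\<close>

text \<open>Block diagonal conjugation acts on corners by b -> p b q' with p and q' independent,
  hence transitively on the corners of rank 1.\<close>

lemma card_bdiag_conj_fibre: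
  fixes V :: "'a::{field, finite} m2 m2 \<Rightarrow> bool"
  assumes V: "\<And>p p' q q' y. p * p' = 1 \<Longrightarrow> p' * p = 1 \<Longrightarrow> q * q' = 1 \<Longrightarrow> q' * q = 1 \<Longrightarrow> V y \<Longrightarrow>
      V (bdiag p q * y * bdiag p' q')"
    and "b \<noteq> 0" "\<not> is_invertible b"
  shows "card {y. V y \<and> m12 y = b} = card {y. V y \<and> m12 y = M2 1 0 0 0}"
proof -
  from assms(2) obtain p q e where pq: "is_invertible p" "is_invertible q" "b = p * M2 1 0 0 e * q" "e = 0 \<or> e = 1"
    by (rule diagonalize_equiv)
  from pq(1,2) obtain p' q' where p: "p * p' = 1" "p' * p = 1" and q: "q * q' = 1" "q' * q = 1"
    unfolding is_invertible_def by blast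
  have "det2 p \<noteq> 0" "det2 q \<noteq> 0" "det2 b = 0" using pq(1,2) assms(3) by (simp_all add: is_invertible_det2)
  hence "e = 0" unfolding pq(3) by (simp add: det2_mult) (simp add: det2_def)
  hence b: "b = p * M2 1 0 0 0 * q" using pq(3) by simp
  have m12: "m12 (bdiag u v * y * bdiag u' v') = u * m12 y * v'" for u v u' v' :: "'a m2" and y
    by (cases y) (simp add: bdiag_conj)
  have inv: "bdiag u v * (bdiag u' v' * y * bdiag u v) * bdiag u' v' = y"
    if "u * u' = 1" "v * v' = 1" for u v u' v' :: "'a m2" and y
    using that by (simp add: mult.assoc conj_cancel[of "bdiag u v" "bdiag u' v'"])
  show ?thesis
  proof (rule card_eq_by_inverse[where f = "\<lambda>y. bdiag p' q * y * bdiag p q'"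
        and g = "\<lambda>y. bdiag p q' * y * bdiag p' q"])
    fix y assume "y \<in> {y. V y \<and> m12 y = b}"
    hence y: "V y" "m12 y = b" by auto
    have "p' * b * q' = M2 1 0 0 0" by (simp add: b mult.assoc q conj_cancel[OF p(2)])
    hence "m12 (bdiag p' q * y * bdiag p q') = M2 1 0 0 0" by (simp only: m12 y(2))
    thus "bdiag p q' * (bdiag p' q * y * bdiag p q') * bdiag p' q = y \<and>
        bdiag p' q * y * bdiag p q' \<in> {y. V y \<and> m12 y = M2 1 0 0 0}"
      using V[OF p(2,1) q y(1)] inv[OF p(1) q(2)] by blast
  next
    fix y assume "y \<in> {y. V y \<and> m12 y = M2 1 0 0 0}"
    hence y: "V y" "m12 y = M2 1 0 0 0" by auto
    have "m12 (bdiag p q' * y * bdiag p' q) = b" by (simp only: m12 y(2) b)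
    thus "bdiag p' q * (bdiag p q' * y * bdiag p' q) * bdiag p q' = y \<and>
        bdiag p q' * y * bdiag p' q \<in> {y. V y \<and> m12 y = b}"
      using V[OF p q(2,1) y(1)] inv[OF p(2) q(1)] by blast
  qed
qed

text \<open>The three summands are the ranks 2, 1, 0 of the corner. Rank 1 is reduced to one
  representative by the transitive action; in rank 2 the fibres can be computed for every b
  directly.\<close>

lemma card_by_corner:
  fixes V :: "'a::{field, finite} m2 m2 \<Rightarrow> bool"
  assumes V: "\<And>p p' q q' y. p * p' = 1 \<Longrightarrow> p' * p = 1 \<Longrightarrow> q * q' = 1 \<Longrightarrow> q' * q = 1 \<Longrightarrow> V y \<Longrightarrow>
      V (bdiag p q * y * bdiag p' q')"
    and inv: "\<And>b. is_invertible b \<Longrightarrow> card {y. V y \<and> m12 y = b} = n"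
  shows "card {y. V y} = card {b :: 'a m2. is_invertible b} * n +
    card {b :: 'a m2. b \<noteq> 0 \<and> \<not> is_invertible b} * card {y. V y \<and> m12 y = M2 1 0 0 0} +
    card {y. V y \<and> m12 y = 0}"
proof -
  have 1: "card {y \<in> {y. V y}. m12 y \<in> {b. is_invertible b}} = card {b :: 'a m2. is_invertible b} * n"
    by (rule card_fibres) (use inv in auto)
  have 2: "card {y \<in> {y. V y}. m12 y \<in> {b. b \<noteq> 0 \<and> \<not> is_invertible b}} =
      card {b :: 'a m2. b \<noteq> 0 \<and> \<not> is_invertible b} * card {y. V y \<and> m12 y = M2 1 0 0 0}"
  proof (rule card_fibres)
    fix b :: "'a m2" assume "b \<in> {b. b \<noteq> 0 \<and> \<not> is_invertible b}"
    hence "b \<noteq> 0" "\<not> is_invertible b" by auto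
    hence "card {y. V y \<and> m12 y = b} = card {y. V y \<and> m12 y = M2 1 0 0 0}"
      by (rule card_bdiag_conj_fibre[of V, rotated]) (rule V)
    thus "card {y \<in> {y. V y}. m12 y = b} = card {y. V y \<and> m12 y = M2 1 0 0 0}" by simp
  qed auto
  have zero: "\<not> is_invertible (0 :: 'a m2)" by (simp add: is_invertible_def)
  have split: "card {y. P y} = card {y. P y \<and> Q y} + card {y. P y \<and> \<not> Q y}" for P Q :: "'a m2 m2 \<Rightarrow> bool"
    using card_split_Collect[of P Q] by linarith
  have "{y. (V y \<and> \<not> is_invertible (m12 y)) \<and> m12 y = 0} = {y. V y \<and> m12 y = 0}"
    using zero by auto
  thus ?thesis
    using split[of V "\<lambda>y. is_invertible (m12 y)"]
      split[of "\<lambda>y. V y \<and> \<not> is_invertible (m12 y)" "\<lambda>y. m12 y = 0"] 1 2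
    by (simp add: conj_ac)
qed

locale odd_char_finite = odd_char field_type for field_type :: "'a::{field, finite} itself"
begin

definition q :: real where "q = real CARD('a)"

text \<open>An invertible corner leaves a free and determines c = b^-1 (1 - a^2) and d = -b^-1 a b;
  the trace condition is then automatic. The predicate \<open>P\<close> serves to count far
  elements, since over such a corner nearness depends on a alone.\<close>

lemma card_S_corner_invertible:
  assumes b: "is_invertible b"
  shows "card {y. (y \<in> S \<and> P (m11 y)) \<and> m12 y = b} = card {a. P a}"
proof -
  from b obtain b' where b': "b * b' = 1" "b' * b = 1" unfolding is_invertible_def by blast
  define g where "g a = M2 a b (b' * (1 - a * a)) (- (b' * a * b))" for a
  have "g a \<in> S" for a
    using tr_conj[OF b'(1), of a]
    by (simp add: g_def S_iff mult.assoc conj_cancel[OF b'(1)] algebra_simps b')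
  moreover have "g (m11 y) = y" if "y \<in> S" "m12 y = b" for y
  proof -
    obtain a c d where y: "y = M2 a b c d" using \<open>m12 y = b\<close> by (cases y) auto
    note eqs = \<open>y \<in> S\<close>[unfolded y S_iff]
    have "b * c = 1 - a * a" "b * d = - (a * b)" using eqs by (auto simp: algebra_simps add_eq_0_iff)
    hence "b' * (b * c) = b' * (1 - a * a)" "b' * (b * d) = - (b' * a * b)" by (simp_all add: mult.assoc)
    thus ?thesis by (simp add: y g_def conj_cancel[OF b'(2)])
  qed
  ultimately show ?thesis
    by (intro card_eq_by_inverse[where f = m11 and g = g]) (auto simp: g_def)
qed

text \<open>The general solution of the equations of \<open>S\<close> with corner
  \<open>M2 1 0 0 0\<close>: the lower right entry \<open>e\<close> of a satisfies e^2 = 1, and the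
  other four parameters are free.\<close>

definition e11_param :: "'a \<Rightarrow> 'a \<Rightarrow> 'a \<Rightarrow> 'a \<Rightarrow> 'a \<Rightarrow> 'a m2 m2" where
  "e11_param e u x z c = M2 (M2 u x 0 e) (M2 1 0 0 0)
     (M2 (1 - u * u) (- (x * (u + e))) (z * (u + e)) c) (M2 (- u) 0 z (- e))"

lemma e11_param_S: "e = 1 \<or> e = - 1 \<Longrightarrow> e11_param e u x z c \<in> S"
  by (auto simp: e11_param_def S_iff tr_def algebra_simps)

lemma S_e11:
  assumes "y \<in> S" "m12 y = M2 1 0 0 0"
  shows "y = e11_param (m22 (m11 y)) (m11 (m11 y)) (m12 (m11 y)) (m21 (m22 y)) (m22 (m21 y))"
    "m22 (m11 y) = 1 \<or> m22 (m11 y) = - 1"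
proof -
  obtain a1 a2 a3 a4 c1 c2 c3 c4 d1 d2 d3 d4 where
    y: "y = M2 (M2 a1 a2 a3 a4) (M2 1 0 0 0) (M2 c1 c2 c3 c4) (M2 d1 d2 d3 d4)"
    using assms(2) by (metis m2.exhaust m2.sel(2))
  note eqs = assms(1)[unfolded y, simplified S_iff tr_def M2_simps, simplified]
  have 1: "a3 = 0" "d2 = 0" "d1 = - a1" using eqs by (auto simp: add_eq_0_iff)
  have 2: "d4 = - a4" using eqs 1 by (auto simp: add_eq_0_iff)
  have "a4 * a4 = 1" using eqs 1 by auto
  thus e: "m22 (m11 y) = 1 \<or> m22 (m11 y) = - 1" by (simp add: y square_eq_1_iff)
  have "c1 = 1 - a1 * a1" "c2 = - (a2 * (a1 + a4))" "c3 = d3 * (a1 + a4)"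
  proof -
    have c: "a1 * a1 + c1 = 1" "a1 * a2 + a2 * a4 + c2 = 0" "c3 + (- (d3 * a1) - a4 * d3) = 0"
      using eqs 1 2 by auto
    show "c1 = 1 - a1 * a1" using c(1) by (simp add: eq_diff_eq add.commute)
    show "c2 = - (a2 * (a1 + a4))" using c(2) by (simp add: eq_neg_iff_add_eq_0 algebra_simps)
    show "c3 = d3 * (a1 + a4)" using c(3) unfolding add_eq_0_iff2 by (simp add: algebra_simps)
  qed
  thus "y = e11_param (m22 (m11 y)) (m11 (m11 y)) (m12 (m11 y)) (m21 (m22 y)) (m22 (m21 y))"
    by (simp add: y e11_param_def 1 2)
qed

lemma card_S_e11:
  "card {y. (y \<in> S \<and> P y) \<and> m12 y = M2 1 0 0 0} =
    card {(e, u, x, z, c). (e = 1 \<or> e = - 1) \<and> P (e11_param e u x z c)}"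
proof (rule card_eq_by_inverse[where g = "\<lambda>(e, u, x, z, c). e11_param e u x z c"
    and f = "\<lambda>y. (m22 (m11 y), m11 (m11 y), m12 (m11 y), m21 (m22 y), m22 (m21 y))"])
  fix y assume "y \<in> {y. (y \<in> S \<and> P y) \<and> m12 y = M2 1 0 0 0}"
  with S_e11[of y] show "(case (m22 (m11 y), m11 (m11 y), m12 (m11 y), m21 (m22 y), m22 (m21 y)) of
      (e, u, x, z, c) \<Rightarrow> e11_param e u x z c) = y \<and>
      (m22 (m11 y), m11 (m11 y), m12 (m11 y), m21 (m22 y), m22 (m21 y)) \<in>
        {(e, u, x, z, c). (e = 1 \<or> e = - 1) \<and> P (e11_param e u x z c)}"
    by simp
next
  fix p assume "p \<in> {(e, u, x, z, c). (e = 1 \<or> e = - 1) \<and> P (e11_param e u x z c)}"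
  then obtain e u x z c where p: "p = (e, u, x, z, c)" "e = 1 \<or> e = - 1" "P (e11_param e u x z c)" by auto
  let ?y = "e11_param e u x z c"
  have "?y \<in> S" using p(2) by (rule e11_param_S)
  thus "(m22 (m11 (case p of (e, u, x, z, c) \<Rightarrow> e11_param e u x z c)),
      m11 (m11 (case p of (e, u, x, z, c) \<Rightarrow> e11_param e u x z c)),
      m12 (m11 (case p of (e, u, x, z, c) \<Rightarrow> e11_param e u x z c)),
      m21 (m22 (case p of (e, u, x, z, c) \<Rightarrow> e11_param e u x z c)),
      m22 (m21 (case p of (e, u, x, z, c) \<Rightarrow> e11_param e u x z c))) = p \<and>
      (case p of (e, u, x, z, c) \<Rightarrow> e11_param e u x z c) \<in> {y. (y \<in> S \<and> P y) \<and> m12 y = M2 1 0 0 0}"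
    using p by (simp add: e11_param_def)
qed

lemma one_neq_neg_one: "(1 :: 'a) \<noteq> - 1" using eq_neg_iff[of 1] by simp

lemma card_e11_all: "card {y. (y \<in> S \<and> True) \<and> m12 y = M2 1 0 0 0} = 2 * CARD('a) ^ 4"
proof -
  have "{(e, u, x, z, c). (e = 1 \<or> e = - 1) \<and> True} =
      {1, - 1 :: 'a} \<times> (UNIV :: ('a \<times> 'a \<times> 'a \<times> 'a) set)" by auto
  thus ?thesis unfolding card_S_e11 using one_neq_neg_one
    by (simp add: card_cartesian_product card_prod power4_eq_xxxx)
qed

text \<open>The block a = (u, x; 0, e) has discriminant (u - e)^2; for u = e, the blocks a and d are
  both scalar exactly when x and z vanish.\<close>

lemma near_e11_param:
  assumes "e = 1 \<or> e = - 1"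
  shows "near (e11_param e u x z c) \<longleftrightarrow> u \<noteq> e \<or> (x = 0 \<and> z = 0)"
proof -
  have "disc (M2 u x 0 e) = (u - e)\<^sup>2"
    by (simp add: disc_def tr_def det2_def power2_eq_square algebra_simps)
  hence split: "is_split (M2 u x 0 e) \<longleftrightarrow> u \<noteq> e"
    unfolding is_split_def by (metis eq_iff_diff_eq_0 power2_eq_iff neg_equal_0_iff_equal power2_eq_square mult_eq_0_iff)
  have "e11_param e u x z c \<in> S" using assms by (rule e11_param_S)
  thus ?thesis unfolding e11_param_def
    by (subst near_iff) (auto simp: split is_scal_iff)
qed

lemma card_e11_far:
  "real (card {y. (y \<in> S \<and> \<not> near y) \<and> m12 y = M2 1 0 0 0}) = 2 * q * (q\<^sup>2 - 1)"
proof -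
  have "card {(e, u, x, z, c). (e = 1 \<or> e = - 1) \<and> \<not> near (e11_param e u x z c)} =
    card ({1, - 1 :: 'a} \<times> ((UNIV - {(0 :: 'a, 0 :: 'a)}) \<times> (UNIV :: 'a set)))"
    by (rule card_eq_by_inverse[where f = "\<lambda>(e, u, x, z, c). (e, (x, z), c)"
          and g = "\<lambda>(e, (x, z), c). (e, e, x, z, c)"])
      (auto simp: near_e11_param)
  also have "\<dots> = 2 * ((CARD('a) * CARD('a) - 1) * CARD('a))"
    using one_neq_neg_one by (simp add: card_cartesian_product card_Diff_subset card_prod)
  also have "real \<dots> = 2 * q * (q\<^sup>2 - 1)"
    using zero_less_card_finite[where 'a = 'a]
    by (simp add: q_def of_nat_diff Suc_leI power2_eq_square)
  finally show ?thesis unfolding card_S_e11 .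
qed

text \<open>The nonscalar 2x2 involutions, with eigenvalues 1 and -1.\<close>

abbreviation invols :: "'a m2 set" where "invols \<equiv> {a. tr a = 0 \<and> det2 a = - 1}"

lemma card_invols: "real (card invols) = q\<^sup>2 + q"
proof -
  have "{a :: 'a. a * (0 - a) = - 1} = {1, - 1}" by (auto simp: square_eq_1_iff)
  hence "card {a :: 'a. a * (0 - a) = - 1} = 2" using one_neq_neg_one by simp
  thus ?thesis unfolding card_tr_det2 by (simp add: q_def power2_eq_square algebra_simps)
qed

lemma invols_props: "a \<in> invols \<Longrightarrow> \<not> is_scal a" "a \<in> invols \<Longrightarrow> a * a = 1"
proof -
  assume a: "a \<in> invols"
  show "a * a = 1" using cayley_hamilton[of a] a by simp
  show "\<not> is_scal a"
  proof
    assume "is_scal a"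
    then obtain k where k: "a = scal k" by (auto simp: is_scal_def)
    hence "2 * k = 0" using a by auto
    hence "k = 0" using two unfolding mult_eq_0_iff by blast
    thus False using a k by (simp add: det2_def)
  qed
qed

lemma involution_pairs:
  assumes "a * a = 1" "d * d = 1" "tr a + tr d = 0"
  shows "a = 1 \<and> d = - 1 \<or> a = - 1 \<and> d = 1 \<or> a \<in> invols \<and> d \<in> invols"
proof -
  have neg4: "(- 2 :: 'a) - 2 = - 4" by simp
  from assms(1) show ?thesis
  proof (cases rule: involution_cases)
    case 1
    from assms(2) show ?thesis
      by (cases rule: involution_cases) (use assms(3) 1 neg4 four two in auto)
  next
    case 2
    from assms(2) show ?thesis
      by (cases rule: involution_cases) (use assms(3) 2 neg4 four two in auto)
  next
    case 3
    from assms(2) show ?thesis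
      by (cases rule: involution_cases) (use assms(3) 3 neg4 four two in auto)
  qed
qed

lemma one_not_invols: "(1 :: 'a m2) \<notin> invols" "(- 1 :: 'a m2) \<notin> invols" "(1 :: 'a m2) \<noteq> - 1"
  using two one_neq_neg_one by (auto simp: m2_eq_iff)

text \<open>For a = 1 or a = -1 one has d = -a and c is free, which gives q^4 each time. For
  nonscalar a and d the block c intertwines a with -d; these have the same characteristic
  polynomial, so there are q^2 choices.\<close>

lemma card_S_corner_zero:
  "real (card {y. y \<in> S \<and> m12 y = 0}) = 2 * q ^ 4 + (q\<^sup>2 + q)\<^sup>2 * q\<^sup>2"
proof -
  define V where "V = {y. y \<in> S \<and> m12 y = 0}"
  define I where "I = invols"
  have V: "y \<in> V \<longleftrightarrow> (\<exists>a c d. y = M2 a 0 c d \<and> a * a = 1 \<and> d * d = 1 \<and> tr a + tr d = 0 \<and> c * a = - d * c)" for y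
    by (cases y) (auto simp: V_def S_iff add_eq_0_iff2)
  have "m11 y = 1 \<or> m11 y = - 1 \<or> (m11 y, m22 y) \<in> I \<times> I" if "y \<in> V" for y
  proof -
    from that obtain a c d where y: "y = M2 a 0 c d" "a * a = 1" "d * d = 1" "tr a + tr d = 0"
      unfolding V by blast
    show ?thesis using involution_pairs[OF y(2-)] by (auto simp: y(1) I_def)
  qed
  hence "V = {y \<in> V. m11 y = 1} \<union> ({y \<in> V. m11 y = - 1} \<union> {y \<in> V. (m11 y, m22 y) \<in> I \<times> I})"
    by blast
  also have "card \<dots> = card {y \<in> V. m11 y = 1} + (card {y \<in> V. m11 y = - 1} + card {y \<in> V. (m11 y, m22 y) \<in> I \<times> I})"
    using one_not_invols by (subst card_Un_disjoint, (auto simp: I_def)[3])+ simp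
  also have "card {y \<in> V. m11 y = 1} = card (UNIV :: 'a m2 set)"
  proof (rule card_eq_by_inverse[where f = m21 and g = "\<lambda>c. M2 1 0 c (- 1)"])
    fix y assume "y \<in> {y \<in> V. m11 y = 1}"
    then obtain c d where y: "y = M2 1 0 c d" "d * d = 1" "2 + tr d = 0" by (auto simp: V)
    with involution_pairs[of 1 d] one_not_invols have "d = - 1" by auto
    thus "M2 1 0 (m21 y) (- 1) = y \<and> m21 y \<in> UNIV" using y by simp
  qed (simp add: V)
  also have "card {y \<in> V. m11 y = - 1} = card (UNIV :: 'a m2 set)"
  proof (rule card_eq_by_inverse[where f = m21 and g = "\<lambda>c. M2 (- 1) 0 c 1"])
    fix y assume "y \<in> {y \<in> V. m11 y = - 1}"
    then obtain c d where y: "y = M2 (- 1) 0 c d" "d * d = 1" "tr (- 1 :: 'a m2) + tr d = 0" by (auto simp: V)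
    with involution_pairs[of "- 1" d] one_not_invols have "d = 1" by auto
    thus "M2 (- 1) 0 (m21 y) 1 = y \<and> m21 y \<in> UNIV" using y by simp
  qed (simp add: V)
  also have "card {y \<in> V. (m11 y, m22 y) \<in> I \<times> I} = card (I \<times> I) * CARD('a)\<^sup>2"
  proof (rule card_fibres)
    fix r assume "r \<in> I \<times> I"
    then obtain a d where r: "r = (a, d)" "a \<in> I" "d \<in> I" by blast
    have "card {y \<in> V. (m11 y, m22 y) = r} = card {c. c * a = (- d) * c}"
      by (rule card_eq_by_inverse[where f = m21 and g = "\<lambda>c. M2 a 0 c d"])
        (use r invols_props in \<open>auto simp: V I_def\<close>)
    also have "\<dots> = CARD('a)\<^sup>2"
    proof (rule card_intertwiners)
      show "\<not> is_scal a" using r invols_props by (auto simp: I_def)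
      show "\<not> is_scal (- d)" using r invols_props(1)[of d] by (auto simp: I_def is_scal_iff)
      show "tr a = tr (- d)" "det2 a = det2 (- d)" using r by (auto simp: I_def det2_def)
    qed
    finally show "card {y \<in> V. (m11 y, m22 y) = r} = CARD('a)\<^sup>2" .
  qed auto
  finally have "real (card V) = 2 * q ^ 4 + (real (card I))\<^sup>2 * q\<^sup>2"
    by (simp add: card_m2 card_cartesian_product q_def power2_eq_square)
  thus ?thesis unfolding I_def card_invols V_def .
qed

lemma card_S: "real (card S) = q ^ 4 * (q\<^sup>2 + 1) * (q\<^sup>2 + q + 1)"
proof -
  have "card {y. y \<in> S} = card {b :: 'a m2. is_invertible b} * CARD('a) ^ 4 +
    card {b :: 'a m2. b \<noteq> 0 \<and> \<not> is_invertible b} * card {y. y \<in> S \<and> m12 y = M2 1 0 0 0} +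
    card {y. y \<in> S \<and> m12 y = 0}"
  proof (rule card_by_corner)
    fix b :: "'a m2" assume "is_invertible b"
    from card_S_corner_invertible[OF this, of "\<lambda>_. True"]
    show "card {y. y \<in> S \<and> m12 y = b} = CARD('a) ^ 4" by (simp add: card_m2)
  qed (auto intro: S_conj)
  hence "real (card {y. y \<in> S}) = real (card {b :: 'a m2. is_invertible b}) * q ^ 4 +
    real (card {b :: 'a m2. b \<noteq> 0 \<and> \<not> is_invertible b}) * (2 * q ^ 4) +
    real (card {y. y \<in> S \<and> m12 y = 0})"
    using card_e11_all by (simp add: q_def)
  also have "\<dots> = q ^ 4 * (q\<^sup>2 + 1) * (q\<^sup>2 + q + 1)"
    unfolding card_invertible card_singular_nonzero card_S_corner_zero q_def
    by (simp add: algebra_simps power_expand)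
  finally show ?thesis by simp
qed

lemma card_far:
  "real (card {y \<in> S. \<not> near y}) = 1/2 * q * (q - 1)^2 * (q + 1) * (q^4 + 5*q^2 + 6*q + 4)"
proof -
  have "card {y. y \<in> S \<and> \<not> near y} =
    card {b :: 'a m2. is_invertible b} * card {a :: 'a m2. \<not> is_split a \<and> \<not> is_scal a} +
    card {b :: 'a m2. b \<noteq> 0 \<and> \<not> is_invertible b} * card {y. (y \<in> S \<and> \<not> near y) \<and> m12 y = M2 1 0 0 0} +
    card {y. (y \<in> S \<and> \<not> near y) \<and> m12 y = 0}"
  proof (rule card_by_corner)
    fix p p' q q' :: "'a m2" and y
    assume p: "p * p' = 1" "p' * p = 1" "q * q' = 1" "q' * q = 1" and y: "y \<in> S \<and> \<not> near y"
    have "bdiag p' q' * (bdiag p q * y * bdiag p' q') * bdiag p q = y"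
      using p by (simp add: mult.assoc conj_cancel[of "bdiag p' q'" "bdiag p q"])
    with y near_bdiag_conj[OF p(2,1,4,3), of "bdiag p q * y * bdiag p' q'"]
    show "bdiag p q * y * bdiag p' q' \<in> S \<and> \<not> near (bdiag p q * y * bdiag p' q')"
      using S_conj[of "bdiag p' q'" "bdiag p q" y] p by auto
  next
    fix b :: "'a m2" assume b: "is_invertible b"
    then obtain b' where b': "b * b' = 1" "b' * b = 1" unfolding is_invertible_def by blast
    have "near y \<longleftrightarrow> is_split (m11 y) \<or> is_scal (m11 y)" if "y \<in> S" "m12 y = b" for y
    proof -
      obtain a c d where y: "y = M2 a b c d" using \<open>m12 y = b\<close> by (cases y) auto
      \<comment> \<open>The invertible corner conjugates a into -d, so the condition on d in
        \<open>near_iff\<close> follows from the one on a.\<close>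
      have "is_scal d" if "is_scal a"
      proof -
        from that obtain k where k: "a = scal k" by (auto simp: is_scal_def)
        have "b * d = - (a * b)" using \<open>y \<in> S\<close> by (simp add: y S_iff add_eq_0_iff)
        hence "b' * (b * d) = b' * (b * scal (- k))" by (simp add: k scal_commute flip: scal_simps(3))
        hence "d = scal (- k)" by (simp add: conj_cancel[OF b'(2)])
        thus ?thesis by (auto simp: is_scal_def)
      qed
      thus ?thesis using near_iff[of a b c d] \<open>y \<in> S\<close> by (auto simp: y)
    qed
    hence "{y. (y \<in> S \<and> \<not> near y) \<and> m12 y = b} =
        {y. (y \<in> S \<and> (\<not> is_split (m11 y) \<and> \<not> is_scal (m11 y))) \<and> m12 y = b}" by blast
    thus "card {y. (y \<in> S \<and> \<not> near y) \<and> m12 y = b} = card {a :: 'a m2. \<not> is_split a \<and> \<not> is_scal a}"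
      using card_S_corner_invertible[OF b, of "\<lambda>a. \<not> is_split a \<and> \<not> is_scal a"] by simp
  qed
  \<comment> \<open>A zero corner contributes no far elements.\<close>
  moreover have "near y" if "y \<in> S" "m12 y = 0" for y
    using that near_if_zero by (cases y) simp
  hence "{y. (y \<in> S \<and> \<not> near y) \<and> m12 y = 0} = {}" by blast
  ultimately have "2 * real (card {y. y \<in> S \<and> \<not> near y}) =
    real (card {b :: 'a m2. is_invertible b}) * (2 * real (card {a :: 'a m2. \<not> is_split a \<and> \<not> is_scal a})) +
    real (card {b :: 'a m2. b \<noteq> 0 \<and> \<not> is_invertible b}) * (2 * (2 * q * (q\<^sup>2 - 1)))"
    using card_e11_far by simp
  also have "\<dots> = q * (q - 1)^2 * (q + 1) * (q^4 + 5*q^2 + 6*q + 4)"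
    unfolding card_invertible card_singular_nonzero card_not_diagonalizable[OF two] q_def
    by (simp add: algebra_simps power_expand)
  finally show ?thesis by simp
qed

text \<open>The elements commuting with \<open>t1\<close> are block diagonal: \<open>t1\<close> and
  its negative, and all pairs of nonscalar 2x2 involutions.\<close>

lemma card_comm: "real (card {y \<in> S. comm t1 y}) = q\<^sup>2 * (q + 1)\<^sup>2 + 2"
proof -
  have "{y \<in> S. comm t1 y} = {bdiag 1 (- 1), bdiag (- 1) 1} \<union> (\<lambda>(a, d). bdiag a d) ` (invols \<times> invols)"
    (is "?L = ?R")
  proof
    show "?L \<subseteq> ?R"
    proof
      fix y assume y: "y \<in> ?L"
      hence "m12 y = 0 \<and> m21 y = 0" using comm_t1_iff[of y] by blast
      hence "y = bdiag (m11 y) (m22 y)" by (simp add: bdiag_def m2_eq_iff)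
      then obtain a d where y': "y = bdiag a d" by blast
      with y involution_pairs[of a d] have "a = 1 \<and> d = - 1 \<or> a = - 1 \<and> d = 1 \<or> a \<in> invols \<and> d \<in> invols"
        by (simp add: bdiag_S_iff)
      thus "y \<in> ?R" unfolding y' by (auto simp: image_iff)
    qed
    show "?R \<subseteq> ?L" using invols_props(2) by (auto simp: bdiag_S_iff)
  qed
  hence "card {y \<in> S. comm t1 y} = card ?R" by simp
  also have "card ?R = 2 + card (invols \<times> invols)"
  proof (subst card_Un_disjoint)
    have "inj_on (\<lambda>(a, d). bdiag a d) (invols \<times> invols)" by (auto simp: inj_on_def bdiag_def)
    thus "card {bdiag 1 (- 1), bdiag (- 1) 1 :: 'a m2 m2} + card ((\<lambda>(a, d). bdiag a d) ` (invols \<times> invols)) =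
        2 + card (invols \<times> invols)"
      using one_not_invols by (simp add: card_image bdiag_def)
    show "{bdiag 1 (- 1), bdiag (- 1) 1} \<inter> (\<lambda>(a, d). bdiag a d) ` (invols \<times> invols) = {}"
      using one_not_invols by (auto simp: bdiag_def)
  qed auto
  finally have "card {y \<in> S. comm t1 y} = 2 + card invols * card invols"
    by (simp only: card_cartesian_product)
  hence "real (card {y \<in> S. comm t1 y}) = 2 + real (card invols) * real (card invols)" by simp
  thus ?thesis unfolding card_invols by (simp add: power2_eq_square algebra_simps)
qed

end

section \<open>Characteristic two\<close>

locale even_char =
  fixes field_type :: "'a::field itself"
  assumes two: "(1 :: 'a) + 1 = 0"
begin

abbreviation n1 :: "'a m2 m2" where "n1 \<equiv> M2 0 0 1 0"

abbreviation jj :: "'a m2" where "jj \<equiv> M2 0 0 1 0"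

abbreviation ee :: "'a m2" where "ee \<equiv> M2 0 1 0 0"

lemma add_self [simp]: "x + x = (0 :: 'a)"
  by (metis distrib_left mult.right_neutral mult_zero_right two)

lemma neg_eq [simp]: "- x = (x :: 'a)"
  by (simp add: neg_eq_iff_add_eq_0)

lemma diff_eq [simp]: "x - y = x + (y :: 'a)"
  by (metis diff_conv_add_uminus neg_eq)

lemma add_self' [simp]: "x + (x + y) = (y :: 'a)"
  by (simp add: add.assoc[symmetric])

lemma add_eq_0 [simp]: "x + y = 0 \<longleftrightarrow> x = (y :: 'a)"
  by (metis add_eq_0_iff neg_eq)

lemma add_self_m2 [simp]: "x + x = (0 :: 'a m2)"
  by (simp add: m2_eq_iff)

lemma neg_eq_m2 [simp]: "- x = (x :: 'a m2)"
  by (simp add: m2_eq_iff)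

lemma diff_eq_m2 [simp]: "x - y = x + (y :: 'a m2)"
  by (simp add: m2_eq_iff)

lemma add_self_m2' [simp]: "x + (x + y) = (y :: 'a m2)"
  by (simp add: add.assoc[symmetric])

lemma add_eq_0_m2 [simp]: "x + y = 0 \<longleftrightarrow> x = (y :: 'a m2)"
  by (auto simp: m2_eq_iff)

lemma two_eq_0: "(2 :: 'a) = 0" by (metis one_add_one two)

section \<open>Nonzero nilpotent blocks, and the class as 1 plus square-zero matrices of rank
  2\<close>

definition nil :: "'a m2 \<Rightarrow> bool" where
  "nil x \<longleftrightarrow> tr x = 0 \<and> det2 x = 0 \<and> x \<noteq> 0"

lemma nilI: "x * x = 0 \<Longrightarrow> x \<noteq> 0 \<Longrightarrow> nil x"
proof -
  assume x: "x * x = 0" "x \<noteq> 0"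
  have "det2 x * det2 x = 0" using det2_mult[of x x] x(1) by (simp add: det2_def)
  hence d: "det2 x = 0" by simp
  with cayley_hamilton[of x] x(1) have "scal (tr x) * x = 0" by simp
  hence "tr x = 0" using x(2) by (auto simp: scal_def m2_eq_iff)
  thus "nil x" using d x(2) by (simp add: nil_def)
qed

lemma nil_nonscal: "nil x \<Longrightarrow> \<not> is_scal x"
  by (auto simp: nil_def is_scal_def det2_def scal_def)

lemma nil_jj: "nil jj" "nil ee" by (simp_all add: nil_def tr_def det2_def)

lemma nil_conj: "nil x \<Longrightarrow> nil y \<Longrightarrow> conj_to x y"
  by (rule conj_to_if_same_charpoly) (auto simp: nil_nonscal nil_def)

text \<open>The second condition is a contracting homotopy for \<open>x\<close> as a differential: it says that
  kernel and image of \<open>x\<close> coincide, i.e. that \<open>x\<close> has rank 2.\<close>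
definition S :: "'a m2 m2 set" where "S = {x. x * x = 0 \<and> (\<exists>k. x * k + k * x = 1)}"

lemma S_conj:
  assumes "g' * g = 1" "g * g' = 1" "y \<in> S"
  shows "g * y * g' \<in> S"
proof -
  from assms(3) obtain k where y: "y * y = 0" "y * k + k * y = 1" by (auto simp: S_def)
  have "g * y * g' * (g * y * g') = g * (y * y) * g'"
    by (simp add: mult.assoc conj_cancel[OF assms(1)])
  moreover have "g * y * g' * (g * k * g') + g * k * g' * (g * y * g') = g * (y * k + k * y) * g'"
    by (simp add: mult.assoc conj_cancel[OF assms(1)] distrib_left distrib_right)
  ultimately show ?thesis using y assms(2) by (auto simp: S_def)
qed

lemma S_conj_to:
  assumes "conj_to x y" "x \<in> S" shows "y \<in> S"
proof -
  from assms(1) obtain g g' where "g * g' = 1" "g' * g = 1" "y = g * x * g'"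
    unfolding conj_to_def by blast
  thus ?thesis using S_conj assms(2) by simp
qed

lemma uconj_S: "y \<in> S \<Longrightarrow> uconj x y \<in> S"
  using S_conj_to conj_to_uconj by blast

lemma uconj_S_iff: "uconj x y \<in> S \<longleftrightarrow> y \<in> S"
  using uconj_S by (metis uconj_inverse(1))

lemma S_eqs:
  assumes "M2 a b c d \<in> S"
  shows "a * a = b * c" "a * b = b * d" "c * a = d * c" "c * b = d * d"
  using assms by (simp_all add: S_def)

text \<open>Since x^2 = 0, multiplying \<open>x * k + k * x = 1\<close> by x gives x = x k x, whose
  trace is that of k x^2 = 0.\<close>

lemma S_tr:
  assumes "x \<in> S" shows "tr (tr x) = 0"
proof -
  from assms obtain k where x: "x * x = 0" "x * k + k * x = 1" by (auto simp: S_def)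
  have "x = x * (x * k + k * x)" by (simp add: x)
  also have "\<dots> = x * x * k + x * (k * x)" by (simp only: distrib_left mult.assoc)
  finally have "tr (tr x) = tr (tr (x * (k * x)))" using x(1) by simp
  also have "\<dots> = tr (tr (k * (x * x)))" by (subst ring_tr_mult_commute) (simp add: mult.assoc)
  finally show ?thesis using x(1) by simp
qed

text \<open>These are the simplest neighbours of \<open>n1\<close>: products of strictly lower block
  triangular matrices vanish.\<close>

lemma S_lower: "M2 0 0 c 0 \<in> S \<longleftrightarrow> is_invertible c"
proof
  assume "M2 0 0 c 0 \<in> S"
  then obtain k where "M2 0 0 c 0 * k + k * M2 0 0 c 0 = 1" by (auto simp: S_def)
  hence "m12 k * c = 1" "c * m12 k = 1" by (cases k; simp)+
  thus "is_invertible c" unfolding is_invertible_def by blast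
next
  assume "is_invertible c"
  then obtain k where "c * k = 1" "k * c = 1" unfolding is_invertible_def by blast
  thus "M2 0 0 c 0 \<in> S" by (auto simp: S_def intro!: exI[of _ "M2 0 k 0 0"])
qed

lemma n1_S: "n1 \<in> S" by (simp add: S_lower is_invertible_det2)

lemma flip_bdiag_jj: "flip (bdiag jj jj) = n1"
  by (simp add: flip_def bdiag_def m2_eq_iff)

lemma conj_to_bdiag_nil:
  assumes "nil k" "nil l"
  shows "conj_to n1 (bdiag k l)"
proof -
  have "conj_to (bdiag jj jj) (bdiag k l)"
    using assms nil_conj nil_jj by (intro conj_to_bdiag) auto
  moreover have "conj_to n1 (bdiag jj jj)" by (metis conj_to_flipI conj_to_refl flip_bdiag_jj)
  ultimately show ?thesis using conj_to_trans by blast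
qed

lemma bdiag_S_iff: "bdiag k l \<in> S \<longleftrightarrow> nil k \<and> nil l"
proof
  assume S: "bdiag k l \<in> S"
  then obtain h where "bdiag k l * h + h * bdiag k l = 1" by (auto simp: S_def)
  hence "k * m11 h + m11 h * k = 1" "l * m22 h + m22 h * l = 1"
    by (cases h; simp add: bdiag_def)+
  hence "k \<noteq> 0" "l \<noteq> 0" by auto
  moreover have "k * k = 0" "l * l = 0" using S by (auto simp: S_def bdiag_def)
  ultimately show "nil k \<and> nil l" using nilI by blast
next
  assume "nil k \<and> nil l"
  thus "bdiag k l \<in> S" using conj_to_bdiag_nil S_conj_to n1_S by blast
qed

lemma conj_to_diag_blocks:
  assumes "y \<in> S" "diag_blocks y"
  shows "conj_to n1 y"
proof -
  from assms(2) obtain k l where *: "flip y = bdiag k l" unfolding diag_blocks_def by blast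
  have "conj_to y (bdiag k l)" using conj_to_flip * by metis
  hence "bdiag k l \<in> S" using assms(1) by (rule S_conj_to)
  hence "conj_to n1 (bdiag k l)" by (intro conj_to_bdiag_nil) (auto simp: bdiag_S_iff)
  thus ?thesis using * conj_to_flipI by metis
qed

text \<open>By the diagonal blocks of \<open>x * k + k * x = 1\<close>, a = 0 makes c invertible,
  and then d c = c a = 0 gives d = 0; likewise d = 0 gives a = 0. If neither vanishes, both are
  square-zero because b = 0.\<close>

lemma S_corner_zero:
  assumes S: "M2 a 0 c d \<in> S"
  shows "a = 0 \<and> d = 0 \<and> is_invertible c \<or> nil a \<and> nil d"
proof -
  from S obtain k where "M2 a 0 c d * k + k * M2 a 0 c d = 1" by (auto simp: S_def)
  hence k: "a * m11 k + m11 k * a + m12 k * c = 1" "c * m12 k + d * m22 k + m22 k * d = 1"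
    by (cases k; simp add: add_ac)+
  note eqs = S_eqs[OF S]
  have "d = 0" if "a = 0"
  proof -
    have "m12 k * c = 1" using that k by simp
    hence "is_invertible c" unfolding is_invertible_det2
      by (metis det2_1 det2_mult mult_zero_right zero_neq_one)
    then obtain c' where "c * c' = 1" unfolding is_invertible_def by blast
    moreover have "d * c = 0" using eqs(3) that by simp
    ultimately show "d = 0" by (metis mult.assoc mult.right_neutral mult_zero_left)
  qed
  moreover have "a = 0" if "d = 0"
  proof -
    have "c * m12 k = 1" using that k by simp
    hence "is_invertible c" unfolding is_invertible_det2
      by (metis det2_1 det2_mult mult_zero_left zero_neq_one)
    then obtain c' where "c' * c = 1" unfolding is_invertible_def by blast
    moreover have "c * a = 0" using eqs(3) that by simp
    ultimately show "a = 0" by (metis mult.assoc mult.left_neutral mult_zero_right)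
  qed
  ultimately consider "a = 0" "d = 0" | "a \<noteq> 0" "d \<noteq> 0" by blast
  thus ?thesis
  proof cases
    case 1
    thus ?thesis using S S_lower by simp
  next
    case 2
    thus ?thesis using eqs nilI by auto
  qed
qed

text \<open>Once a and d are both conjugated to \<open>jj\<close>, the intertwiner c becomes an
  element u + v jj of the centralizer of \<open>jj\<close>, which a unitriangular conjugation
  removes.\<close>

lemma S_corner_zero_conj:
  assumes nil: "nil a" "nil d" and ca: "c * a = d * c"
  shows "conj_to n1 (M2 a 0 c d)"
proof -
  from nil_conj[OF nil(1) nil_jj(1)] obtain p p' where p: "p * p' = 1" "p' * p = 1" "jj = p * a * p'"
    unfolding conj_to_def by blast
  from nil_conj[OF nil(2) nil_jj(1)] obtain q q' where q: "q * q' = 1" "q' * q = 1" "jj = q * d * q'"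
    unfolding conj_to_def by blast
  define k where "k = q * c * p'"
  have "k * jj = q * (c * a) * p'"
    by (simp only: k_def p(3) mult.assoc conj_cancel[OF p(2)])
  also have "\<dots> = jj * k"
    by (simp only: ca k_def q(3) mult.assoc conj_cancel[OF q(2)])
  finally have "k * jj = jj * k" .
  hence "k = M2 (m11 k) 0 (m21 k) (m11 k)" by (cases k) auto
  then obtain u v where k: "k = M2 u 0 v u" by blast
  have "conj_to (M2 a 0 c d) (bdiag p q * M2 a 0 c d * bdiag p' q')"
    by (rule conj_toI') (simp_all add: p q)
  also have "bdiag p q * M2 a 0 c d * bdiag p' q' = M2 jj 0 k jj"
    unfolding bdiag_conj p(3)[symmetric] q(3)[symmetric] k_def by simp
  finally have "conj_to (M2 a 0 c d) (M2 jj 0 k jj)" .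
  \<comment> \<open>\<open>M2 v u 0 0\<close> solves x jj + jj x = k; in characteristic 2 the
    matrices x jj + jj x fill the whole centralizer of \<open>jj\<close>.\<close>
  moreover have "uconj (M2 v u 0 0) (M2 jj 0 k jj) = bdiag jj jj"
    by (simp add: uconj_M2 k bdiag_def)
  hence "conj_to (M2 jj 0 k jj) (bdiag jj jj)" by (metis conj_to_uconj)
  ultimately have "conj_to (M2 a 0 c d) (bdiag jj jj)" by (rule conj_to_trans)
  thus ?thesis
    by (rule conj_to_trans[OF conj_to_bdiag_nil[OF nil_jj(1) nil_jj(1)] conj_to_sym])
qed

text \<open>Conjugation clears part of a and d, and the square-zero equations clear the rest. The
  explicit form, sharper than \<open>diag_blocks\<close>, is what a path in \<open>near3_all\<close>
  is written down for.\<close>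

lemma corner_normal_form:
  assumes S: "M2 a (M2 1 0 0 e) c d \<in> S" and "e = 0 \<or> e = 1"
  obtains x k where "uconj x (M2 a (M2 1 0 0 e) c d) = M2 0 (M2 1 0 0 e) (M2 0 0 0 k) 0"
    "e = 1 \<Longrightarrow> k = 0"
  using assms(2)
proof
  assume e: "e = 1"
  define y where "y = uconj a (M2 a (M2 1 0 0 e) c d)"
  have 1: "(M2 1 0 0 1 :: 'a m2) = 1" by simp
  obtain c' d' where y: "y = M2 0 1 c' d'" unfolding y_def uconj_M2 e 1 by simp
  have "y \<in> S" unfolding y_def using S by (rule uconj_S)
  from S_eqs[OF this[unfolded y]] have "c' = 0" "d' = 0" by auto
  hence "y = M2 0 (M2 1 0 0 e) (M2 0 0 0 0) 0" by (simp add: y e)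
  thus thesis unfolding y_def by (rule that) simp
next
  assume e: "e = 0"
  \<comment> \<open>The first row of x cancels that of a, and the entry \<open>m21 d\<close> cancels
    the lower left entry of d.\<close>
  define x where "x = M2 (m11 a) (m12 a) (m21 d) 0"
  define y where "y = uconj x (M2 a (M2 1 0 0 e) c d)"
  obtain a3 a4 c1 c2 c3 c4 d1 d2 d4 where
    y: "y = M2 (M2 0 0 a3 a4) (M2 1 0 0 0) (M2 c1 c2 c3 c4) (M2 d1 d2 0 d4)"
    by (cases a; cases d; cases "m21 y") (simp add: y_def uconj_M2 x_def e)
  have "y \<in> S" unfolding y_def using S by (rule uconj_S)
  from S_eqs[OF this[unfolded y]] have "y = M2 0 (M2 1 0 0 e) (M2 0 0 0 c4) 0"
    by (auto simp: y e)
  thus thesis unfolding y_def by (rule that) (simp add: e)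
qed

lemma conj_to_n1_if_S:
  assumes "y \<in> S"
  shows "conj_to n1 y"
proof -
  obtain a b c d where y: "y = M2 a b c d" by (cases y)
  show ?thesis
  proof (cases "b = 0")
    case True
    from S_corner_zero[of a c d] assms consider "a = 0" "d = 0" "is_invertible c" | "nil a" "nil d"
      by (auto simp: y True)
    thus ?thesis
    proof cases
      case 1
      then obtain c' where c: "c * c' = 1" "c' * c = 1" unfolding is_invertible_def by blast
      have "conj_to y (bdiag c 1 * y * bdiag c' 1)" by (rule conj_toI') (simp_all add: c)
      moreover have "bdiag c 1 * y * bdiag c' 1 = n1" by (simp add: y True 1 bdiag_conj c)
      ultimately show ?thesis by (metis conj_to_sym)
    next
      case 2
      thus ?thesis using S_eqs(3)[of a b c d] assms by (simp add: y True S_corner_zero_conj)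
    qed
  next
    case False
    then obtain p q e where pq: "is_invertible p" "is_invertible q" "b = p * M2 1 0 0 e * q" "e = 0 \<or> e = 1"
      by (rule diagonalize_equiv)
    from pq(1,2) obtain p' q' where p: "p * p' = 1" "p' * p = 1" and q: "q * q' = 1" "q' * q = 1"
      unfolding is_invertible_def by blast
    define z where "z = bdiag p' q * y * bdiag p q'"
    have b: "p' * b * q' = M2 1 0 0 e"
      by (simp add: pq(3) mult.assoc q conj_cancel[OF p(2)])
    have "conj_to y z" unfolding z_def by (rule conj_toI') (simp_all add: p q)
    moreover have "z = M2 (p' * a * p) (M2 1 0 0 e) (q * c * p) (q * d * q')"
      unfolding z_def y bdiag_conj b ..
    moreover from \<open>conj_to y z\<close> have "z \<in> S" using assms by (rule S_conj_to)
    ultimately obtain x k where "uconj x z = M2 0 (M2 1 0 0 e) (M2 0 0 0 k) 0"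
      using corner_normal_form pq(4) by metis
    hence "diag_blocks (uconj x z)" by (simp add: diag_blocks_iff)
    hence "conj_to n1 (uconj x z)" using \<open>z \<in> S\<close> uconj_S by (intro conj_to_diag_blocks)
    thus ?thesis using \<open>conj_to y z\<close> conj_to_uconj by (metis conj_to_sym conj_to_trans)
  qed
qed

lemma S_eq: "S = {y. conj_to n1 y}"
  using conj_to_n1_if_S S_conj_to n1_S by blast

section \<open>Distance at most 2 and at most 3 in characteristic 2, where steps may be
  trivial\<close>

definition near :: "'a m2 m2 \<Rightarrow> bool" where
  "near y \<longleftrightarrow> (\<exists>z\<in>S. comm n1 z \<and> comm z y)"

definition near3 :: "'a m2 m2 \<Rightarrow> bool" where
  "near3 y \<longleftrightarrow> (\<exists>z\<in>S. \<exists>w\<in>S. comm n1 z \<and> comm z w \<and> comm w y)"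

lemma comm_n1_iff: "comm n1 z \<longleftrightarrow> m12 z = 0 \<and> m22 z = m11 z"
  by (cases z) auto

text \<open>A common neighbour z has equal diagonal blocks x, and x commutes with b. If x = 0, then
  w is invertible and b w = 0, so b = 0. Otherwise x is a nonzero nilpotent and b = u + v x has
  trace 2u = 0.\<close>

lemma near_imp:
  assumes S: "M2 a b c d \<in> S" and "near (M2 a b c d)"
  shows "tr b = 0"
proof -
  from assms(2) obtain z where z: "z \<in> S" "comm n1 z" "comm z (M2 a b c d)"
    unfolding near_def by blast
  from z(2) have "m12 z = 0 \<and> m22 z = m11 z" unfolding comm_n1_iff .
  then obtain x w where z': "z = M2 x 0 w x" by (cases z) auto
  have eqs: "x * b = b * x" "x * a = a * x + b * w" using z(3) by (auto simp: z')
  from S_corner_zero[of x w x] z(1) consider "x = 0" "is_invertible w" | "nil x"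
    by (auto simp: z')
  thus ?thesis
  proof cases
    case 1
    then obtain w' where "w * w' = 1" unfolding is_invertible_def by blast
    moreover have "b * w = 0" using eqs 1 by simp
    ultimately have "b = 0" by (metis mult.assoc mult.right_neutral mult_zero_left)
    thus ?thesis by simp
  next
    case 2
    obtain u v where b: "b = scal u + scal v * x"
      using commuting_nonscalar[OF eqs(1) nil_nonscal[OF 2]] by blast
    have "tr (scal v * x) = v * tr x" by (simp add: tr_def scal_def algebra_simps)
    thus ?thesis using 2 by (simp add: b nil_def two_eq_0)
  qed
qed

lemma S_comm_n1:
  assumes "nil x" "comm x w"
  shows "M2 x 0 w x \<in> S"
  using S_corner_zero_conj[OF assms(1,1)] assms(2) S_conj_to n1_S by metis

text \<open>Unless \<open>b\<close> is scalar, the common neighbour is \<open>ty + yt - r\<close>, where \<open>r\<^sup>2 = det b\<close>.\<close>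
lemma near_if_tr_zero:
  assumes sqrt: "\<And>v :: 'a. \<exists>r. r * r = v"
    and S: "M2 a b c d \<in> S" and "tr b = 0"
  shows "near (M2 a b c d)"
proof -
  note eqs = S_eqs[OF S]
  consider "b = 0" | r where "b = scal r" "r \<noteq> 0" | "\<not> is_scal b"
    by (metis is_scal_def scal_simps(5))
  thus ?thesis
  proof cases
    case 1
    from S_corner_zero[of a c d] S 1 consider "a = 0" "d = 0" | "nil a" "nil d" by auto
    thus ?thesis
    proof cases
      case a: 1
      have "comm n1 (M2 a b c d)" by (simp add: 1 a)
      thus ?thesis using S unfolding near_def by blast
    next
      case 2
      from nil_conj[OF this] obtain s s' where s: "s * s' = 1" "s' * s = 1" "d = s * a * s'"
        unfolding conj_to_def by blast
      have "s * a = d * s" by (simp add: s mult.assoc)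
      \<comment> \<open>With b = 0, both products only involve the lower left block, where they are
        s a and d s; the block c does not enter.\<close>
      hence "comm (M2 0 0 s 0) (M2 a b c d)" by (simp add: 1)
      moreover have "M2 0 0 s 0 \<in> S" using s unfolding S_lower is_invertible_def by blast
      ultimately show ?thesis unfolding near_def by (intro bexI[of _ "M2 0 0 s 0"]) auto
    qed
  next
    case 2
    \<comment> \<open>Here a = d, so ty + yt - r vanishes and gives no candidate. Instead the
      diagonal block is prescribed as \<open>jj\<close>, and \<open>w\<close> is the solution of jj
      a = a jj + b w. It commutes with \<open>jj\<close> because jj^2 = 0.\<close>
    define w where "w = scal (1 / r) * (jj * a + a * jj)"
    have r: "scal (1 / r) * scal r = 1" "scal r * scal (1 / r) = 1" using 2 by simp_all
    have canc: "scal r * (scal (1 / r) * x) = x" "scal (1 / r) * (scal r * x) = x" for x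
      by (simp_all only: mult.assoc[symmetric] r mult_1_left)
    have sc: "x * scal k = scal k * x" "x * (scal k * y) = scal k * (x * y)" for x y and k :: 'a
      by (metis scal_commute, metis mult.assoc scal_commute)
    have d: "d = a" using eqs(2) canc(2) 2 by (metis scal_commute)
    have c: "c = scal (1 / r) * (a * a)" using eqs(1) canc(2) 2 by metis
    have jj: "jj * jj = 0" by simp
    hence j: "jj * jj = 0" "jj * (jj * x) = 0" for x :: "'a m2"
      by (simp, metis mult.assoc mult_zero_left)
    have "comm jj w"
      by (simp add: w_def sc j distrib_left distrib_right mult.assoc del: M2_simps)
    hence "M2 jj 0 w jj \<in> S" using nil_jj by (intro S_comm_n1)
    moreover have "comm n1 (M2 jj 0 w jj)" by simp
    moreover have "comm (M2 jj 0 w jj) (M2 a b c d)"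
    proof -
      have bw: "b * w = jj * a + a * jj" unfolding w_def \<open>b = scal r\<close> canc ..
      have wb: "w * b = b * w" unfolding \<open>b = scal r\<close> by (rule scal_commute[symmetric])
      have 1: "jj * a = a * jj + b * w" by (simp add: bw add_ac del: M2_simps)
      have 2: "w * b + jj * d = d * jj" by (simp add: wb bw d add_ac del: M2_simps)
      have 3: "w * a + jj * c = c * jj + d * w"
        unfolding w_def c d
        by (simp add: sc distrib_left distrib_right mult.assoc add_ac del: M2_simps)
      have 4: "jj * b = b * jj" unfolding \<open>b = scal r\<close> by (rule scal_commute[symmetric])
      show ?thesis using 1 2 3 4 by (simp add: M2_simps(4)[where 'a = "'a m2"] del: M2_simps)
    qed
    ultimately show ?thesis unfolding near_def by (intro bexI[of _ "M2 jj 0 w jj"]) auto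
  next
    case 3
    \<comment> \<open>The characteristic polynomial of b is X^2 + det b = (X + r)^2, so b + r is
      nilpotent.\<close>
    obtain r where r: "r * r = det2 b" using sqrt by blast
    define x where "x = b + scal r"
    have "det2 x = det2 b + r * tr b + r * r"
      by (simp add: x_def det2_def tr_def scal_def algebra_simps)
    hence "det2 x = 0" using r assms(3) by simp
    moreover have "tr x = 0" using assms(3) by (simp add: x_def two_eq_0)
    moreover have "x \<noteq> 0" using 3 by (auto simp: x_def is_scal_def)
    ultimately have "nil x" by (simp add: nil_def)
    have "tr a = tr d" using S_tr[OF S] by (simp add: tr_def add_ac)
    \<comment> \<open>Taking adjugates in \<open>ab = bd\<close> yields \<open>ba = db\<close>.\<close>
    have "adj2 b = b" using assms(3) by (simp add: adj2_eq)
    moreover have "adj2 b * adj2 a = adj2 d * adj2 b" using eqs(2) by (metis adj2_mult_distrib)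
    moreover have "adj2 a = scal (tr a) + a" "adj2 d = scal (tr d) + d" by (simp_all add: adj2_eq)
    ultimately have "b * (scal (tr a) + a) = (scal (tr d) + d) * b" by simp
    hence ba: "b * a = d * b" using \<open>tr a = tr d\<close> by (simp add: distrib_left distrib_right scal_commute)
    have sc: "y * scal r = scal r * y" for y by (rule scal_commute[symmetric])
    have "comm x (a + d)"
      by (simp add: x_def distrib_left distrib_right sc ba eqs add_ac)
    hence "M2 x 0 (a + d) x \<in> S" using \<open>nil x\<close> by (intro S_comm_n1)
    moreover have "comm n1 (M2 x 0 (a + d) x)" by simp
    moreover have "comm (M2 x 0 (a + d) x) (M2 a b c d)"
      by (simp add: x_def distrib_left distrib_right sc ba eqs add_ac)
    ultimately show ?thesis unfolding near_def by (intro bexI[of _ "M2 x 0 (a + d) x"]) auto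
  qed
qed

text \<open>A block diagonal matrix that normalises b need not fix \<open>n1\<close>. Therefore the
  first step of the path goes to a matrix \<open>M2 0 0 s 0\<close>: this shape commutes with
  \<open>n1\<close>, survives block diagonal conjugation and is fixed by
  \<open>uconj\<close>.\<close>

lemma near3_all:
  assumes sqrt: "\<And>v :: 'a. \<exists>r. r * r = v" and "y \<in> S"
  shows "near3 y"
proof -
  obtain a b c d where y: "y = M2 a b c d" by (cases y)
  show ?thesis
  proof (cases "b = 0")
    case True
    hence "near y" using near_if_tr_zero[OF sqrt] assms y by simp
    thus ?thesis using assms unfolding near_def near3_def by blast
  next
    case False
    then obtain p q e where pq: "is_invertible p" "is_invertible q" "b = p * M2 1 0 0 e * q" "e = 0 \<or> e = 1"
      by (rule diagonalize_equiv)
    from pq(1,2) obtain p' q' where p: "p * p' = 1" "p' * p = 1" and q: "q * q' = 1" "q' * q = 1"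
      unfolding is_invertible_def by blast
    define z where "z = bdiag p' q * y * bdiag p q'"
    have b: "p' * b * q' = M2 1 0 0 e"
      by (simp add: pq(3) mult.assoc q conj_cancel[OF p(2)])
    have z: "z = M2 (p' * a * p) (M2 1 0 0 e) (q * c * p) (q * d * q')"
      unfolding z_def y bdiag_conj b ..
    moreover have "z \<in> S" unfolding z_def by (rule S_conj[OF _ _ assms(2)]) (simp_all add: p q)
    ultimately obtain x k where x: "uconj x z = M2 0 (M2 1 0 0 e) (M2 0 0 0 k) 0" "e = 1 \<Longrightarrow> k = 0"
      using corner_normal_form pq(4) by metis
    have "\<exists>s w0. is_invertible s \<and> w0 \<in> S \<and> comm (M2 0 0 s 0) w0 \<and> comm w0 (uconj x z)"
      using pq(4)
    proof
      assume "e = 0"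
      \<comment> \<open>All products of \<open>ee\<close> and \<open>jj\<close> with the two
        off-diagonal blocks that occur in the commutation vanish, and the swap
        \<open>M2 0 1 1 0\<close> conjugates \<open>ee\<close> into \<open>jj\<close>.\<close>
      thus ?thesis
        by (intro exI[of _ "M2 0 1 1 0"] exI[of _ "bdiag ee jj"])
          (simp add: x bdiag_S_iff nil_jj is_invertible_det2 det2_def, simp add: bdiag_def)
    next
      assume "e = 1"
      thus ?thesis
        by (intro exI[of _ 1] exI[of _ "bdiag jj jj"])
          (simp add: x bdiag_S_iff nil_jj is_invertible_det2, simp add: bdiag_def)
    qed
    then obtain s w0 where s: "is_invertible s" "w0 \<in> S" "comm (M2 0 0 s 0) w0" "comm w0 (uconj x z)"
      by blast
    define w1 where "w1 = uconj (- x) w0"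
    define g where "g = bdiag p q'"
    define g' where "g' = bdiag p' q"
    have g: "g * g' = 1" "g' * g = 1" by (simp_all add: g_def g'_def p q)
    have "M2 0 0 s 0 = uconj (- x) (M2 0 0 s 0)" by (simp add: uconj_M2)
    hence "comm (M2 0 0 s 0) w1" using comm_uconj[OF s(3), of "- x"] by (simp add: w1_def)
    hence "comm (g * M2 0 0 s 0 * g') (g * w1 * g')" by (rule conj_comm[OF g(2)])
    moreover have "comm w1 z" using comm_uconj[OF s(4), of "- x"] uconj_inverse(1)[of x z] by (simp add: w1_def)
    hence "comm (g * w1 * g') (g * z * g')" by (rule conj_comm[OF g(2)])
    moreover have "g * z * g' = y"
      unfolding z_def g_def[symmetric] g'_def[symmetric] by (simp add: mult.assoc g conj_cancel[OF g(1)])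
    moreover have "g * w1 * g' \<in> S" unfolding w1_def by (intro S_conj g uconj_S s)
    moreover have "g * M2 0 0 s 0 * g' \<in> S" using s(1) by (intro S_conj g) (simp add: S_lower)
    moreover have "comm n1 (g * M2 0 0 s 0 * g')" by (simp add: g_def g'_def bdiag_conj)
    ultimately show ?thesis unfolding near3_def by metis
  qed
qed

end

section \<open>Counting in characteristic two\<close>

locale even_char_finite = even_char field_type for field_type :: "'a::{field, finite} itself"
begin

definition q :: real where "q = real CARD('a)"

text \<open>Squaring is additive in characteristic 2, hence injective, and a finite field makes it
  surjective.\<close>

lemma sqrt_exists: "\<exists>r. r * r = (v :: 'a)"
proof -
  have "inj (\<lambda>r :: 'a. r * r)"
  proof (rule injI)
    fix r s :: 'a assume "r * r = s * s"
    hence "(r + s) * (r + s) = 0" by (simp add: algebra_simps)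
    thus "r = s" by simp
  qed
  hence "surj (\<lambda>r :: 'a. r * r)" by (rule finite_UNIV_inj_surj[rotated]) simp
  thus ?thesis by (metis surjD)
qed

lemma near_iff: "y \<in> S \<Longrightarrow> near y \<longleftrightarrow> tr (m12 y) = 0"
  by (cases y) (use near_imp near_if_tr_zero[OF sqrt_exists] in auto)

text \<open>The solutions are unitriangular conjugates of \<open>M2 0 b 0 0\<close>, one for each a.
  Writing them so settles the rank condition in \<open>S\<close>, which the block equations do not
  show.\<close>

lemma card_S_corner_invertible:
  assumes b: "is_invertible b"
  shows "card {y. y \<in> S \<and> m12 y = b} = CARD('a) ^ 4"
proof -
  from b obtain b' where b': "b * b' = 1" "b' * b = 1" unfolding is_invertible_def by blast
  define g where "g a = M2 a b (b' * (a * a)) (b' * (a * b))" for a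
  have "M2 0 b 0 0 \<in> S"
    using b' by (auto simp: S_def intro!: exI[of _ "M2 0 0 b' 0"])
  moreover have "g a = uconj (b' * a) (M2 0 b 0 0)" for a
    by (simp add: g_def uconj_M2 mult.assoc conj_cancel[OF b'(1)])
  ultimately have "g a \<in> S" for a by (simp add: uconj_S)
  moreover have "g (m11 y) = y" if "y \<in> S" "m12 y = b" for y
  proof -
    obtain a c d where y: "y = M2 a b c d" using \<open>m12 y = b\<close> by (cases y) auto
    note eqs = S_eqs[OF \<open>y \<in> S\<close>[unfolded y]]
    show ?thesis by (simp add: y g_def eqs(1,2) conj_cancel[OF b'(2)])
  qed
  ultimately have "card {y. y \<in> S \<and> m12 y = b} = card (UNIV :: 'a m2 set)"
    by (intro card_eq_by_inverse[where f = m11 and g = g]) (auto simp: g_def)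
  thus ?thesis by (simp add: card_m2)
qed

text \<open>Every solution is a unitriangular conjugate of the normal form \<open>n k\<close>, with
  three free parameters; rank 2 means that k is nonzero, whence the factor q - 1.\<close>

lemma card_S_e11:
  "real (card {y. y \<in> S \<and> m12 y = M2 1 0 0 0}) = q ^ 3 * (q - 1)"
proof -
  define n where "n k = M2 0 (M2 1 0 0 0) (M2 0 0 0 k) (0 :: 'a m2)" for k :: 'a
  define g where "g = (\<lambda>(u, x, z, k). uconj (M2 u x z 0) (n k))"
  \<comment> \<open>Exchanging the indices makes \<open>n k\<close> block diagonal, where membership
    in \<open>S\<close> is decided block by block.\<close>
  have "flip (n k) = bdiag ee (M2 0 0 k 0)" for k
    by (simp add: n_def flip_def bdiag_def m2_eq_iff)
  hence "n k \<in> S \<longleftrightarrow> nil ee \<and> nil (M2 0 0 k 0)" for k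
    by (metis bdiag_S_iff S_conj_to conj_to_flip conj_to_sym)
  hence n: "n k \<in> S \<longleftrightarrow> k \<noteq> 0" for k by (simp add: nil_jj) (simp add: nil_def tr_def det2_def)
  have "card {y. y \<in> S \<and> m12 y = M2 1 0 0 0} =
      card {(u :: 'a, x :: 'a, z :: 'a, k :: 'a). k \<noteq> 0}"
  proof (rule card_eq_by_inverse[where g = g
        and f = "\<lambda>y. (m11 (m11 y), m12 (m11 y), m21 (m22 y), m22 (m21 y) + m21 (m22 y) * m12 (m11 y))"])
    fix y assume "y \<in> {y. y \<in> S \<and> m12 y = M2 1 0 0 0}"
    hence y: "y \<in> S" "m12 y = M2 1 0 0 0" by auto
    then obtain a1 a2 a3 a4 c1 c2 c3 c4 d1 d2 d3 d4 where
      y'': "y = M2 (M2 a1 a2 a3 a4) (M2 1 0 0 0) (M2 c1 c2 c3 c4) (M2 d1 d2 d3 d4)"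
      by (metis m2.exhaust m2.sel(2))
    note eqs = S_eqs[OF y(1)[unfolded y'']]
    \<comment> \<open>The conjugation that clears a and d also adds d3 * a2 to the last entry of c;
      this explains the last coordinate of the bijection.\<close>
    have "uconj (M2 a1 a2 d3 0) y = n (c4 + d3 * a2)"
      using eqs by (auto simp: y'' uconj_M2 n_def mult.commute)
    hence *: "uconj (M2 a1 a2 d3 0) (n (c4 + d3 * a2)) = y"
      using uconj_inverse(1)[of "M2 a1 a2 d3 0" y] by (simp del: M2_simps)
    hence "n (c4 + d3 * a2) \<in> S" using y(1) uconj_S_iff by metis
    hence **: "c4 + d3 * a2 \<noteq> 0" unfolding n .
    have comps: "m11 (m11 y) = a1" "m12 (m11 y) = a2" "m21 (m22 y) = d3" "m22 (m21 y) = c4"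
      by (simp_all add: y'')
    show "g (m11 (m11 y), m12 (m11 y), m21 (m22 y), m22 (m21 y) + m21 (m22 y) * m12 (m11 y)) = y \<and>
        (m11 (m11 y), m12 (m11 y), m21 (m22 y), m22 (m21 y) + m21 (m22 y) * m12 (m11 y))
          \<in> {(u, x, z, k). k \<noteq> 0}"
      unfolding comps using * ** by (simp add: g_def)
  next
    fix p :: "'a \<times> 'a \<times> 'a \<times> 'a" assume "p \<in> {(u, x, z, k). k \<noteq> 0}"
    then obtain u x z k where p: "p = (u, x, z, k)" "k \<noteq> 0" by auto
    have "g p \<in> S" using p n by (simp add: g_def uconj_S)
    thus "(m11 (m11 (g p)), m12 (m11 (g p)), m21 (m22 (g p)), m22 (m21 (g p)) + m21 (m22 (g p)) * m12 (m11 (g p))) = p \<and>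
        g p \<in> {y. y \<in> S \<and> m12 y = M2 1 0 0 0}"
      by (simp add: p g_def) (simp add: uconj_M2 n_def add_ac)
  qed
  also have "{(u :: 'a, x :: 'a, z :: 'a, k :: 'a). k \<noteq> 0} = UNIV \<times> UNIV \<times> UNIV \<times> {k. k \<noteq> 0}" by auto
  also have "card \<dots> = CARD('a) ^ 3 * card {k :: 'a. k \<noteq> 0}"
    by (simp add: card_cartesian_product power3_eq_cube)
  finally show ?thesis by (simp add: card_nonzero q_def)
qed

lemma card_nil: "real (card {a :: 'a m2. nil a}) = q\<^sup>2 - 1"
  unfolding nil_def card_nilpotent_nonzero q_def ..

text \<open>Either a = d = 0 and c is any invertible block, or a and d are nonzero nilpotents and c
  is one of their q^2 intertwiners.\<close>

lemma card_S_corner_zero: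
  "real (card {y. y \<in> S \<and> m12 y = 0}) = (q\<^sup>2 - 1) * (q\<^sup>2 - q) + (q\<^sup>2 - 1)\<^sup>2 * q\<^sup>2"
proof -
  define V where "V = {y. y \<in> S \<and> m12 y = 0}"
  define I where "I = {a :: 'a m2. nil a}"
  have V: "y \<in> V \<longleftrightarrow> (\<exists>a c d. y = M2 a 0 c d \<and>
      (a = 0 \<and> d = 0 \<and> is_invertible c \<or> nil a \<and> nil d \<and> c * a = d * c))" for y
  proof
    assume "y \<in> V"
    then obtain a c d where "y = M2 a 0 c d" "M2 a 0 c d \<in> S" by (cases y) (auto simp: V_def)
    thus "\<exists>a c d. y = M2 a 0 c d \<and>
      (a = 0 \<and> d = 0 \<and> is_invertible c \<or> nil a \<and> nil d \<and> c * a = d * c)"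
      using S_corner_zero[of a c d] S_eqs(3)[of a 0 c d] by blast
  next
    assume "\<exists>a c d. y = M2 a 0 c d \<and>
      (a = 0 \<and> d = 0 \<and> is_invertible c \<or> nil a \<and> nil d \<and> c * a = d * c)"
    then obtain a c d where y: "y = M2 a 0 c d"
      "a = 0 \<and> d = 0 \<and> is_invertible c \<or> nil a \<and> nil d \<and> c * a = d * c" by blast
    from y(2) have "y \<in> S"
    proof
      assume "a = 0 \<and> d = 0 \<and> is_invertible c" thus ?thesis by (simp add: y(1) S_lower)
    next
      assume "nil a \<and> nil d \<and> c * a = d * c"
      hence "conj_to n1 y" unfolding y(1) by (intro S_corner_zero_conj) auto
      thus ?thesis using n1_S by (rule S_conj_to)
    qed
    thus "y \<in> V" by (simp add: V_def y(1))
  qed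
  have zero: "\<not> nil 0" by (simp add: nil_def)
  have "V = {y \<in> V. m11 y = 0} \<union> {y \<in> V. (m11 y, m22 y) \<in> I \<times> I}"
    by (auto simp: V I_def)
  hence "card V = card ({y \<in> V. m11 y = 0} \<union> {y \<in> V. (m11 y, m22 y) \<in> I \<times> I})" by simp
  also have "\<dots> = card {y \<in> V. m11 y = 0} + card {y \<in> V. (m11 y, m22 y) \<in> I \<times> I}"
    using zero by (intro card_Un_disjoint) (auto simp: I_def)
  also have "card {y \<in> V. m11 y = 0} = card {c :: 'a m2. is_invertible c}"
    by (rule card_eq_by_inverse[where f = m21 and g = "\<lambda>c. M2 0 0 c 0"])
      (use zero in \<open>auto simp: V\<close>)
  also have "card {y \<in> V. (m11 y, m22 y) \<in> I \<times> I} = card (I \<times> I) * CARD('a)\<^sup>2"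
  proof (rule card_fibres)
    fix r assume "r \<in> I \<times> I"
    then obtain a d where r: "r = (a, d)" "nil a" "nil d" by (auto simp: I_def)
    have "card {y \<in> V. (m11 y, m22 y) = r} = card {c. c * a = d * c}"
      by (rule card_eq_by_inverse[where f = m21 and g = "\<lambda>c. M2 a 0 c d"])
        (use r zero in \<open>auto simp: V\<close>)
    also have "\<dots> = CARD('a)\<^sup>2"
      using r by (intro card_intertwiners nil_nonscal) (auto simp: nil_def)
    finally show "card {y \<in> V. (m11 y, m22 y) = r} = CARD('a)\<^sup>2" .
  qed auto
  finally have "real (card V) = real (card {c :: 'a m2. is_invertible c}) + (real (card I))\<^sup>2 * q\<^sup>2"
    by (simp add: card_cartesian_product q_def power2_eq_square)
  thus ?thesis unfolding I_def V_def card_nil card_invertible by (simp add: q_def)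
qed

lemma card_S: "real (card S) = q * (q - 1)\<^sup>2 * (q + 1) * (q\<^sup>2 + 1) * (q\<^sup>2 + q + 1)"
proof -
  have "card {y. y \<in> S} = card {b :: 'a m2. is_invertible b} * CARD('a) ^ 4 +
    card {b :: 'a m2. b \<noteq> 0 \<and> \<not> is_invertible b} * card {y. y \<in> S \<and> m12 y = M2 1 0 0 0} +
    card {y. y \<in> S \<and> m12 y = 0}"
    by (rule card_by_corner) (auto intro: S_conj card_S_corner_invertible)
  hence "real (card {y. y \<in> S}) = real (card {b :: 'a m2. is_invertible b}) * q ^ 4 +
    real (card {b :: 'a m2. b \<noteq> 0 \<and> \<not> is_invertible b}) * (q ^ 3 * (q - 1)) +
    real (card {y. y \<in> S \<and> m12 y = 0})"
    using card_S_e11 by (simp add: q_def)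
  also have "\<dots> = q * (q - 1)\<^sup>2 * (q + 1) * (q\<^sup>2 + 1) * (q\<^sup>2 + q + 1)"
    unfolding card_invertible card_singular_nonzero card_S_corner_zero q_def
    by (simp add: algebra_simps power_expand)
  finally show ?thesis by simp
qed

text \<open>Nearness is a condition on tr b, which b -> p b q' does not preserve. So only the fibres
  of \<open>S\<close> are compared, and the corners of nonzero trace are counted by rank.\<close>

lemma card_far: "real (card {y \<in> S. \<not> near y}) = q ^ 4 * (q ^ 4 - q ^ 3 - q\<^sup>2 + 1)"
proof -
  define R1 where "R1 = {b :: 'a m2. is_invertible b \<and> tr b \<noteq> 0}"
  define R2 where "R2 = {b :: 'a m2. det2 b = 0 \<and> tr b \<noteq> 0}"
  have "card {y \<in> S. \<not> near y} = card ({y \<in> S. m12 y \<in> R1} \<union> {y \<in> S. m12 y \<in> R2})"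
    by (rule arg_cong[of _ _ card]) (auto simp: R1_def R2_def near_iff is_invertible_det2)
  also have "\<dots> = card {y \<in> S. m12 y \<in> R1} + card {y \<in> S. m12 y \<in> R2}"
    by (rule card_Un_disjoint) (auto simp: R1_def R2_def is_invertible_det2)
  also have "card {y \<in> S. m12 y \<in> R1} = card R1 * CARD('a) ^ 4"
    by (rule card_fibres) (auto simp: R1_def card_S_corner_invertible)
  also have "card {y \<in> S. m12 y \<in> R2} = card R2 * card {y. y \<in> S \<and> m12 y = M2 1 0 0 0}"
  proof (rule card_fibres)
    fix b assume "b \<in> R2"
    hence "b \<noteq> 0" "\<not> is_invertible b" by (auto simp: R2_def is_invertible_det2)
    thus "card {y \<in> S. m12 y = b} = card {y. y \<in> S \<and> m12 y = M2 1 0 0 0}"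
      by (intro card_bdiag_conj_fibre) (auto intro: S_conj)
  qed auto
  finally have "real (card {y \<in> S. \<not> near y}) = real (card R1) * q ^ 4 + real (card R2) * (q ^ 3 * (q - 1))"
    using card_S_e11 by (simp add: q_def)
  also have "\<dots> = q ^ 4 * (q ^ 4 - q ^ 3 - q\<^sup>2 + 1)"
    unfolding R1_def R2_def card_invertible_tr_nonzero card_singular_tr q_def
    by (simp add: algebra_simps power_expand)
  finally show ?thesis .
qed

text \<open>The diagonal blocks of such an element agree: either they vanish and w is invertible, or
  they are a nonzero nilpotent x and w is one of the q^2 elements of its centralizer.\<close>

lemma card_comm: "real (card {y \<in> S. comm n1 y}) = 2 * q ^ 4 - q ^ 3 - 2 * q\<^sup>2 + q"
proof -
  define V where "V = {y \<in> S. comm n1 y}"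
  define I where "I = {a :: 'a m2. nil a}"
  have V: "y \<in> V \<longleftrightarrow> (\<exists>x w. y = M2 x 0 w x \<and>
      (x = 0 \<and> is_invertible w \<or> nil x \<and> w * x = x * w))" for y
  proof
    assume "y \<in> V"
    hence "y \<in> S" "m12 y = 0 \<and> m22 y = m11 y" using comm_n1_iff[of y] by (auto simp: V_def)
    then obtain x w where "y = M2 x 0 w x" "M2 x 0 w x \<in> S" by (cases y) auto
    thus "\<exists>x w. y = M2 x 0 w x \<and> (x = 0 \<and> is_invertible w \<or> nil x \<and> w * x = x * w)"
      using S_corner_zero[of x w x] S_eqs(3)[of x 0 w x] by blast
  next
    assume "\<exists>x w. y = M2 x 0 w x \<and> (x = 0 \<and> is_invertible w \<or> nil x \<and> w * x = x * w)"
    then obtain x w where y: "y = M2 x 0 w x" "x = 0 \<and> is_invertible w \<or> nil x \<and> w * x = x * w" by blast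
    from y(2) have "y \<in> S" using S_comm_n1[of x w] S_lower[of w] y(1) by auto
    thus "y \<in> V" by (simp add: V_def y(1))
  qed
  have zero: "\<not> nil 0" by (simp add: nil_def)
  have "V = {y \<in> V. m11 y = 0} \<union> {y \<in> V. m11 y \<in> I}"
    by (auto simp: V I_def)
  hence "card V = card ({y \<in> V. m11 y = 0} \<union> {y \<in> V. m11 y \<in> I})" by simp
  also have "\<dots> = card {y \<in> V. m11 y = 0} + card {y \<in> V. m11 y \<in> I}"
    using zero by (intro card_Un_disjoint) (auto simp: I_def)
  also have "card {y \<in> V. m11 y = 0} = card {c :: 'a m2. is_invertible c}"
    by (rule card_eq_by_inverse[where f = m21 and g = "\<lambda>c. M2 0 0 c 0"])
      (use zero in \<open>auto simp: V\<close>)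
  also have "card {y \<in> V. m11 y \<in> I} = card I * CARD('a)\<^sup>2"
  proof (rule card_fibres)
    fix a assume "a \<in> I"
    hence a: "nil a" by (simp add: I_def)
    have "card {y \<in> V. m11 y = a} = card {c. c * a = a * c}"
      by (rule card_eq_by_inverse[where f = m21 and g = "\<lambda>c. M2 a 0 c a"])
        (use a zero in \<open>auto simp: V\<close>)
    also have "\<dots> = CARD('a)\<^sup>2"
      using a by (intro card_intertwiners nil_nonscal) auto
    finally show "card {y \<in> V. m11 y = a} = CARD('a)\<^sup>2" .
  qed auto
  finally have "real (card V) = real (card {c :: 'a m2. is_invertible c}) + real (card I) * q\<^sup>2"
    by (simp add: q_def)
  thus ?thesis unfolding I_def V_def card_nil card_invertible
    by (simp add: q_def algebra_simps power_expand)
qed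

end

section \<open>Distances in commuting graphs\<close>

lemma length_le_2_cases:
  assumes "length p \<le> 2"
  obtains "p = []" | e where "p = [e]" | e f where "p = [e, f]"
  using assms by (cases p; cases "tl p"; cases "tl (tl p)") auto

context
  fixes G :: "('a, 'b) monoid_scheme" and X :: "'a set"
begin

abbreviation "C x y \<equiv> x \<otimes>\<^bsub>G\<^esub> y = y \<otimes>\<^bsub>G\<^esub> x"

interpretation wf_digraph "with_proj (commuting_graph G X)"
  by (rule wf_digraph_commuting_graph)

lemma awalk_cost_one: "awalk_cost (\<lambda>_. 1) p = real (length p)"
  by (induction p) auto

lemma graph_dist_eq_length:
  assumes "awalk x p y" "\<And>p'. awalk x p' y \<Longrightarrow> length p \<le> length p'"
  shows "graph_dist (commuting_graph G X) x y = ereal (real (length p))"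
  unfolding graph_dist_def \<mu>_def
  by (rule INF_eqI) (use assms in \<open>auto simp: awalk_cost_one\<close>)

lemma commuting_graph_simps [simp]:
  "pverts (commuting_graph G X) = X"
  "(x, y) \<in> parcs (commuting_graph G X) \<longleftrightarrow> x \<in> X \<and> y \<in> X \<and> x \<noteq> y \<and> C x y"
  by (auto simp: commuting_graph_def)

lemma awalk_Nil: "awalk x [] y \<longleftrightarrow> x \<in> X \<and> x = y"
  by (auto simp: awalk_Nil_iff)

lemma awalk_Cons:
  "awalk x (e # p) y \<longleftrightarrow> fst e = x \<and> x \<in> X \<and> snd e \<in> X \<and> x \<noteq> snd e \<and> C x (snd e) \<and> awalk (snd e) p y"
  by (cases e) (auto simp: awalk_Cons_iff)

lemma graph_dist_0: "x \<in> X \<Longrightarrow> graph_dist (commuting_graph G X) x x = ereal (real 0)"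
  using graph_dist_eq_length[of x "[]" x] by (simp add: awalk_Nil)

lemma graph_dist_1:
  assumes "x \<in> X" "y \<in> X" "x \<noteq> y" "C x y"
  shows "graph_dist (commuting_graph G X) x y = ereal (real 1)"
proof -
  have "p \<noteq> []" if "awalk x p y" for p using that assms(3) by (auto simp: awalk_Nil)
  thus ?thesis using graph_dist_eq_length[of x "[(x, y)]" y] assms
    by (simp add: awalk_Nil awalk_Cons Suc_le_eq)
qed

lemma graph_dist_2:
  assumes "x \<in> X" "y \<in> X" "\<not> C x y" "z \<in> X" "C x z" "C z y"
  shows "graph_dist (commuting_graph G X) x y = ereal (real 2)"
proof -
  have "awalk x [(x, z), (z, y)] y" using assms by (auto simp: awalk_Nil awalk_Cons)
  moreover have "length [(x, z), (z, y)] \<le> length p" if "awalk x p y" for p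
  proof (rule ccontr)
    assume "\<not> length [(x, z), (z, y)] \<le> length p"
    hence "length p \<le> 2" "length p \<noteq> 2" by auto
    thus False using that assms
      by (cases rule: length_le_2_cases) (auto simp: awalk_Nil awalk_Cons)
  qed
  ultimately have "graph_dist (commuting_graph G X) x y = ereal (real (length [(x, z), (z, y)]))"
    by (rule graph_dist_eq_length)
  thus ?thesis by simp
qed

lemma graph_dist_3:
  assumes "x \<in> X" "y \<in> X" "z \<in> X" "w \<in> X" "C x z" "C z w" "C w y"
    and far: "\<And>z. z \<in> X \<Longrightarrow> C x z \<Longrightarrow> \<not> C z y"
  shows "graph_dist (commuting_graph G X) x y = ereal (real 3)"
proof -
  \<comment> \<open>If two consecutive vertices coincide, then \<open>z\<close> or \<open>w\<close>
    commutes with both ends, against \<open>far\<close>.\<close>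
  have "x \<noteq> z" "z \<noteq> w" "w \<noteq> y" using assms far[of w] far[of z] by auto
  hence "awalk x [(x, z), (z, w), (w, y)] y" using assms by (auto simp: awalk_Nil awalk_Cons)
  moreover have "length [(x, z), (z, w), (w, y)] \<le> length p" if "awalk x p y" for p
  proof (rule ccontr)
    assume "\<not> length [(x, z), (z, w), (w, y)] \<le> length p"
    hence "length p \<le> 2" by auto
    \<comment> \<open>As commuting is reflexive, taking an end itself in \<open>far\<close> excludes
      walks of length 0 and 1.\<close>
    thus False using that assms far[of y] far[of x]
      by (cases rule: length_le_2_cases) (auto simp: awalk_Nil awalk_Cons)
  qed
  ultimately have "graph_dist (commuting_graph G X) x y =
      ereal (real (length [(x, z), (z, w), (w, y)]))"
    by (rule graph_dist_eq_length)
  thus ?thesis by simp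
qed

text \<open>Steps may be trivial here because commuting is reflexive; so these are bounds on the distance.\<close>
definition "path2 x y \<longleftrightarrow> (\<exists>z\<in>X. C x z \<and> C z y)"
definition "path3 x y \<longleftrightarrow> (\<exists>z\<in>X. \<exists>w\<in>X. C x z \<and> C z w \<and> C w y)"

lemma graph_dist_cases:
  assumes "x \<in> X" "y \<in> X" "path3 x y"
  shows "graph_dist (commuting_graph G X) x y =
    ereal (real (if x = y then 0 else if C x y then 1 else if path2 x y then 2 else 3))"
  using assms graph_dist_0[of x] graph_dist_1[of x y] graph_dist_2[of x y] graph_dist_3[of x y]
  unfolding path2_def path3_def by (smt (verit))

lemma dist_spheres:
  assumes "x \<in> X" "\<And>y. y \<in> X \<Longrightarrow> path3 x y"
  shows "dist_sphere (commuting_graph G X) 1 x = {y \<in> X. C x y} - {x}"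
    "dist_sphere (commuting_graph G X) 2 x = {y \<in> X. path2 x y} - {y \<in> X. C x y}"
    "dist_sphere (commuting_graph G X) 3 x = {y \<in> X. \<not> path2 x y}"
proof -
  have *: "y \<in> dist_sphere (commuting_graph G X) i x \<longleftrightarrow> y \<in> X \<and>
      i = (if x = y then 0 else if C x y then 1 else if path2 x y then 2 else 3)" for y i
    unfolding dist_sphere_def using graph_dist_cases[OF assms(1) _ assms(2), of y]
    by auto
  have 2: "path2 x y" if "y \<in> X" "C x y" for y
    using that assms(1) unfolding path2_def by blast
  show "dist_sphere (commuting_graph G X) 1 x = {y \<in> X. C x y} - {x}"
    unfolding set_eq_iff * by auto
  show "dist_sphere (commuting_graph G X) 2 x = {y \<in> X. path2 x y} - {y \<in> X. C x y}"
    unfolding set_eq_iff * by auto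
  show "dist_sphere (commuting_graph G X) 3 x = {y \<in> X. \<not> path2 x y}"
    unfolding set_eq_iff * using 2 assms(1) by auto
qed

text \<open>Connectedness of a digraph refers to its symmetric closure; reachability holds in the
  graph itself and carries over.\<close>

lemma connected_commuting_graph:
  assumes "X \<noteq> {}" "\<And>x y. x \<in> X \<Longrightarrow> y \<in> X \<Longrightarrow> path3 x y"
  shows "Digraph_Component.connected (with_proj (commuting_graph G X))"
  unfolding connected_def
proof (rule strongly_connectedI)
  show "verts (with_proj (mk_symmetric (with_proj (commuting_graph G X)))) \<noteq> {}"
    using assms(1) by simp
next
  have step: "u \<rightarrow>\<^sup>*\<^bsub>with_proj (commuting_graph G X)\<^esub> v" if "u \<in> X" "v \<in> X" "C u v" for u v
  proof (cases "u = v")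
    case True
    hence "awalk u [] v" using that by (simp add: awalk_Nil)
    thus ?thesis by (rule reachable_awalkI)
  next
    case False
    hence "awalk u [(u, v)] v" using that by (simp add: awalk_Nil awalk_Cons)
    thus ?thesis by (rule reachable_awalkI)
  qed
  fix x y assume "x \<in> verts (with_proj (mk_symmetric (with_proj (commuting_graph G X))))"
    "y \<in> verts (with_proj (mk_symmetric (with_proj (commuting_graph G X))))"
  hence xy: "x \<in> X" "y \<in> X" by auto
  with assms(2) obtain z w where "z \<in> X" "w \<in> X" "C x z" "C z w" "C w y" unfolding path3_def by blast
  hence "x \<rightarrow>\<^sup>*\<^bsub>with_proj (commuting_graph G X)\<^esub> y" using xy step reachable_trans by metis
  thus "x \<rightarrow>\<^sup>*\<^bsub>with_proj (mk_symmetric (with_proj (commuting_graph G X)))\<^esub> y"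
    by (rule reachable_mk_symmetricI)
qed

lemma graph_diameter_3:
  assumes "\<And>x y. x \<in> X \<Longrightarrow> y \<in> X \<Longrightarrow> path3 x y" and "x \<in> X" "y \<in> X" "\<not> path2 x y"
  shows "graph_diameter (commuting_graph G X) = 3"
proof (rule antisym)
  have "graph_dist (commuting_graph G X) u v \<le> 3" if "u \<in> X" "v \<in> X" for u v
    using graph_dist_cases[of u v] that assms(1)[of u v] by simp
  thus "graph_diameter (commuting_graph G X) \<le> 3"
    unfolding graph_diameter_def by (auto intro!: SUP_least)
  have "graph_dist (commuting_graph G X) x y = 3"
    using graph_dist_cases[of x y] assms unfolding path2_def by auto
  hence "3 \<le> (SUP v\<in>X. graph_dist (commuting_graph G X) x v)"
    using assms(3) by (intro SUP_upper2[of y]) auto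
  also have "\<dots> \<le> (SUP u\<in>X. SUP v\<in>X. graph_dist (commuting_graph G X) u v)"
    using assms(2) by (rule SUP_upper)
  finally show "3 \<le> graph_diameter (commuting_graph G X)" by (simp add: graph_diameter_def)
qed

end

section \<open>Transfer to matrices\<close>

definition mat2 :: "'a::ring_1 m2 \<Rightarrow> 'a mat" where
  "mat2 x = mat 2 2 (\<lambda>(i, j). if i = 0 then if j = 0 then m11 x else m12 x
     else if j = 0 then m21 x else m22 x)"

text \<open>A ring isomorphism onto the 4x4 matrices, which carries \<open>conj_to\<close> and
  \<open>comm\<close> to conjugacy and commuting in \<open>GL 4\<close>.\<close>

definition to_mat :: "'a::ring_1 m2 m2 \<Rightarrow> 'a mat" where
  "to_mat y = four_block_mat (mat2 (m11 y)) (mat2 (m12 y)) (mat2 (m21 y)) (mat2 (m22 y))"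

lemma mat2_carrier [simp]: "mat2 x \<in> carrier_mat 2 2" "dim_row (mat2 x) = 2" "dim_col (mat2 x) = 2"
  by (simp_all add: mat2_def)

lemma mat2_add: "mat2 (x + y) = mat2 x + mat2 y"
  by (rule eq_matI) (auto simp: mat2_def)

lemma mat2_mult: "mat2 (x * y) = mat2 x * mat2 (y :: 'a::comm_ring_1 m2)"
  by (rule eq_matI)
    (auto simp: mat2_def scalar_prod_def numeral_2_eq_2 less_Suc_eq lessThan_Suc atLeast0LessThan)

lemma mat2_const: "mat2 0 = 0\<^sub>m 2 2" "mat2 1 = 1\<^sub>m 2" "mat2 (- x) = - mat2 x"
  by (rule eq_matI, auto simp: mat2_def)+

lemma to_mat_carrier [simp]: "to_mat y \<in> carrier_mat 4 4"
  using four_block_carrier_mat[of "mat2 (m11 y)" 2 2 "mat2 (m22 y)" 2 2] by (simp add: to_mat_def)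

lemma to_mat_dim [simp]: "dim_row (to_mat y) = 4" "dim_col (to_mat y) = 4"
  using to_mat_carrier[of y] by (simp_all only: carrier_matD)

lemma to_mat_mult: "to_mat (x * y) = to_mat x * to_mat (y :: 'a::comm_ring_1 m2 m2)"
  unfolding to_mat_def
  by (subst mult_four_block_mat[of _ 2 2 _ 2 _ 2 _ _ 2 _ 2]) (simp_all add: mat2_add mat2_mult)

lemma to_mat_1: "to_mat 1 = 1\<^sub>m 4"
  by (rule eq_matI) (auto simp: to_mat_def mat2_const)

lemma to_mat_index:
  "to_mat y $$ (0, 0) = m11 (m11 y)" "to_mat y $$ (0, 1) = m12 (m11 y)"
  "to_mat y $$ (1, 0) = m21 (m11 y)" "to_mat y $$ (1, 1) = m22 (m11 y)"
  "to_mat y $$ (0, 2) = m11 (m12 y)" "to_mat y $$ (0, 3) = m12 (m12 y)"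
  "to_mat y $$ (1, 2) = m21 (m12 y)" "to_mat y $$ (1, 3) = m22 (m12 y)"
  "to_mat y $$ (2, 0) = m11 (m21 y)" "to_mat y $$ (2, 1) = m12 (m21 y)"
  "to_mat y $$ (3, 0) = m21 (m21 y)" "to_mat y $$ (3, 1) = m22 (m21 y)"
  "to_mat y $$ (2, 2) = m11 (m22 y)" "to_mat y $$ (2, 3) = m12 (m22 y)"
  "to_mat y $$ (3, 2) = m21 (m22 y)" "to_mat y $$ (3, 3) = m22 (m22 y)"
  by (simp_all add: to_mat_def mat2_def)

lemma inj_to_mat: "inj to_mat"
  by (rule injI) (metis to_mat_index m2_eq_iff)

lemma to_mat_surj:
  assumes "A \<in> carrier_mat 4 4"
  obtains y where "A = to_mat y"
proof -
  define y where "y =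
    M2 (M2 (A $$ (0, 0)) (A $$ (0, 1)) (A $$ (1, 0)) (A $$ (1, 1)))
       (M2 (A $$ (0, 2)) (A $$ (0, 3)) (A $$ (1, 2)) (A $$ (1, 3)))
       (M2 (A $$ (2, 0)) (A $$ (2, 1)) (A $$ (3, 0)) (A $$ (3, 1)))
       (M2 (A $$ (2, 2)) (A $$ (2, 3)) (A $$ (3, 2)) (A $$ (3, 3)))"
  have lt4: "i < 4 \<longleftrightarrow> i = 0 \<or> i = 1 \<or> i = 2 \<or> i = 3" for i :: nat by auto
  have "A = to_mat y"
  proof (rule eq_matI)
    fix i j assume "i < dim_row (to_mat y)" "j < dim_col (to_mat y)"
    hence "i < 4" "j < 4" using to_mat_carrier[of y] by auto
    thus "A $$ (i, j) = to_mat y $$ (i, j)"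
      unfolding lt4 by (elim disjE; simp only: to_mat_index) (simp_all add: y_def)
  qed (use assms to_mat_carrier[of y] in auto)
  thus thesis by (rule that)
qed

lemma GL_4_carrier:
  "(A \<in> carrier (GL 4)) \<longleftrightarrow> (\<exists>g g'. A = to_mat g \<and> g * g' = (1 :: 'a::field m2 m2) \<and> g' * g = 1)"
proof
  assume "A \<in> carrier (GL 4)"
  then obtain B where AB: "A \<in> carrier_mat 4 4" "B \<in> carrier_mat 4 4" "A * B = 1\<^sub>m 4" "B * A = 1\<^sub>m 4"
    by (auto simp: GL_simps Units_def ring_mat_simps)
  then obtain g g' where g: "A = to_mat g" "B = to_mat g'" using to_mat_surj by metis
  with AB(3,4) have "to_mat (g * g') = to_mat 1" "to_mat (g' * g) = to_mat 1"
    by (simp_all add: to_mat_mult to_mat_1)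
  with g(1) show "\<exists>g g'. A = to_mat g \<and> g * g' = 1 \<and> g' * g = 1"
    using inj_to_mat by (metis injD)
next
  assume "\<exists>g g'. A = to_mat g \<and> g * g' = 1 \<and> g' * g = 1"
  then obtain g g' where g: "A = to_mat g" "g * g' = 1" "g' * g = 1" by blast
  have "to_mat g * to_mat g' = 1\<^sub>m 4" "to_mat g' * to_mat g = 1\<^sub>m 4"
    by (simp_all add: g flip: to_mat_mult to_mat_1)
  thus "A \<in> carrier (GL 4)" by (auto simp: GL_simps Units_def ring_mat_simps g(1))
qed

lemma GL_4_inv:
  assumes "g * g' = (1 :: 'a::field m2 m2)" "g' * g = 1"
  shows "inv\<^bsub>GL 4\<^esub> (to_mat g) = to_mat g'"
proof (rule group.inv_equality[OF group_GL])
  show "to_mat g' \<otimes>\<^bsub>GL 4\<^esub> to_mat g = \<one>\<^bsub>GL 4\<^esub>"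
    using assms by (simp add: GL_simps flip: to_mat_mult to_mat_1)
  show "to_mat g \<in> carrier (GL 4)" "to_mat g' \<in> carrier (GL 4)"
    using assms by (auto simp: GL_4_carrier)
qed

lemma conjugacy_class_to_mat:
  "conjugacy_class (GL 4) (to_mat t) = to_mat ` {y :: 'a::field m2 m2. conj_to t y}"
proof -
  have "to_mat g \<otimes>\<^bsub>GL 4\<^esub> to_mat t \<otimes>\<^bsub>GL 4\<^esub> inv\<^bsub>GL 4\<^esub> (to_mat g) = to_mat (g * t * g')"
    if "g * g' = 1" "g' * g = 1" for g g' :: "'a m2 m2"
    using that by (simp add: GL_4_inv GL_simps to_mat_mult)
  thus ?thesis
    unfolding conjugacy_class_def GL_4_carrier conj_to_def by (auto simp: image_iff) metis+
qed

text \<open>Reduces everything to the cardinalities of the class, of the ball \<open>N2\<close> of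
  radius 2 and of the centralizer of t in the class. The spheres are differences of these nested
  sets, and \<open>ne\<close> provides a pair at distance 3.\<close>

lemma commuting_graph_conj_class:
  fixes t :: "'a::{field, finite} m2 m2"
  defines "X \<equiv> {y. conj_to t y}"
  defines "N2 \<equiv> {y \<in> X. \<exists>z\<in>X. comm t z \<and> comm z y}"
  defines "\<Gamma> \<equiv> commuting_graph (GL 4) (conjugacy_class (GL 4) (to_mat t))"
  assumes path3: "\<forall>y\<in>X. \<exists>z\<in>X. \<exists>w\<in>X. comm t z \<and> comm z w \<and> comm w y"
    and ne: "N2 \<noteq> X"
  shows "Digraph_Component.connected (with_proj \<Gamma>)" "graph_diameter \<Gamma> = 3"
    "real (card (dist_sphere \<Gamma> 1 (to_mat t))) = real (card {y \<in> X. comm t y}) - 1"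
    "real (card (dist_sphere \<Gamma> 2 (to_mat t))) = real (card N2) - real (card {y \<in> X. comm t y})"
    "real (card (dist_sphere \<Gamma> 3 (to_mat t))) = real (card X) - real (card N2)"
proof -
  let ?G = "GL 4 :: 'a mat monoid"
  define Y where "Y = to_mat ` X"
  have \<Gamma>: "\<Gamma> = commuting_graph ?G Y"
    by (simp add: \<Gamma>_def Y_def X_def conjugacy_class_to_mat)
  have C: "to_mat x \<otimes>\<^bsub>?G\<^esub> to_mat y = to_mat y \<otimes>\<^bsub>?G\<^esub> to_mat x \<longleftrightarrow> comm x y" for x y
    by (simp add: GL_simps inj_eq[OF inj_to_mat] flip: to_mat_mult)
  have t: "t \<in> X" by (simp add: X_def)
  have p2: "path2 ?G Y (to_mat x) (to_mat y) \<longleftrightarrow> (\<exists>z\<in>X. comm x z \<and> comm z y)" for x y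
    by (auto simp: path2_def Y_def C)
  have p3: "path3 ?G Y (to_mat x) (to_mat y) \<longleftrightarrow> (\<exists>z\<in>X. \<exists>w\<in>X. comm x z \<and> comm z w \<and> comm w y)" for x y
    by (auto simp: path3_def Y_def C)
  \<comment> \<open>Conjugation is transitive on the class and preserves commuting, so paths
    starting at t yield paths starting anywhere.\<close>
  have all3: "\<exists>z\<in>X. \<exists>w\<in>X. comm x z \<and> comm z w \<and> comm w y" if "x \<in> X" "y \<in> X" for x y
  proof -
    from that(1) obtain g g' where g: "g * g' = 1" "g' * g = 1" "x = g * t * g'"
      unfolding X_def conj_to_def by blast
    have X_conj: "h * u * h' \<in> X" if "h * h' = 1" "h' * h = 1" "u \<in> X" for h h' u
      using that conj_to_trans[OF _ conj_toI'[OF that(1,2)]] by (auto simp: X_def)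
    have "g' * y * g \<in> X" using g that(2) by (intro X_conj)
    with path3 obtain z w where zw: "z \<in> X" "w \<in> X" "comm t z" "comm z w" "comm w (g' * y * g)" by blast
    have "g * (g' * y * g) * g' = y" by (simp add: mult.assoc g conj_cancel[OF g(1)])
    moreover note conj_comm[OF g(2) zw(3)] conj_comm[OF g(2) zw(4)] conj_comm[OF g(2) zw(5)]
    moreover note X_conj[OF g(1,2) zw(1)] X_conj[OF g(1,2) zw(2)]
    ultimately show ?thesis unfolding g(3) by metis
  qed
  have Y3: "path3 ?G Y x y" if "x \<in> Y" "y \<in> Y" for x y
    using that all3 p3 unfolding Y_def by blast
  show "Digraph_Component.connected (with_proj \<Gamma>)"
    unfolding \<Gamma> using t Y3 by (intro connected_commuting_graph) (auto simp: Y_def)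
  obtain y where "y \<in> X" "y \<notin> N2" using ne unfolding N2_def by blast
  hence far: "\<not> path2 ?G Y (to_mat t) (to_mat y)" unfolding p2 N2_def by blast
  have ty: "to_mat t \<in> Y" "to_mat y \<in> Y" using t \<open>y \<in> X\<close> by (auto simp: Y_def)
  show "graph_diameter \<Gamma> = 3" unfolding \<Gamma>
    by (rule graph_diameter_3[rotated, OF ty far]) (rule Y3)
  note spheres = dist_spheres[of "to_mat t" Y ?G, folded \<Gamma>]
  have card: "card (to_mat ` A) = card A" for A :: "'a m2 m2 set"
    by (rule card_image) (use inj_to_mat in \<open>auto intro: inj_on_subset\<close>)
  have tY: "to_mat t \<in> Y" using t by (simp add: Y_def)
  have img: "{y \<in> Y. P y} = to_mat ` {x \<in> X. P (to_mat x)}" for P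
    unfolding Y_def by blast
  note spheres = spheres[OF tY Y3[OF tY], unfolded img C p2]
  have "dist_sphere \<Gamma> 1 (to_mat t) = to_mat ` ({y \<in> X. comm t y} - {t})"
    using spheres(1) by (simp add: image_set_diff[OF inj_to_mat])
  hence "card (dist_sphere \<Gamma> 1 (to_mat t)) = card ({y \<in> X. comm t y} - {t})" by (simp only: card)
  \<comment> \<open>t commutes with itself but has distance 0, whence the -1.\<close>
  moreover have "card {y \<in> X. comm t y} = Suc (card ({y \<in> X. comm t y} - {t}))"
    by (rule card.remove) (use t in auto)
  ultimately show "real (card (dist_sphere \<Gamma> 1 (to_mat t))) = real (card {y \<in> X. comm t y}) - 1"
    by linarith
  have sub: "{y \<in> X. comm t y} \<subseteq> N2" using t unfolding N2_def by blast
  have "dist_sphere \<Gamma> 2 (to_mat t) = to_mat ` (N2 - {y \<in> X. comm t y})"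
    using spheres(2) by (simp add: image_set_diff[OF inj_to_mat] N2_def)
  hence "card (dist_sphere \<Gamma> 2 (to_mat t)) = card N2 - card {y \<in> X. comm t y}"
    using sub by (simp only: card) (rule card_Diff_subset, auto)
  thus "real (card (dist_sphere \<Gamma> 2 (to_mat t))) = real (card N2) - real (card {y \<in> X. comm t y})"
    using card_mono[OF _ sub] by (simp add: of_nat_diff)
  have sub: "N2 \<subseteq> X" unfolding N2_def by blast
  have "X - N2 = {y \<in> X. \<not> (\<exists>z\<in>X. comm t z \<and> comm z y)}" unfolding N2_def by blast
  hence "dist_sphere \<Gamma> 3 (to_mat t) = to_mat ` (X - N2)" using spheres(3) by simp
  hence "card (dist_sphere \<Gamma> 3 (to_mat t)) = card X - card N2"
    using sub by (simp only: card) (rule card_Diff_subset, auto)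
  thus "real (card (dist_sphere \<Gamma> 3 (to_mat t))) = real (card X) - real (card N2)"
    using card_mono[OF _ sub] by (simp add: of_nat_diff)
qed

lemma two_eq_zero_iff_CHAR: "(2 :: 'a::field) = 0 \<longleftrightarrow> CHAR('a) = 2"
proof
  assume "(2 :: 'a) = 0"
  hence "of_nat 2 = (0 :: 'a)" by simp
  hence "CHAR('a) dvd 2" by (simp only: of_nat_eq_0_iff_char_dvd)
  hence "CHAR('a) \<le> 2" "CHAR('a) \<noteq> 0"
    by (simp add: dvd_imp_le, metis dvd_0_left zero_neq_numeral)
  moreover have "CHAR('a) \<noteq> 1" by simp
  ultimately show "CHAR('a) = 2" by linarith
next
  assume "CHAR('a) = 2"
  thus "(2 :: 'a) = 0" using of_nat_CHAR[where 'a = 'a] by simp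
qed

theorem proposition3p5:
  fixes G :: "'a::{field, finite} mat monoid"
    and t :: "'a mat"
    and X\<^sub>2 :: "'a mat set"
    and \<Gamma> :: "'a mat pair_pre_digraph"
    and q :: real
  defines "G \<equiv> GL 4"
    and "t \<equiv> invol_4_2"
    and "X\<^sub>2 \<equiv> conjugacy_class G t"
    and "\<Gamma> \<equiv> commuting_graph G X\<^sub>2"
    and "q \<equiv> real CARD('a)"
  shows "Digraph_Component.connected (with_proj \<Gamma>) \<and> graph_diameter \<Gamma> = 3 \<and>
    real (card (dist_sphere \<Gamma> 1 t)) =
      (if CHAR('a) = 2 then 2*q^4 - q^3 - 2*q^2 + q - 1
       else q^2 * (q + 1)^2 + 1) \<and>
    real (card (dist_sphere \<Gamma> 2 t)) =
      (if CHAR('a) = 2 then q^2 * (q^5 + q^4 - q^3 - 4*q^2 + q + 2)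
       else 1/2 * (q - 1) * (q + 1) * (q^6 + 3*q^5 + q^4 + 3*q^3 + 8*q^2 + 4*q + 4)) \<and>
    real (card (dist_sphere \<Gamma> 3 t)) =
      (if CHAR('a) = 2 then q^4 * (q^4 - q^3 - q^2 + 1)
       else 1/2 * q * (q - 1)^2 * (q + 1) * (q^4 + 5*q^2 + 6*q + 4))"
proof (cases "CHAR('a) = 2")
  note q_eq = q_def
  have q2: "q \<ge> 2" using card_UNIV_ge_2[where 'a = 'a] by (simp add: q_def)
  case True
  hence "(1 :: 'a) + 1 = 0" using two_eq_zero_iff_CHAR[where 'a = 'a] by simp
  then interpret even_char_finite "TYPE('a)" by unfold_locales
  \<comment> \<open>Adding 1 is compatible with conjugation and with commuting, so the class is 1 +
    S and all counts transfer from \<open>S\<close>.\<close>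
  let ?t = "1 + n1 :: 'a m2 m2"
  define X where "X = {y. conj_to ?t y}"
  define N2 where "N2 = {y \<in> X. \<exists>z\<in>X. comm ?t z \<and> comm z y}"
  have q: "even_char_finite.q TYPE('a) = q" by (simp add: q_eq even_char_finite.q_def[OF even_char_finite_axioms])
  have t: "t = to_mat ?t"
    unfolding t_def invol_4_2_def using True
    by (simp add: to_mat_def mat2_const)
  have conj: "conj_to (1 + x) (1 + y) \<longleftrightarrow> conj_to x y" for x y :: "'a m2 m2"
    unfolding conj_to_def by (intro ex_cong1 conj_cong refl) (simp add: distrib_left distrib_right)
  have X: "X = (+) 1 ` S"
  proof -
    have "y \<in> X \<longleftrightarrow> y - 1 \<in> S" for y
      using conj[of n1 "y - 1"] by (simp add: X_def S_eq)
    thus ?thesis by (force simp: image_iff)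
  qed
  have comm: "comm (1 + x) (1 + y) \<longleftrightarrow> comm x y" for x y :: "'a m2 m2"
    by (simp add: distrib_left distrib_right add_ac)
  have card: "card ((+) 1 ` A) = card A" for A :: "'a m2 m2 set"
    by (rule card_image) simp
  have "N2 = (+) 1 ` {y \<in> S. near y}" unfolding N2_def X near_def
    by (auto simp: comm image_iff)
  hence N2: "card N2 = card {y \<in> S. near y}" by (simp only: card)
  have "{y \<in> X. comm ?t y} = (+) 1 ` {y \<in> S. comm n1 y}" unfolding X by (auto simp: comm)
  hence C: "card {y \<in> X. comm ?t y} = card {y \<in> S. comm n1 y}" by (simp only: card)
  have XS: "card X = card S" unfolding X card ..
  have "card {y \<in> S. near y} + card {y \<in> S. \<not> near y} = card S"
    by (subst card_Un_disjoint[symmetric]) (auto intro: arg_cong[of _ _ card])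
  hence near: "real (card N2) = real (card X) - q ^ 4 * (q ^ 4 - q ^ 3 - q\<^sup>2 + 1)"
    using card_far unfolding q N2 XS by linarith
  \<comment> \<open>The factor equals q^2 (q^2 - q - 1) + 1 and is positive from q = 2 on, so
    elements at distance 3 exist over every field of characteristic 2.\<close>
  have "2 * 1 \<le> q * (q - 1)" using q2 by (intro mult_mono) auto
  hence "0 < q\<^sup>2 * (q\<^sup>2 - q - 1) + 1" using q2
    by (intro add_nonneg_pos mult_nonneg_nonneg) (auto simp: power2_eq_square algebra_simps)
  hence "0 < q ^ 4 - q ^ 3 - q\<^sup>2 + 1" by (simp add: power_expand algebra_simps)
  hence "0 < q ^ 4 * (q ^ 4 - q ^ 3 - q\<^sup>2 + 1)" using q2 by simp
  hence ne: "N2 \<noteq> X" using near by auto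
  have path3: "\<forall>y\<in>X. \<exists>z\<in>X. \<exists>w\<in>X. comm ?t z \<and> comm z w \<and> comm w y"
  proof
    fix y assume "y \<in> X"
    then obtain m where m: "y = 1 + m" "m \<in> S" unfolding X by blast
    from near3_all[OF sqrt_exists m(2)] obtain z w where
      "z \<in> S" "w \<in> S" "comm n1 z" "comm z w" "comm w m" unfolding near3_def by blast
    thus "\<exists>z\<in>X. \<exists>w\<in>X. comm ?t z \<and> comm z w \<and> comm w y" unfolding X m(1)
      by (intro bexI[of _ "1 + z"] bexI[of _ "1 + w"]) (simp_all only: comm imageI simp_thms)
  qed
  note res = commuting_graph_conj_class[of ?t, folded X_def, folded N2_def, OF path3 ne,
      folded t G_def, folded X\<^sub>2_def, folded \<Gamma>_def]
  have "real (card (dist_sphere \<Gamma> 1 t)) = 2*q^4 - q^3 - 2*q^2 + q - 1"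
    unfolding res(3) C card_comm q ..
  moreover have "real (card (dist_sphere \<Gamma> 2 t)) = q^2 * (q^5 + q^4 - q^3 - 4*q^2 + q + 2)"
    unfolding res(4) near C card_comm XS card_S q by (simp add: algebra_simps eval_nat_numeral)
  moreover have "real (card (dist_sphere \<Gamma> 3 t)) = q^4 * (q^4 - q^3 - q^2 + 1)"
    unfolding res(5) near XS by simp
  ultimately show ?thesis using res(1,2) True by simp
next
  note q_eq = q_def
  have q2: "q \<ge> 2" using card_UNIV_ge_2[where 'a = 'a] by (simp add: q_def)
  case False
  hence "(2 :: 'a) \<noteq> 0" using two_eq_zero_iff_CHAR[where 'a = 'a] by simp
  then interpret odd_char_finite "TYPE('a)" by unfold_locales
  define X where "X = {y. conj_to t1 y}"
  define N2 where "N2 = {y \<in> X. \<exists>z\<in>X. comm t1 z \<and> comm z y}"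
  have q: "odd_char_finite.q TYPE('a) = q" by (simp add: q_eq odd_char_finite.q_def[OF odd_char_finite_axioms])
  have t: "t = to_mat t1"
    unfolding t_def invol_4_2_def using False
    by (simp add: to_mat_def mat2_const bdiag_def)
  have X: "X = S" by (simp add: X_def S_eq)
  have N2: "N2 = {y \<in> S. near y}" unfolding N2_def X near_def ..
  have "card {y \<in> S. near y} + card {y \<in> S. \<not> near y} = card S"
    by (subst card_Un_disjoint[symmetric]) (auto intro: arg_cong[of _ _ card])
  hence near: "real (card N2) = real (card X) -
      1/2 * q * (q - 1)^2 * (q + 1) * (q^4 + 5*q^2 + 6*q + 4)"
    using card_far unfolding q N2 X by linarith
  have "0 < 1/2 * q * (q - 1)^2 * (q + 1) * (q^4 + 5*q^2 + 6*q + 4)"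
    using q2 by (intro mult_pos_pos add_pos_pos) auto
  hence ne: "N2 \<noteq> X" using near by auto
  have path3: "\<forall>y\<in>X. \<exists>z\<in>X. \<exists>w\<in>X. comm t1 z \<and> comm z w \<and> comm w y"
    using near3_all unfolding X near3_def ..
  note res = commuting_graph_conj_class[of t1, folded X_def, folded N2_def, OF path3 ne,
      folded t G_def, folded X\<^sub>2_def, folded \<Gamma>_def]
  have C: "real (card {y \<in> X. comm t1 y}) = q\<^sup>2 * (q + 1)\<^sup>2 + 2"
    using card_comm unfolding X q .
  have "real (card (dist_sphere \<Gamma> 1 t)) = q^2 * (q + 1)^2 + 1"
    unfolding res(3) C by simp
  moreover have "real (card (dist_sphere \<Gamma> 2 t)) =
      1/2 * (q - 1) * (q + 1) * (q^6 + 3*q^5 + q^4 + 3*q^3 + 8*q^2 + 4*q + 4)"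
    unfolding res(4) near C unfolding X card_S q by (simp add: field_simps eval_nat_numeral)
  moreover have "real (card (dist_sphere \<Gamma> 3 t)) =
      1/2 * q * (q - 1)^2 * (q + 1) * (q^4 + 5*q^2 + 6*q + 4)"
    unfolding res(5) near by simp
  ultimately show ?thesis using res(1,2) False by simp
qed

end
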